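(* Let $X$ be a curve of genus $g$ over a finite field, $P,Q$ rational points, and $B_0,C_0$ divisor classes of degree zero. Partition $\{-2g,\ldots,-1\}=N_1\cup G_1$, $\{0,\ldots,2g-1\}=N_2\cup G_2$, $\{2g,\ldots,4g-1\}=N_3\cup G_3$, where $k\in N_1\iff B_0-C_0+2gQ+kP\in\Gamma_P$, $k\in N_2\iff B_0+kP\in\Gamma_P$, $k\in N_3\iff B_0-C_0-2gQ+kP\in\Gamma_P$ (and $G_i$ is the complement of $N_i$ in the respective interval). Then $\#N_i=\#G_i=g$ for $i=1,2,3$, and \[ I_P(B_0,C_0+2gQ)=N_2\cup G_3,\qquad I_P(B_0-C_0+2gQ,-C_0+2gQ)=N_1\cup G_2 . \]
   Context: $L(E)=\{f:(f)+E\ge0\}\cup\{0\}$; $\Gamma_P$ is the set of divisor classes $A$ with $L(A)\neq L(A-P)$. For divisors $B,C$, $I_P(B,C)=\{i\in\mathbb{Z} : B+iP\in\Gamma_P,\ B-C+iP\notin\Gamma_P\}$. *)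

theory Defs
  imports Complex_Main "HOL-Library.Poly_Mapping" "HOL-Computational_Algebra.Polynomial"
begin

text \<open>
  A (smooth, projective, absolutely irreducible) curve over a finite, hence perfect, field \<open>K\<close> is
  represented by its function field: a field \<open>F\<close> that is a finite extension of \<open>K(x)\<close> for some
  \<open>x\<close> transcendental over \<open>K\<close>, and in which \<open>K\<close> is algebraically closed. The type \<open>'f\<close> is \<open>F\<close>,
  the type \<open>'k\<close> is \<open>K\<close>, and \<open>emb\<close> is the inclusion of \<open>K\<close> in \<open>F\<close>.
\<close>

definition algebraic_over :: "('k::field \<Rightarrow> 'f::field) \<Rightarrow> 'f \<Rightarrow> bool" where
  "algebraic_over emb z \<longleftrightarrow> (\<exists>p. p \<noteq> 0 \<and> poly (map_poly emb p) z = 0)"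

definition simple_subfield :: "('k::field \<Rightarrow> 'f::field) \<Rightarrow> 'f \<Rightarrow> 'f set" where
  "simple_subfield emb x =
    {poly (map_poly emb p) x / poly (map_poly emb q) x | p q. poly (map_poly emb q) x \<noteq> 0}"

definition finite_over :: "'f::field set \<Rightarrow> bool" where
  "finite_over E \<longleftrightarrow> (\<exists>S. finite S \<and> (\<forall>z. \<exists>a. a ` S \<subseteq> E \<and> z = (\<Sum>s\<in>S. a s * s)))"

locale function_field =
  fixes emb :: "'k::field \<Rightarrow> 'f::field"
  assumes emb_one: "emb 1 = 1"
    and emb_add: "emb (a + b) = emb a + emb b"
    and emb_mult: "emb (a * b) = emb a * emb b"
    and constants_algebraically_closed: "algebraic_over emb z \<Longrightarrow> z \<in> range emb"
    and finite_over_rational: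
      "\<exists>x. \<not> algebraic_over emb x \<and> finite_over (simple_subfield emb x)"

text \<open>
  The closed points of the curve are the places of \<open>F/K\<close>. A place is given by its normalized
  discrete valuation, as an integer-valued function; the value at \<open>0\<close> (mathematically infinity)
  is fixed to the dummy \<open>0\<close>, so that distinct functions are distinct places.
\<close>

definition places :: "('k::field \<Rightarrow> 'f::field) \<Rightarrow> ('f \<Rightarrow> int) set" where
  "places emb = {v. v 0 = 0
     \<and> (\<forall>x y. x \<noteq> 0 \<longrightarrow> y \<noteq> 0 \<longrightarrow> v (x * y) = v x + v y)
     \<and> (\<forall>x y. x \<noteq> 0 \<longrightarrow> y \<noteq> 0 \<longrightarrow> x + y \<noteq> 0 \<longrightarrow> min (v x) (v y) \<le> v (x + y))
     \<and> (\<forall>c. c \<noteq> 0 \<longrightarrow> v (emb c) = 0)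
     \<and> (\<exists>t. t \<noteq> 0 \<and> v t = 1)}"

definition local_ring :: "('f::field \<Rightarrow> int) \<Rightarrow> 'f set" where
  "local_ring P = {z. z = 0 \<or> 0 \<le> P z}"

definition max_ideal :: "('f::field \<Rightarrow> int) \<Rightarrow> 'f set" where
  "max_ideal P = {z. z = 0 \<or> 0 < P z}"

text \<open>\<open>S\<close> represents a \<open>K\<close>-basis of the residue field \<open>local_ring P / max_ideal P\<close>.\<close>

definition residue_basis :: "('k::field \<Rightarrow> 'f::field) \<Rightarrow> ('f \<Rightarrow> int) \<Rightarrow> 'f set \<Rightarrow> bool" where
  "residue_basis emb P S \<longleftrightarrow> finite S \<and> S \<subseteq> local_ring P
     \<and> (\<forall>c. (\<Sum>s\<in>S. emb (c s) * s) \<in> max_ideal P \<longrightarrow> (\<forall>s\<in>S. c s = 0))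
     \<and> (\<forall>z\<in>local_ring P. \<exists>c. z - (\<Sum>s\<in>S. emb (c s) * s) \<in> max_ideal P)"

definition place_degree :: "('k::field \<Rightarrow> 'f::field) \<Rightarrow> ('f \<Rightarrow> int) \<Rightarrow> nat" where
  "place_degree emb P = (THE n. \<exists>S. residue_basis emb P S \<and> card S = n)"

definition rational_points :: "('k::field \<Rightarrow> 'f::field) \<Rightarrow> ('f \<Rightarrow> int) set" where
  "rational_points emb = {P \<in> places emb. place_degree emb P = 1}"

type_synonym 'f divisor = "('f \<Rightarrow> int) \<Rightarrow>\<^sub>0 int"

definition divisors :: "('k::field \<Rightarrow> 'f::field) \<Rightarrow> 'f divisor set" where
  "divisors emb = {D. Poly_Mapping.keys D \<subseteq> places emb}"

definition degree_divisor :: "('k::field \<Rightarrow> 'f::field) \<Rightarrow> 'f divisor \<Rightarrow> int" where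
  "degree_divisor emb D =
    (\<Sum>P\<in>Poly_Mapping.keys D. Poly_Mapping.lookup D P * int (place_degree emb P))"

text \<open>The coefficient of the principal divisor \<open>(f)\<close> at the place \<open>P\<close> is \<open>P f\<close>.\<close>

definition RR_space :: "('k::field \<Rightarrow> 'f::field) \<Rightarrow> 'f divisor \<Rightarrow> 'f set" where
  "RR_space emb E =
    {f. f \<noteq> 0 \<and> (\<forall>P\<in>places emb. 0 \<le> P f + Poly_Mapping.lookup E P)} \<union> {0}"

definition RR_dim :: "('k::field \<Rightarrow> 'f::field) \<Rightarrow> 'f divisor \<Rightarrow> nat" where
  "RR_dim emb E = vector_space.dim (\<lambda>c z. emb c * z) (RR_space emb E)"

text \<open>The supremum is a maximum, by Riemann's theorem.\<close>

definition genus :: "('k::field \<Rightarrow> 'f::field) \<Rightarrow> nat" where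
  "genus emb = nat (SUP A\<in>divisors emb. degree_divisor emb A - int (RR_dim emb A) + 1)"

definition linearly_equivalent ::
    "('k::field \<Rightarrow> 'f::field) \<Rightarrow> 'f divisor \<Rightarrow> 'f divisor \<Rightarrow> bool" where
  "linearly_equivalent emb D E \<longleftrightarrow>
    (\<exists>f. f \<noteq> 0 \<and> (\<forall>P\<in>places emb. Poly_Mapping.lookup (D - E) P = P f))"

definition divisor_class :: "('k::field \<Rightarrow> 'f::field) \<Rightarrow> 'f divisor \<Rightarrow> 'f divisor set" where
  "divisor_class emb D = {E \<in> divisors emb. linearly_equivalent emb E D}"

definition divisor_classes0 :: "('k::field \<Rightarrow> 'f::field) \<Rightarrow> 'f divisor set set" where
  "divisor_classes0 emb = {divisor_class emb D | D. D \<in> divisors emb \<and> degree_divisor emb D = 0}"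

text \<open>The group operations on divisor classes, i.e. on cosets of the group of principal divisors.\<close>

definition class_plus :: "'f divisor set \<Rightarrow> 'f divisor set \<Rightarrow> 'f divisor set"
    (infixl \<open>+\<^sub>c\<close> 65) where
  "A +\<^sub>c B = {D + E | D E. D \<in> A \<and> E \<in> B}"

definition class_minus :: "'f divisor set \<Rightarrow> 'f divisor set \<Rightarrow> 'f divisor set"
    (infixl \<open>-\<^sub>c\<close> 65) where
  "A -\<^sub>c B = {D - E | D E. D \<in> A \<and> E \<in> B}"

definition class_uminus :: "'f divisor set \<Rightarrow> 'f divisor set" where
  "class_uminus A = uminus ` A"

definition point_class :: "('k::field \<Rightarrow> 'f::field) \<Rightarrow> int \<Rightarrow> ('f \<Rightarrow> int) \<Rightarrow> 'f divisor set" where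
  "point_class emb n P = divisor_class emb (Poly_Mapping.single P n)"

definition Gamma :: "('k::field \<Rightarrow> 'f::field) \<Rightarrow> ('f \<Rightarrow> int) \<Rightarrow> 'f divisor set set" where
  "Gamma emb P = {divisor_class emb D | D. D \<in> divisors emb
     \<and> RR_space emb D \<noteq> RR_space emb (D - Poly_Mapping.single P 1)}"

definition I_set ::
    "('k::field \<Rightarrow> 'f::field) \<Rightarrow> ('f \<Rightarrow> int) \<Rightarrow> 'f divisor set \<Rightarrow> 'f divisor set \<Rightarrow> int set" where
  "I_set emb P B C = {i. B +\<^sub>c point_class emb i P \<in> Gamma emb P
     \<and> B -\<^sub>c C +\<^sub>c point_class emb i P \<notin> Gamma emb P}"

end

theory Submission
  imports Defs
begin

text \<open>
  Since \<open>P\<close> is rational, the dimension \<open>l(D + kP)\<close> grows by one exactly at the \<open>k\<close> with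
  \<open>D + kP \<in> \<Gamma>\<^sub>P\<close>. Classes of negative degree are never in \<open>\<Gamma>\<^sub>P\<close>, and classes of degree at
  least \<open>2g\<close> always are, because \<open>l(D) = deg D + 1 - g\<close> as soon as \<open>deg D \<ge> 2g - 1\<close>; a telescoping
  sum over \<open>2g\<close> consecutive degrees gives the cardinalities, and the sets \<open>I\<^sub>P\<close> are read off degree by
  degree.

  The exact formula in degree \<open>\<ge> 2g - 1\<close> needs duality only in a weak form. Let \<open>W(D)\<close> (below \<open>polar D\<close>) be the sum of the
  functions satisfying the condition of \<open>L(D)\<close> at \<open>P\<close> and of those satisfying it away from \<open>P\<close>.
  Riemann's theorem gives \<open>dim F/W(D) = l(D) - deg D - 1 + g\<close>. If this is positive, a nonzero
  functional \<open>\<omega>\<close> on \<open>F/W(D)\<close> makes \<open>f \<mapsto> \<omega>(f \<cdot> _)\<close> an embedding of \<open>L(D)\<close> into the dual of \<open>F/W(0)\<close>,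
  so \<open>l(D) \<le> g\<close> and therefore \<open>deg D \<le> 2g - 2\<close>.

  Riemann's theorem rests on \<open>deg (x)\<^sub>0 = deg (x)\<^sub>\<infinity> = [F : K(x)]\<close>, where the field degree is replaced by
  the maximal number of elements that are linearly independent over \<open>K[x]\<close>.
\<close>

subsection \<open>Linear algebra modulo a subspace\<close>

text \<open>Local rings, \<open>polar D\<close> and the function field itself have infinite
  dimension over \<open>K\<close>, and only the quotients of neighbouring spaces are finite; hence
  all dimensions are taken modulo a subspace. Every finiteness statement rests on the single bound
  \<open>poly_indep_bounded\<close>: residue degrees, numbers of zeros, and even the discreteness of
  the valuation rings produced by Zorn's lemma, because a violation would yield too many elements
  independent over some \<open>K[y]\<close>. Those valuation rings supply zeros of nonconstant
  functions, which give \<open>L(0) = K\<close> and the positive degree in Riemann's theorem. In the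
  duality argument an upper bound for \<open>dim F/W(D)\<close> is combined with a separate
  treatment of the case \<open>W(D) = F\<close>.\<close>

locale scalar_space = vector_space scale for scale :: "'a::field \<Rightarrow> 'b::ab_group_add \<Rightarrow> 'b" (infixr \<open>*s\<close> 75)
begin

text \<open>Same shape as \<open>residue_basis\<close>, so that place degrees become instances of
  \<open>rdim\<close>. In effect a basis of the image of \<open>V\<close> in the quotient by
  \<open>W\<close>.\<close>

definition basis_mod :: "'b set \<Rightarrow> 'b set \<Rightarrow> 'b set \<Rightarrow> bool" where
  "basis_mod W V S \<longleftrightarrow> finite S \<and> S \<subseteq> V
     \<and> (\<forall>c. (\<Sum>s\<in>S. c s *s s) \<in> W \<longrightarrow> (\<forall>s\<in>S. c s = 0))
     \<and> (\<forall>z\<in>V. \<exists>c. z - (\<Sum>s\<in>S. c s *s s) \<in> W)"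

lemma basis_modD:
  assumes "basis_mod W V S"
  shows "finite S" "S \<subseteq> V" "(\<Sum>s\<in>S. c s *s s) \<in> W \<Longrightarrow> \<forall>s\<in>S. c s = 0"
    "z \<in> V \<Longrightarrow> \<exists>c. z - (\<Sum>s\<in>S. c s *s s) \<in> W"
  using assms by (auto simp: basis_mod_def)

definition fin_mod :: "'b set \<Rightarrow> 'b set \<Rightarrow> bool" where
  "fin_mod W V \<longleftrightarrow> (\<exists>S. basis_mod W V S)"

definition rdim :: "'b set \<Rightarrow> 'b set \<Rightarrow> nat" where
  "rdim W V = card (SOME S. basis_mod W V S)"

text \<open>Two equal entries would satisfy the relation with coefficients 1 and -1, so independence
  as an indexed family forces \<open>u\<close> to be injective, and the exchange bound for
  independent sets applies.\<close>

lemma card_le_span: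
  assumes "finite I" "finite S" "u ` I \<subseteq> span S"
    and ind: "\<And>c. (\<Sum>i\<in>I. c i *s u i) = 0 \<Longrightarrow> \<forall>i\<in>I. c i = 0"
  shows "card I \<le> card S"
proof -
  have inj: "inj_on u I"
  proof (rule inj_onI, rule ccontr)
    fix i j assume ij: "i \<in> I" "j \<in> I" "u i = u j" "i \<noteq> j"
    define c :: "_ \<Rightarrow> 'a" where "c = (\<lambda>k. if k = i then 1 else if k = j then -1 else 0)"
    have "(\<Sum>k\<in>I. c k *s u k) = (\<Sum>k\<in>{i,j}. c k *s u k)"
      by (rule sum.mono_neutral_right) (use assms(1) ij in \<open>auto simp: c_def\<close>)
    also have "\<dots> = 0" using ij by (auto simp: c_def)
    finally have "c i = 0" using ind ij by blast
    then show False by (simp add: c_def)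
  qed
  have "independent (u ` I)"
  proof
    assume "dependent (u ` I)"
    then obtain a where a: "\<exists>v\<in>u ` I. a v \<noteq> 0" "(\<Sum>v\<in>u ` I. a v *s v) = 0"
      using dependent_finite[of "u ` I"] assms(1) by auto
    have "(\<Sum>i\<in>I. (a \<circ> u) i *s u i) = 0" using a(2) inj by (simp add: sum.reindex)
    from ind[OF this] a(1) show False by auto
  qed
  from independent_span_bound[OF assms(2) this assms(3)] inj show ?thesis
    by (simp add: card_image)
qed

text \<open>Each \<open>v i\<close> may be replaced by a combination \<open>u i\<close> of the
  \<open>w j\<close> that differs from it by an element of \<open>W\<close>; a relation among the
  \<open>u i\<close> is then a relation among the \<open>v i\<close> modulo
  \<open>W\<close>.\<close>

lemma card_le_mod:
  assumes "finite I" "finite J" "subspace W"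
    and ind: "\<And>c. (\<Sum>i\<in>I. c i *s v i) \<in> W \<Longrightarrow> \<forall>i\<in>I. c i = 0"
    and spn: "\<And>i. i \<in> I \<Longrightarrow> \<exists>c. v i - (\<Sum>j\<in>J. c j *s w j) \<in> W"
  shows "card I \<le> card J"
proof -
  obtain c where c: "\<And>i. i \<in> I \<Longrightarrow> v i - (\<Sum>j\<in>J. c i j *s w j) \<in> W" using spn by metis
  define u where "u = (\<lambda>i. \<Sum>j\<in>J. c i j *s w j)"
  have "card I \<le> card (w ` J)"
  proof (rule card_le_span)
    show "u ` I \<subseteq> span (w ` J)"
      unfolding u_def by (intro image_subsetI span_sum span_scale span_base imageI)
    fix a assume a: "(\<Sum>i\<in>I. a i *s u i) = 0"
    have "(\<Sum>i\<in>I. a i *s (v i - u i)) \<in> W"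
      using c by (auto simp: u_def intro!: subspace_sum subspace_scale assms)
    then have "(\<Sum>i\<in>I. a i *s v i) \<in> W"
      using a by (simp add: scale_right_diff_distrib sum_subtractf)
    then show "\<forall>i\<in>I. a i = 0" by (rule ind)
  qed (use assms in auto)
  also have "\<dots> \<le> card J" using assms(2) by (rule card_image_le)
  finally show ?thesis .
qed

lemma basis_mod_card_ge:
  assumes "subspace W" "basis_mod W V S" "finite I" "v ` I \<subseteq> V"
    and "\<And>c. (\<Sum>i\<in>I. c i *s v i) \<in> W \<Longrightarrow> \<forall>i\<in>I. c i = 0"
  shows "card I \<le> card S"
  by (rule card_le_mod[where w = "\<lambda>x. x" and W = W and v = v])
     (use assms in \<open>auto simp: basis_mod_def\<close>)

lemma basis_mod_unique:
  assumes "subspace W" "basis_mod W V S" "basis_mod W V T"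
  shows "card S = card T"
  using basis_mod_card_ge[OF assms(1,2), of T "\<lambda>x. x"] basis_mod_card_ge[OF assms(1,3), of S "\<lambda>x. x"]
    assms by (simp add: basis_mod_def)

lemma rdim_eq:
  assumes "subspace W" "basis_mod W V S" shows "rdim W V = card S"
  unfolding rdim_def using assms by (metis basis_mod_unique someI)

lemma fin_modE:
  assumes "subspace W" "fin_mod W V"
  obtains S where "basis_mod W V S" "card S = rdim W V"
  using assms rdim_eq by (auto simp: fin_mod_def)

text \<open>An independent set of largest size modulo \<open>W\<close> is a basis: a vector outside
  its span modulo \<open>W\<close> could be adjoined to it.\<close>

lemma fin_mod_exists:
  assumes W: "subspace W"
    and bound: "\<And>T. finite T \<Longrightarrow> T \<subseteq> V \<Longrightarrow>
       (\<And>c. (\<Sum>s\<in>T. c s *s s) \<in> W \<Longrightarrow> \<forall>s\<in>T. c s = 0) \<Longrightarrow> card T \<le> N"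
  shows "fin_mod W V" "rdim W V \<le> N"
proof -
  define Q where "Q = (\<lambda>T. finite T \<and> T \<subseteq> V \<and> (\<forall>c. (\<Sum>s\<in>T. c s *s s) \<in> W \<longrightarrow> (\<forall>s\<in>T. c s = 0)))"
  have bound': "Q T \<Longrightarrow> card T \<le> N" for T using bound by (auto simp: Q_def)
  have "Q {}" by (simp add: Q_def)
  then have "\<exists>S. Q S \<and> (\<forall>T. Q T \<longrightarrow> card T \<le> card S)"
    by (rule ex_has_greatest_nat[where b = "Suc N"]) (use bound' in \<open>auto simp: less_Suc_eq_le\<close>)
  then obtain S where S: "Q S" "\<And>T. Q T \<Longrightarrow> card T \<le> card S" by blast
  have "\<exists>c. z - (\<Sum>s\<in>S. c s *s s) \<in> W" if z: "z \<in> V" for z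
  proof (rule ccontr)
    assume "\<not> ?thesis"
    then have no: "z - (\<Sum>s\<in>S. c s *s s) \<notin> W" for c by blast
    have fin: "finite S" using S(1) by (simp add: Q_def)
    have "z \<notin> S"
    proof
      assume "z \<in> S"
      then have "(\<Sum>s\<in>S. (if s = z then 1 else 0) *s s) = z"
        using fin by (simp add: if_distrib[of "\<lambda>c. c *s _"] cong: if_cong)
      then show False using no subspace_0[OF W] by (metis diff_self)
    qed
    have "Q (insert z S)"
      unfolding Q_def
    proof (intro conjI allI impI)
      fix c assume "(\<Sum>s\<in>insert z S. c s *s s) \<in> W"
      then have s: "c z *s z + (\<Sum>s\<in>S. c s *s s) \<in> W" using fin \<open>z \<notin> S\<close> by simp
      have "c z = 0"
      proof (rule ccontr)
        assume nz: "c z \<noteq> 0"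
        have "inverse (c z) *s (c z *s z + (\<Sum>s\<in>S. c s *s s)) \<in> W"
          using s W by (simp add: subspace_scale)
        then have "z - (\<Sum>s\<in>S. (- inverse (c z) * c s) *s s) \<in> W"
          using nz by (simp add: scale_right_distrib scale_sum_right sum_negf)
        then show False using no[of "\<lambda>s. - inverse (c z) * c s"] by contradiction
      qed
      with s S(1) show "\<forall>s\<in>insert z S. c s = 0" by (auto simp: Q_def)
    qed (use S(1) z in \<open>auto simp: Q_def\<close>)
    from S(2)[OF this] \<open>z \<notin> S\<close> fin show False by simp
  qed
  then have "basis_mod W V S" using S(1) by (auto simp: basis_mod_def Q_def)
  then show "fin_mod W V" "rdim W V \<le> N"
    using bound'[OF S(1)] rdim_eq[OF W] by (auto simp: fin_mod_def)
qed

lemma rdim_mono: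
  assumes "subspace W" "fin_mod W U" "V \<subseteq> U"
  shows "fin_mod W V" "rdim W V \<le> rdim W U"
proof -
  obtain S where S: "basis_mod W U S" "card S = rdim W U" using assms fin_modE by blast
  have b: "card T \<le> rdim W U" if "finite T" "T \<subseteq> V"
    "\<And>c. (\<Sum>s\<in>T. c s *s s) \<in> W \<Longrightarrow> \<forall>s\<in>T. c s = 0" for T
    using basis_mod_card_ge[OF assms(1) S(1), of T "\<lambda>x. x"] that assms S by auto
  show "fin_mod W V" "rdim W V \<le> rdim W U"
    using fin_mod_exists[OF assms(1) b] by blast+
qed

text \<open>A basis of the lower layer together with one of the upper layer is a basis of the
  whole.\<close>

lemma rdim_trans:
  assumes W: "subspace W" and V: "subspace V" and sub: "W \<subseteq> V" "V \<subseteq> U"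
    and fin: "fin_mod W V" "fin_mod V U"
  shows "fin_mod W U" "rdim W U = rdim W V + rdim V U"
proof -
  obtain S where S: "basis_mod W V S" "card S = rdim W V" using fin W fin_modE by blast
  obtain T where T: "basis_mod V U T" "card T = rdim V U" using fin V fin_modE by blast
  have finST: "finite S" "finite T" and SV: "S \<subseteq> V" using S T by (auto simp: basis_mod_def)
  have inV: "(\<Sum>s\<in>S. c s *s s) \<in> V" for c
    using SV by (auto intro!: subspace_sum subspace_scale V)
  have disj: "S \<inter> T = {}"
  proof (rule ccontr)
    assume "S \<inter> T \<noteq> {}"
    then obtain t where t: "t \<in> S" "t \<in> T" by auto
    have "(\<Sum>s\<in>T. (if s = t then 1 else 0) *s s) = t"
      using finST t by (simp add: if_distrib[of "\<lambda>c. c *s _"] cong: if_cong)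
    then have "(\<Sum>s\<in>T. (if s = t then 1 else 0) *s s) \<in> V" using t SV by auto
    then have "\<forall>s\<in>T. (if s = t then 1 else 0) = (0::'a)"
      by (rule basis_modD(3)[OF T(1)])
    with t(2) show False by auto
  qed
  have "basis_mod W U (S \<union> T)"
    unfolding basis_mod_def
  proof (intro conjI allI impI ballI)
    show "finite (S \<union> T)" "S \<union> T \<subseteq> U" using S T sub by (auto simp: basis_mod_def)
  next
    fix c s assume c: "(\<Sum>s\<in>S \<union> T. c s *s s) \<in> W" and s: "s \<in> S \<union> T"
    have sp: "(\<Sum>s\<in>S \<union> T. c s *s s) = (\<Sum>s\<in>S. c s *s s) + (\<Sum>s\<in>T. c s *s s)"
      using disj finST by (simp add: sum.union_disjoint)
    have "(\<Sum>s\<in>T. c s *s s) = (\<Sum>s\<in>S \<union> T. c s *s s) - (\<Sum>s\<in>S. c s *s s)" using sp by simp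
    also have "\<dots> \<in> V" using c sub inV V subspace_diff by blast
    finally have cT: "\<forall>s\<in>T. c s = 0" using T(1) by (auto simp: basis_mod_def)
    then have "(\<Sum>s\<in>S. c s *s s) \<in> W" using c sp by simp
    with cT S(1) s show "c s = 0" by (auto simp: basis_mod_def)
  next
    fix z assume "z \<in> U"
    then obtain c where c: "z - (\<Sum>s\<in>T. c s *s s) \<in> V" using T(1) by (auto simp: basis_mod_def)
    then obtain d where d: "z - (\<Sum>s\<in>T. c s *s s) - (\<Sum>s\<in>S. d s *s s) \<in> W"
      using S(1) by (auto simp: basis_mod_def)
    define e where "e = (\<lambda>s. if s \<in> S then d s else c s)"
    have "(\<Sum>s\<in>S \<union> T. e s *s s) = (\<Sum>s\<in>S. e s *s s) + (\<Sum>s\<in>T. e s *s s)"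
      using disj finST by (simp add: sum.union_disjoint)
    also have "(\<Sum>s\<in>S. e s *s s) = (\<Sum>s\<in>S. d s *s s)" by (auto simp: e_def)
    also have "(\<Sum>s\<in>T. e s *s s) = (\<Sum>s\<in>T. c s *s s)" using disj by (intro sum.cong) (auto simp: e_def)
    finally show "\<exists>c. z - (\<Sum>s\<in>S \<union> T. c s *s s) \<in> W" using d
      by (intro exI[of _ e]) (simp add: algebra_simps)
  qed
  moreover from this have "rdim W U = card (S \<union> T)" using rdim_eq[OF W] by blast
  ultimately show "fin_mod W U" "rdim W U = rdim W V + rdim V U"
    using S T disj finST by (auto simp: fin_mod_def card_Un_disjoint)
qed

text \<open>Since \<open>W\<close> is the preimage of \<open>M\<close>, the map \<open>f\<close>
  induces an injection of \<open>V\<close> modulo \<open>W\<close> into \<open>R\<close> modulo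
  \<open>M\<close>. In the applications \<open>f\<close> is multiplication by a nonzero
  function.\<close>

lemma rdim_pullback_le:
  assumes f: "module_hom scale scale f" and M: "subspace M" and W: "subspace W"
    and fin: "fin_mod M R" and im: "f ` V \<subseteq> R" and W_eq: "W = {z \<in> V. f z \<in> M}" and V: "subspace V"
  shows "fin_mod W V" "rdim W V \<le> rdim M R"
proof -
  interpret f: module_hom scale scale f by (rule f)
  obtain S where S: "basis_mod M R S" "card S = rdim M R" using fin M fin_modE by blast
  have b: "card T \<le> rdim M R" if T: "finite T" "T \<subseteq> V"
    "\<And>c. (\<Sum>s\<in>T. c s *s s) \<in> W \<Longrightarrow> \<forall>s\<in>T. c s = 0" for T
  proof -
    have "card T \<le> card S"
    proof (rule basis_mod_card_ge[OF M S(1), of T f])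
      fix c assume "(\<Sum>s\<in>T. c s *s f s) \<in> M"
      then have "f (\<Sum>s\<in>T. c s *s s) \<in> M" by (simp add: f.sum f.scale)
      moreover have "(\<Sum>s\<in>T. c s *s s) \<in> V" using T V by (auto intro!: subspace_sum subspace_scale)
      ultimately show "\<forall>s\<in>T. c s = 0" using T W_eq by blast
    qed (use T im in blast)+
    then show ?thesis using S by simp
  qed
  show "fin_mod W V" "rdim W V \<le> rdim M R"
    using fin_mod_exists[OF W b] by blast+
qed

lemma rdim_pullback_eq:
  assumes f: "module_hom scale scale f" and M: "subspace M" and W: "subspace W"
    and fin: "fin_mod M R" and im: "f ` V \<subseteq> R" and W_eq: "W = {z \<in> V. f z \<in> M}" and V: "subspace V"
    and surj: "\<And>z. z \<in> R \<Longrightarrow> \<exists>y\<in>V. z - f y \<in> M"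
  shows "rdim W V = rdim M R"
proof (rule antisym)
  show "rdim W V \<le> rdim M R" using rdim_pullback_le[OF assms(1-7)] by blast
  interpret f: module_hom scale scale f by (rule f)
  obtain S where S: "basis_mod M R S" "card S = rdim M R" using fin M fin_modE by blast
  obtain T where T: "basis_mod W V T" "card T = rdim W V"
    using rdim_pullback_le(1)[OF assms(1-7)] W fin_modE by blast
  have "card S \<le> card T"
  proof (rule card_le_mod[where v = "\<lambda>x. x" and w = f and W = M])
    fix s assume "s \<in> S"
    then obtain y where y: "y \<in> V" "s - f y \<in> M" using surj S unfolding basis_mod_def by blast
    then obtain c where "y - (\<Sum>t\<in>T. c t *s t) \<in> W" using T by (auto simp: basis_mod_def)
    then have "f (y - (\<Sum>t\<in>T. c t *s t)) \<in> M" using W_eq by blast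
    then have "f y - (\<Sum>t\<in>T. c t *s f t) \<in> M" by (simp add: f.sum f.scale f.diff)
    from subspace_add[OF M y(2) this]
    show "\<exists>c. s - (\<Sum>t\<in>T. c t *s f t) \<in> M" by auto
  qed (use S T M in \<open>auto simp: basis_mod_def\<close>)
  then show "rdim M R \<le> rdim W V" using S T by simp
qed

lemma dim_eq_rdim:
  assumes V: "subspace V" and fin: "fin_mod {0} V"
  shows "dim V = rdim {0} V"
proof -
  have 0: "subspace {0}" by (simp add: subspace_def)
  obtain S where S: "basis_mod {0} V S" "card S = rdim {0} V" using fin fin_modE[OF 0] by blast
  have "dim V = card S"
  proof (rule dim_unique)
    show "independent S"
      using S(1) by (subst dependent_finite) (auto simp: basis_mod_def)
    show "V \<subseteq> span S"
    proof
      fix z assume "z \<in> V"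
      then obtain c where "z = (\<Sum>s\<in>S. c s *s s)" using S(1) by (auto simp: basis_mod_def)
      then show "z \<in> span S" by (simp add: span_sum span_scale span_base)
    qed
  qed (use S in \<open>auto simp: basis_mod_def\<close>)
  then show ?thesis using S by simp
qed

end

subsection \<open>Independence over a polynomial ring\<close>

context function_field
begin

abbreviation ev :: "'k poly \<Rightarrow> 'f \<Rightarrow> 'f" where
  "ev p x \<equiv> poly (map_poly emb p) x"

lemma emb_0 [simp]: "emb 0 = 0"
  using emb_add[of 0 0] add_left_cancel[of "emb 0" "emb 0" 0] by simp

lemma emb_1 [simp]: "emb 1 = 1"
  by (rule emb_one)

lemma emb_uminus: "emb (- a) = - emb a"
  using emb_add[of a "- a"] by (simp add: eq_neg_iff_add_eq_0 add.commute)

lemma emb_eq_0_iff [simp]: "emb a = 0 \<longleftrightarrow> a = 0"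
proof
  assume "emb a = 0"
  then have "emb (a * inverse a) = 0" by (simp add: emb_mult)
  then show "a = 0" by (cases "a = 0") auto
qed simp

sublocale K: scalar_space "\<lambda>c z. emb c * z"
  by unfold_locales (auto simp: emb_add emb_mult algebra_simps)

lemma ev_pCons [simp]: "ev (pCons a p) x = emb a + x * ev p x"
  by (simp add: map_poly_pCons)

lemma ev_1 [simp]: "ev 1 x = 1"
  by (simp add: one_pCons)

lemma ev_add: "ev (p + q) x = ev p x + ev q x"
  by (induction p q rule: poly_induct2) (auto simp: emb_add algebra_simps)

lemma ev_smult: "ev (smult a p) x = emb a * ev p x"
  by (induction p) (auto simp: emb_mult algebra_simps)

lemma ev_mult: "ev (p * q) x = ev p x * ev q x"
  by (induction p) (auto simp: ev_add ev_smult algebra_simps)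

lemma ev_sum: "ev (\<Sum>i\<in>I. p i) x = (\<Sum>i\<in>I. ev (p i) x)"
  by (induction I rule: infinite_finite_induct) (auto simp: ev_add)

lemma ev_prod: "ev (\<Prod>i\<in>I. p i) x = (\<Prod>i\<in>I. ev (p i) x)"
  by (induction I rule: infinite_finite_induct) (auto simp: ev_mult)

lemma ev_monom: "ev (monom a n) x = emb a * x ^ n"
  by (induction n) (auto simp: monom_Suc monom_0 algebra_simps)

definition poly_indep :: "'f \<Rightarrow> 'f set \<Rightarrow> bool" where
  "poly_indep y Z \<longleftrightarrow> finite Z
     \<and> (\<forall>p. (\<Sum>z\<in>Z. ev (p z) y * z) = 0 \<longrightarrow> (\<forall>z\<in>Z. p z = 0))"

text \<open>Grouping by \<open>z\<close> turns a relation over \<open>K\<close> into one with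
  polynomial coefficients. This converts independence over \<open>K[y]\<close> into many elements
  independent over \<open>K\<close>, which dimension counts can use.\<close>

lemma poly_indep_powers:
  assumes Z: "poly_indep y Z"
    and sum: "(\<Sum>i\<in>{..k} \<times> Z. emb (c i) * (y ^ fst i * snd i)) = 0"
  shows "\<forall>i\<in>{..k} \<times> Z. c i = 0"
proof -
  define p where "p = (\<lambda>z. \<Sum>j\<le>k. monom (c (j, z)) j)"
  have "(\<Sum>z\<in>Z. ev (p z) y * z) = (\<Sum>z\<in>Z. \<Sum>j\<le>k. emb (c (j, z)) * (y ^ j * z))"
    by (simp add: p_def ev_sum ev_monom sum_distrib_right mult.assoc)
  also have "\<dots> = (\<Sum>i\<in>{..k} \<times> Z. emb (c i) * (y ^ fst i * snd i))"
    by (subst sum.swap) (simp add: sum.cartesian_product case_prod_unfold)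
  finally have p0: "\<forall>z\<in>Z. p z = 0" using Z sum by (simp add: poly_indep_def)
  have "c (j, z) = 0" if "j \<le> k" "z \<in> Z" for j z
  proof -
    have "coeff (p z) j = c (j, z)" using that by (simp add: p_def coeff_sum)
    then show ?thesis using p0 that by simp
  qed
  then show ?thesis by auto
qed

text \<open>The \<open>K[x]\<close>-module generated by \<open>S\<close>, filtered by degree; the
  layer for \<open>e\<close> has at most \<open>(e + 1) * card S\<close> dimensions over
  \<open>K\<close>.\<close>

definition poly_combs :: "'f \<Rightarrow> 'f set \<Rightarrow> nat \<Rightarrow> 'f set" where
  "poly_combs x S e = {\<Sum>s\<in>S. ev (p s) x * s | p. \<forall>s\<in>S. degree (p s) \<le> e}"

lemma poly_combs_mult:
  assumes "w \<in> poly_combs x S e" "degree q \<le> d"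
  shows "ev q x * w \<in> poly_combs x S (e + d)"
proof -
  obtain p where p: "w = (\<Sum>s\<in>S. ev (p s) x * s)" "\<forall>s\<in>S. degree (p s) \<le> e"
    using assms by (auto simp: poly_combs_def)
  have "ev q x * w = (\<Sum>s\<in>S. ev (q * p s) x * s)"
    by (simp add: p ev_mult sum_distrib_left mult.assoc)
  moreover have "degree (q * p s) \<le> e + d" if "s \<in> S" for s
    using degree_mult_le[of q "p s"] p(2) assms(2) that by fastforce
  ultimately show ?thesis unfolding poly_combs_def by (intro CollectI exI[of _ "\<lambda>s. q * p s"]) auto
qed

lemma poly_combs_mono: "e \<le> d \<Longrightarrow> poly_combs x S e \<subseteq> poly_combs x S d"
  unfolding poly_combs_def using order_trans by blast

lemma poly_combs_0: "0 \<in> poly_combs x S e"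
  unfolding poly_combs_def by (intro CollectI exI[of _ "\<lambda>_. 0"]) auto

lemma poly_combs_add:
  assumes "v \<in> poly_combs x S e" "w \<in> poly_combs x S e"
  shows "v + w \<in> poly_combs x S e"
proof -
  obtain p where p: "v = (\<Sum>s\<in>S. ev (p s) x * s)" "\<forall>s\<in>S. degree (p s) \<le> e"
    using assms by (auto simp: poly_combs_def)
  obtain q where q: "w = (\<Sum>s\<in>S. ev (q s) x * s)" "\<forall>s\<in>S. degree (q s) \<le> e"
    using assms by (auto simp: poly_combs_def)
  have "v + w = (\<Sum>s\<in>S. ev (p s + q s) x * s)"
    by (simp add: p q ev_add sum.distrib algebra_simps)
  then show ?thesis unfolding poly_combs_def
    using p q by (intro CollectI exI[of _ "\<lambda>s. p s + q s"]) (auto intro: degree_add_le)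
qed

lemma poly_combs_sum: "(\<And>i. i \<in> I \<Longrightarrow> f i \<in> poly_combs x S e) \<Longrightarrow> sum f I \<in> poly_combs x S e"
  by (induction I rule: infinite_finite_induct) (auto intro: poly_combs_0 poly_combs_add)

lemma poly_combs_span:
  "poly_combs x S e \<subseteq> K.span ((\<lambda>(j, s). x ^ j * s) ` ({..e} \<times> S))"
proof
  fix w assume "w \<in> poly_combs x S e"
  then obtain p where p: "w = (\<Sum>s\<in>S. ev (p s) x * s)" "\<forall>s\<in>S. degree (p s) \<le> e"
    by (auto simp: poly_combs_def)
  have "ev (p s) x * s = (\<Sum>j\<le>e. emb (coeff (p s) j) * (x ^ j * s))" if "s \<in> S" for s
  proof -
    have "ev (p s) x = ev (\<Sum>j\<le>e. monom (coeff (p s) j) j) x"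
      using poly_as_sum_of_monoms'[of "p s" e] p(2) that by simp
    then show ?thesis by (simp add: ev_sum ev_monom sum_distrib_right mult.assoc)
  qed
  then have "w = (\<Sum>s\<in>S. \<Sum>j\<le>e. emb (coeff (p s) j) * (x ^ j * s))" using p by simp
  also have "\<dots> \<in> K.span ((\<lambda>(j, s). x ^ j * s) ` ({..e} \<times> S))"
    by (intro K.span_sum K.span_scale K.span_base) force
  finally show "w \<in> K.span ((\<lambda>(j, s). x ^ j * s) ` ({..e} \<times> S))" .
qed

lemma clear_denominator:
  assumes S: "finite S" and a: "a ` S \<subseteq> simple_subfield emb x"
  shows "\<exists>q e. ev q x \<noteq> 0 \<and> ev q x * (\<Sum>s\<in>S. a s * s) \<in> poly_combs x S e"
proof -
  have "\<forall>s\<in>S. \<exists>p q. a s = ev p x / ev q x \<and> ev q x \<noteq> 0"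
    using a by (auto simp: simple_subfield_def)
  then obtain p q where pq: "\<And>s. s \<in> S \<Longrightarrow> a s = ev (p s) x / ev (q s) x \<and> ev (q s) x \<noteq> 0"
    by metis
  define r where "r = (\<lambda>s. p s * (\<Prod>t\<in>S - {s}. q t))"
  have "ev (\<Prod>s\<in>S. q s) x \<noteq> 0" using pq S by (simp add: ev_prod)
  moreover have "ev (\<Prod>s\<in>S. q s) x * a s = ev (r s) x" if "s \<in> S" for s
    using pq[OF that] S that by (simp add: r_def ev_mult ev_prod prod.remove[of S s])
  then have "ev (\<Prod>s\<in>S. q s) x * (\<Sum>s\<in>S. a s * s) = (\<Sum>s\<in>S. ev (r s) x * s)"
    by (simp add: sum_distrib_left mult.assoc[symmetric])
  moreover have "\<forall>s\<in>S. degree (r s) \<le> (\<Sum>s\<in>S. degree (r s))"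
    using S by (auto intro: member_le_sum)
  ultimately show ?thesis unfolding poly_combs_def by blast
qed

lemma clear_denominators:
  assumes clear: "\<And>z. \<exists>q e. ev q x \<noteq> 0 \<and> ev q x * z \<in> poly_combs x S e" and Z: "finite Z"
  shows "\<exists>q e. ev q x \<noteq> 0 \<and> (\<forall>z\<in>Z. ev q x * z \<in> poly_combs x S e)"
  using Z
proof induction
  case empty
  show ?case by (intro exI[of _ 1]) simp
next
  case (insert z Z)
  then obtain q e where q: "ev q x \<noteq> 0" "\<forall>z\<in>Z. ev q x * z \<in> poly_combs x S e" by blast
  obtain r d where r: "ev r x \<noteq> 0" "ev r x * z \<in> poly_combs x S d" using clear by blast
  define N where "N = (e + degree r) + (d + degree q)"
  have "ev (q * r) x * y \<in> poly_combs x S N" if "y \<in> Z" for y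
    using poly_combs_mult[of "ev q x * y" x S e r "degree r"] q(2) that
      poly_combs_mono[of "e + degree r" N x S]
    by (auto simp: ev_mult N_def mult_ac)
  moreover have "ev (q * r) x * z \<in> poly_combs x S N"
    using poly_combs_mult[OF r(2), of q "degree q"] poly_combs_mono[of "d + degree q" N x S]
    by (auto simp: ev_mult N_def mult_ac)
  moreover have "ev (q * r) x \<noteq> 0" using q r by (simp add: ev_mult)
  ultimately show ?case by (intro exI[of _ "q * r"] exI[of _ N]) simp
qed

text \<open>Multiplication by \<open>y\<close> has degree at most \<open>d\<close> in \<open>x\<close> with respect to a finite spanning set
  over \<open>K(x)\<close>, so the powers of \<open>y\<close> up to \<open>k\<close> fill up at most about \<open>k d |S|\<close> dimensions over \<open>K\<close>.\<close>

lemma poly_indep_bounded: "\<exists>N. \<forall>Z. poly_indep y Z \<longrightarrow> card Z \<le> N"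
proof -
  obtain x S where S: "finite S"
    and a: "\<forall>z. \<exists>a. a ` S \<subseteq> simple_subfield emb x \<and> z = (\<Sum>s\<in>S. a s * s)"
    using finite_over_rational unfolding finite_over_def by blast
  have clear: "\<exists>q e. ev q x \<noteq> 0 \<and> ev q x * z \<in> poly_combs x S e" for z
  proof -
    obtain a where "a ` S \<subseteq> simple_subfield emb x" "z = (\<Sum>s\<in>S. a s * s)" using a by blast
    then show ?thesis using clear_denominator[OF S] by simp
  qed
  obtain q d' where q: "ev q x \<noteq> 0" "\<forall>z\<in>(\<lambda>s. y * s) ` S. ev q x * z \<in> poly_combs x S d'"
    using clear_denominators[OF clear, of "(\<lambda>s. y * s) ` S"] S by blast
  define d where "d = d' + degree q"
  have qd: "ev q x * (y * s) \<in> poly_combs x S d" if "s \<in> S" for s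
    using q(2) poly_combs_mono[of d' d x S] that by (auto simp: d_def)
  have step: "ev q x * (y * w) \<in> poly_combs x S (d + e)" if "w \<in> poly_combs x S e" for w e
  proof -
    obtain p where p: "w = (\<Sum>s\<in>S. ev (p s) x * s)" "\<forall>s\<in>S. degree (p s) \<le> e"
      using \<open>w \<in> _\<close> by (auto simp: poly_combs_def)
    have "ev q x * (y * w) = (\<Sum>s\<in>S. ev (p s) x * (ev q x * (y * s)))"
      by (simp add: p sum_distrib_left mult_ac)
    also have "\<dots> \<in> poly_combs x S (d + e)"
      using p qd by (intro poly_combs_sum poly_combs_mult) auto
    finally show ?thesis .
  qed
  \<comment> \<open>The full power of \<open>q\<close> is used for every exponent \<open>j\<close>
    up to \<open>k\<close>, so that one factor clears the denominators of all the products at once,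
    each power raising the degree bound by \<open>d\<close>.\<close>
  have iter: "ev q x ^ k * (y ^ j * w) \<in> poly_combs x S (k * d + e)"
    if "w \<in> poly_combs x S e" "j \<le> k" for w e j k
    using that(2)
  proof (induction k arbitrary: j)
    case 0
    then show ?case using that by simp
  next
    case (Suc k)
    show ?case
    proof (cases "j \<le> k")
      case True
      from poly_combs_mult[OF Suc.IH[OF True], of q d] show ?thesis
        by (simp add: d_def mult_ac add_ac)
    next
      case False
      with Suc.prems have "j = Suc k" by simp
      with step[OF Suc.IH[of k]] show ?thesis by (simp add: mult_ac add_ac)
    qed
  qed
  have "card Z \<le> d * card S" if Z: "poly_indep y Z" for Z
  proof (rule ccontr)
    assume big: "\<not> card Z \<le> d * card S"
    have finZ: "finite Z" using Z by (simp add: poly_indep_def)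
    obtain r e where r: "ev r x \<noteq> 0" "\<forall>z\<in>Z. ev r x * z \<in> poly_combs x S e"
      using clear_denominators[OF clear finZ] by blast
    \<comment> \<open>With \<open>n = card S\<close> the count would give
      \<open>(k + 1) (d n + 1) <= (k d + e + 1) n\<close>, that is
      \<open>k + d n + 1 <= (e + 1) n\<close>, which this \<open>k\<close> violates.\<close>
    define k where "k = (e + 1) * card S"
    define u where "u = (\<lambda>i. ev q x ^ k * (y ^ fst i * (ev r x * snd i)))"
    let ?T = "(\<lambda>(j, s). x ^ j * s) ` ({..k * d + e} \<times> S)"
    have "card ({..k} \<times> Z) \<le> card ?T"
    proof (rule K.card_le_span)
      show "u ` ({..k} \<times> Z) \<subseteq> K.span ?T"
        using iter r poly_combs_span[of x S "k * d + e"] by (auto simp: u_def)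
      fix c assume "(\<Sum>i\<in>{..k} \<times> Z. emb (c i) * u i) = 0"
      then have "ev q x ^ k * ev r x * (\<Sum>i\<in>{..k} \<times> Z. emb (c i) * (y ^ fst i * snd i)) = 0"
        by (simp add: u_def sum_distrib_left mult_ac)
      then show "\<forall>i\<in>{..k} \<times> Z. c i = 0" using q r poly_indep_powers[OF Z] by simp
    qed (use S finZ in auto)
    also have "card ?T \<le> card ({..k * d + e} \<times> S)" using S by (intro card_image_le) auto
    finally have "Suc k * card Z \<le> Suc (k * d + e) * card S" by (simp add: card_cartesian_product)
    moreover have "Suc k * Suc (d * card S) \<le> Suc k * card Z"
      using big by (intro mult_le_mono2) simp
    ultimately have "Suc k * Suc (d * card S) \<le> Suc (k * d + e) * card S" by linarith
    then show False by (simp add: k_def algebra_simps)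
  qed
  then show ?thesis by blast
qed

text \<open>For nonconstant \<open>y\<close> this is the degree of \<open>F\<close> over
  \<open>K(y)\<close>. For constant \<open>y\<close> only the empty set is independent and the value
  is 0.\<close>

definition poly_rank :: "'f \<Rightarrow> nat" where
  "poly_rank y = Max {card Z | Z. poly_indep y Z}"

lemma poly_indep_card_le: "poly_indep y Z \<Longrightarrow> card Z \<le> poly_rank y"
  and poly_rank_attained: "\<exists>Z. poly_indep y Z \<and> card Z = poly_rank y"
proof -
  obtain N where "\<forall>Z. poly_indep y Z \<longrightarrow> card Z \<le> N" using poly_indep_bounded by blast
  then have "{card Z | Z. poly_indep y Z} \<subseteq> {..N}" by auto
  then have fin: "finite {card Z | Z. poly_indep y Z}" using finite_subset by blast
  have "poly_indep y {}" by (simp add: poly_indep_def)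
  then have ne: "{card Z | Z. poly_indep y Z} \<noteq> {}" by blast
  show "poly_indep y Z \<Longrightarrow> card Z \<le> poly_rank y"
    unfolding poly_rank_def by (rule Max_ge[OF fin]) blast
  show "\<exists>Z. poly_indep y Z \<and> card Z = poly_rank y"
    using Max_in[OF fin ne] by (auto simp: poly_rank_def)
qed

text \<open>If some relation had a nonzero constant coefficient, reducing it modulo \<open>y M\<close> would give a
  relation over \<open>K\<close>; otherwise it can be divided by \<open>y\<close>.\<close>

lemma poly_indep_if_indep_mod:
  assumes M: "K.subspace M" "\<And>z. z \<in> M \<Longrightarrow> y * z \<in> N" and N: "K.subspace N" "N \<subseteq> M" and y: "y \<noteq> 0"
    and Z: "finite Z" "Z \<subseteq> M"
    and ind: "\<And>c. (\<Sum>s\<in>Z. emb (c s) * s) \<in> N \<Longrightarrow> \<forall>s\<in>Z. c s = 0"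
  shows "poly_indep y Z"
  unfolding poly_indep_def
proof (intro conjI allI impI Z)
  fix p assume p: "(\<Sum>z\<in>Z. ev (p z) y * z) = 0"
  have evM: "ev q y * z \<in> M" if "z \<in> M" for q z
    by (induction q) (use that M N K.subspace_0 in \<open>auto simp: distrib_right mult.assoc
        intro!: K.subspace_add K.subspace_scale\<close>)
  \<comment> \<open>Induction on the length of the coefficient lists rather than on the degree:
    length 0 means that all the polynomials vanish, and splitting off the constant term shortens
    also the constants.\<close>
  have "\<forall>z\<in>Z. p z = 0" if "\<forall>z\<in>Z. length (coeffs (p z)) \<le> n" for n
    using that p
  proof (induction n arbitrary: p)
    case 0
    then show ?case by simp
  next
    case (Suc n)
    define a where "a = (\<lambda>z. coeff (p z) 0)"
    define q where "q = (\<lambda>z. poly_shift 1 (p z))"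
    have pq: "p z = pCons (a z) (q z)" for z
      by (rule poly_eqI) (simp add: a_def q_def coeff_pCons coeff_poly_shift split: nat.split)
    have "(\<Sum>z\<in>Z. emb (a z) * z) = (\<Sum>z\<in>Z. ev (p z) y * z) - (\<Sum>z\<in>Z. y * (ev (q z) y * z))"
      by (simp add: pq algebra_simps sum.distrib)
    also have "\<dots> = - (\<Sum>z\<in>Z. y * (ev (q z) y * z))" using Suc.prems by simp
    also have "\<dots> \<in> N" using Z evM M by (intro K.subspace_neg K.subspace_sum N) auto
    finally have a0: "\<forall>z\<in>Z. a z = 0" by (rule ind)
    have "\<forall>z\<in>Z. q z = 0"
    proof (rule Suc.IH)
      show "\<forall>z\<in>Z. length (coeffs (q z)) \<le> n"
      proof
        fix z assume z: "z \<in> Z"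
        then have "length (coeffs (p z)) \<le> Suc n" using Suc.prems by blast
        then show "length (coeffs (q z)) \<le> n" by (simp add: pq cCons_def split: if_splits)
      qed
      have "y * (\<Sum>z\<in>Z. ev (q z) y * z) = (\<Sum>z\<in>Z. ev (p z) y * z)"
        unfolding sum_distrib_left by (rule sum.cong) (auto simp: pq a0 mult_ac)
      then show "(\<Sum>z\<in>Z. ev (q z) y * z) = 0" using y Suc.prems by simp
    qed
    with a0 show ?case by (simp add: pq)
  qed
  moreover have "\<forall>z\<in>Z. length (coeffs (p z)) \<le> (\<Sum>z\<in>Z. length (coeffs (p z)))"
    using Z by (auto intro: member_le_sum)
  ultimately show "\<forall>z\<in>Z. p z = 0" by blast
qed

lemma algebraic_iff: "algebraic_over emb z \<longleftrightarrow> z \<in> range emb"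
proof
  assume "z \<in> range emb"
  then obtain a where "z = emb a" by blast
  then have "ev [:- a, 1:] z = 0" by (simp add: emb_uminus)
  then show "algebraic_over emb z" unfolding algebraic_over_def by (intro exI[of _ "[:- a, 1:]"]) simp
qed (rule constants_algebraically_closed)

end

subsection \<open>Places\<close>

context function_field
begin

definition vge :: "('f \<Rightarrow> int) \<Rightarrow> int \<Rightarrow> 'f set" where
  "vge R n = {z. z = 0 \<or> n \<le> R z}"

lemma local_ring_eq: "local_ring R = vge R 0" and max_ideal_eq: "max_ideal R = vge R 1"
  by (auto simp: local_ring_def max_ideal_def vge_def)

lemma place_mult: "R \<in> places emb \<Longrightarrow> x \<noteq> 0 \<Longrightarrow> y \<noteq> 0 \<Longrightarrow> R (x * y) = R x + R y"
  and place_add: "R \<in> places emb \<Longrightarrow> x \<noteq> 0 \<Longrightarrow> y \<noteq> 0 \<Longrightarrow> x + y \<noteq> 0 \<Longrightarrow> min (R x) (R y) \<le> R (x + y)"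
  and place_emb: "R \<in> places emb \<Longrightarrow> R (emb c) = 0"
  and place_0: "R \<in> places emb \<Longrightarrow> R 0 = 0"
  and place_uniformizer: "R \<in> places emb \<Longrightarrow> \<exists>t. t \<noteq> 0 \<and> R t = 1"
  by (auto simp: places_def) (metis emb_0)

lemma place_1 [simp]: "R \<in> places emb \<Longrightarrow> R 1 = 0"
  using place_emb[of R 1] by simp

lemma place_uminus: assumes "R \<in> places emb" shows "R (- x) = R x"
proof (cases "x = 0")
  case False
  have "R (emb (- 1) * x) = R (emb (- 1)) + R x"
    using False by (intro place_mult assms) auto
  then show ?thesis using place_emb[OF assms, of "- 1"] by (simp add: emb_uminus)
qed simp

lemma place_inverse: assumes "R \<in> places emb" shows "R (inverse x) = - R x"
proof (cases "x = 0")
  case False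
  then show ?thesis using place_mult[OF assms, of x "inverse x"] assms by simp
qed (simp add: place_0 assms)

lemma place_divide: "R \<in> places emb \<Longrightarrow> x \<noteq> 0 \<Longrightarrow> y \<noteq> 0 \<Longrightarrow> R (x / y) = R x - R y"
  by (simp add: divide_inverse place_mult place_inverse)

lemma place_power: "R \<in> places emb \<Longrightarrow> x \<noteq> 0 \<Longrightarrow> R (x ^ n) = int n * R x"
  by (induction n) (auto simp: place_mult algebra_simps)

lemma place_power_int: "R \<in> places emb \<Longrightarrow> x \<noteq> 0 \<Longrightarrow> R (x powi n) = n * R x"
  by (cases n rule: int_cases2) (auto simp: place_power place_inverse power_int_minus)

lemma place_element: "R \<in> places emb \<Longrightarrow> \<exists>u. u \<noteq> 0 \<and> R u = n"
  using place_uniformizer[of R] place_power_int[of R _ n] by (metis mult.right_neutral power_int_eq_0_iff)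

text \<open>The upper bound on \<open>R (x + y)\<close> is the ultrametric inequality for
  \<open>x = (x + y) - y\<close>.\<close>

lemma place_add_less:
  assumes R: "R \<in> places emb" and "x \<noteq> 0" "y \<noteq> 0" "R x < R y"
  shows "x + y \<noteq> 0" "R (x + y) = R x"
proof -
  show nz: "x + y \<noteq> 0"
  proof
    assume "x + y = 0"
    then have "x = - y" by (simp add: eq_neg_iff_add_eq_0)
    then show False using assms place_uminus[OF R, of y] by simp
  qed
  show "R (x + y) = R x"
    using place_add[OF R, of x y] place_add[OF R, of "x + y" "- y"] nz assms place_uminus[OF R, of y]
    by simp
qed

lemma vge_add: "R \<in> places emb \<Longrightarrow> x \<in> vge R n \<Longrightarrow> y \<in> vge R n \<Longrightarrow> x + y \<in> vge R n"
  unfolding vge_def using place_add[of R x y] by (cases "x = 0"; cases "y = 0"; cases "x + y = 0") auto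

lemma vge_mult: "R \<in> places emb \<Longrightarrow> x \<in> vge R m \<Longrightarrow> y \<in> vge R n \<Longrightarrow> x * y \<in> vge R (m + n)"
  unfolding vge_def using place_mult[of R x y] by (cases "x = 0"; cases "y = 0") auto

lemma vge_emb: "R \<in> places emb \<Longrightarrow> emb c \<in> vge R 0"
  by (simp add: vge_def place_emb)

lemma vge_mono: "m \<le> n \<Longrightarrow> vge R n \<subseteq> vge R m"
  by (auto simp: vge_def)

lemma vge_mult_iff:
  assumes "R \<in> places emb" "u \<noteq> 0"
  shows "u * z \<in> vge R (R u + n) \<longleftrightarrow> z \<in> vge R n"
  using assms place_mult[of R u z] by (cases "z = 0") (auto simp: vge_def)

lemma subspace_vge: "R \<in> places emb \<Longrightarrow> K.subspace (vge R n)"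
  unfolding K.subspace_def
  using vge_add vge_mult[of R "emb _" 0 _ n] vge_emb[of R] by (auto simp: vge_def)

lemma module_hom_mult: "module_hom (\<lambda>c z. emb c * z) (\<lambda>c z. emb c * z) (\<lambda>z. u * z)"
  by unfold_locales (auto simp: emb_add emb_mult algebra_simps)

section \<open>Separation of places and weak approximation\<close>

text \<open>If the local ring of \<open>R\<close> were contained in that of \<open>R'\<close>, then
  \<open>R'\<close> would vanish wherever \<open>R\<close> does, hence be \<open>R\<close> times its
  value at a uniformizer \<open>t\<close> of \<open>R\<close>; both being normalized, that factor is
  1 and the places coincide.\<close>

lemma places_separated:
  assumes R: "R \<in> places emb" and R': "R' \<in> places emb" and "R \<noteq> R'"
  shows "\<exists>z. z \<noteq> 0 \<and> 0 \<le> R z \<and> R' z < 0"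
proof (rule ccontr)
  assume "\<not> ?thesis"
  then have le: "0 \<le> R' z" if "z \<noteq> 0" "0 \<le> R z" for z using that by force
  have zero: "R' z = 0" if "z \<noteq> 0" "R z = 0" for z
    using le[of z] le[of "inverse z"] that place_inverse[OF R] place_inverse[OF R'] by simp
  obtain t where t: "t \<noteq> 0" "R t = 1" using place_uniformizer[OF R] by blast
  have eq: "R' z = R z * R' t" if z: "z \<noteq> 0" for z
  proof -
    have "R' (z / t powi (R z)) = 0"
      using z t R by (intro zero) (auto simp: place_divide place_power_int)
    then show ?thesis using z t R' by (simp add: place_divide place_power_int)
  qed
  obtain s where s: "s \<noteq> 0" "R' s = 1" using place_uniformizer[OF R'] by blast
  have "R s * R' t = 1" using eq[OF s(1)] s by simp
  moreover have "0 \<le> R' t" using le t by simp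
  ultimately have "R' t = 1" by (metis linorder_not_le zero_less_one zmult_eq_1_iff not_numeral_le_zero neg_0_le_iff_le)
  then have "R z = R' z" for z using eq[of z] place_0[OF R] place_0[OF R'] by (cases "z = 0") auto
  then show False using \<open>R \<noteq> R'\<close> by blast
qed

lemma places_separated2:
  assumes R: "R \<in> places emb" and R': "R' \<in> places emb" and "R \<noteq> R'"
  shows "\<exists>z. z \<noteq> 0 \<and> 0 < R z \<and> R' z < 0"
proof -
  obtain a where "a \<noteq> 0" "0 \<le> R a" "R' a < 0" using places_separated[OF assms] by blast
  moreover obtain b where "b \<noteq> 0" "0 \<le> R' b" "R b < 0"
    using places_separated[OF R' R] assms by blast
  ultimately show ?thesis using R R' by (intro exI[of _ "a / b"]) (simp add: place_divide)
qed

text \<open>If the function \<open>y\<close> found so far has no pole at the new place, a power of a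
  function \<open>w\<close> with a pole there is added. The exponent must avoid cancellation at the
  old places.\<close>

lemma places_separated_finite:
  assumes R: "R \<in> places emb" and S: "finite S" "S \<subseteq> places emb" "R \<notin> S"
  shows "\<exists>y. y \<noteq> 0 \<and> 0 < R y \<and> (\<forall>R'\<in>S. R' y < 0)"
  using S
proof induction
  case empty
  then show ?case using place_uniformizer[OF R] by force
next
  case (insert R2 S)
  then obtain y where y: "y \<noteq> 0" "0 < R y" "\<forall>R'\<in>S. R' y < 0" by auto
  have R2: "R2 \<in> places emb" using insert.prems by simp
  obtain w where w: "w \<noteq> 0" "0 < R w" "R2 w < 0"
    using places_separated2[OF R R2] insert.prems by blast
  show ?case
  proof (cases "R2 y < 0")
    case True
    with y show ?thesis by blast
  next
    case False
    \<comment> \<open>Contains every exponent for which \<open>w ^ m\<close> and \<open>y\<close>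
      have equal order at some place of \<open>S\<close>. For any other exponent the smaller order,
      negative because that of \<open>y\<close> is, survives in the sum.\<close>
    define bad where "bad = (\<lambda>R'. nat (R' y div R' w)) ` S"
    obtain m where m: "m \<notin> insert 0 bad"
      using ex_new_if_finite[of "insert 0 bad"] insert.hyps by (auto simp: bad_def)
    have m0: "m > 0" using m by simp
    have wm: "w ^ m \<noteq> 0" using w by simp
    have neg: "R2 (w ^ m) < R2 y"
      using False w m0 R2 by (simp add: place_power) (smt (verit) mult_pos_neg of_nat_0_less_iff)
    note R2' = place_add_less[OF R2 wm y(1) neg]
    have "0 < R (w ^ m + y)"
      using place_add[OF R wm y(1) R2'(1)] y(2) w m0 by (simp add: place_power R min_def split: if_splits)
        (smt (verit) mult_pos_pos of_nat_0_less_iff)+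
    moreover have "R2 (w ^ m + y) < 0" using R2'(2) w m0 R2
      by (simp add: place_power mult_pos_neg)
    moreover have "R' (w ^ m + y) < 0" if R': "R' \<in> S" for R'
    proof -
      have pl: "R' \<in> places emb" and Ry: "R' y < 0" using R' insert.prems y by auto
      have ne: "R' (w ^ m) \<noteq> R' y"
      proof
        assume "R' (w ^ m) = R' y"
        then have e: "int m * R' w = R' y" using pl w by (simp add: place_power)
        then have "R' w \<noteq> 0" using Ry by auto
        then have "R' y div R' w = int m" unfolding e[symmetric] by simp
        then have "m = nat (R' y div R' w)" by simp
        then have "m \<in> bad" unfolding bad_def using R' by (rule image_eqI)
        then show False using m by simp
      qed
      show ?thesis
      proof (cases "R' (w ^ m) < R' y")
        case True
        from place_add_less(2)[OF pl wm y(1) this] True Ry show ?thesis by simp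
      next
        case False
        then have "R' y < R' (w ^ m)" using ne by simp
        from place_add_less(2)[OF pl y(1) wm this] Ry show ?thesis by (simp add: add.commute)
      qed
    qed
    ultimately show ?thesis using R2'(1) by (intro exI[of _ "w ^ m + y"]) auto
  qed
qed

text \<open>The function \<open>1 / (1 + y)\<close> is close to 1 where \<open>y\<close> vanishes
  and vanishes where \<open>y\<close> has a pole.\<close>

lemma approximation_unit:
  assumes R: "R \<in> places emb" and S: "finite S" "S \<subseteq> places emb" "R \<notin> S"
  shows "\<exists>e. e \<noteq> 0 \<and> 1 - e \<in> vge R 1 \<and> (\<forall>R'\<in>S. 0 < R' e)"
proof -
  obtain y where y: "y \<noteq> 0" "0 < R y" "\<forall>R'\<in>S. R' y < 0"
    using places_separated_finite[OF assms] by blast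
  have "R 1 < R y" using y R by simp
  note a = place_add_less[OF R _ y(1) this, simplified]
  have "1 - inverse (1 + y) = y * inverse (1 + y)" using a by (simp add: field_simps)
  then have "R (1 - inverse (1 + y)) = R y"
    using a y R by (simp add: place_mult place_inverse)
  moreover have "0 < R' (inverse (1 + y))" if "R' \<in> S" for R'
  proof -
    have pl: "R' \<in> places emb" using that S by blast
    have "R' y < R' 1" using y pl that by simp
    from place_add_less(2)[OF pl y(1) _ this] y pl that show ?thesis
      by (simp add: place_inverse add.commute)
  qed
  ultimately show ?thesis using a y
    by (intro exI[of _ "inverse (1 + y)"]) (auto simp: vge_def)
qed

text \<open>Multiplying \<open>z\<close> by a high power of the function from
  \<open>approximation_unit\<close> keeps its residue at \<open>R\<close> and makes the orders on
  \<open>S\<close> as large as required. First-order accuracy at \<open>R\<close> fits the later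
  use, where ideals are compared one layer at a time.\<close>

lemma weak_approximation:
  assumes R: "R \<in> places emb" and S: "finite S" "S \<subseteq> places emb" "R \<notin> S" and z: "z \<in> vge R 0"
  shows "\<exists>f. z - f \<in> vge R 1 \<and> (\<forall>R'\<in>S. f \<in> vge R' (N R'))"
proof (cases "z = 0")
  case True
  then show ?thesis by (intro exI[of _ 0]) (auto simp: vge_def)
next
  case False
  obtain e where e: "e \<noteq> 0" "1 - e \<in> vge R 1" "\<forall>R'\<in>S. 0 < R' e"
    using approximation_unit[OF assms(1-4)] by blast
  \<comment> \<open>Bounds every missing order \<open>N R' - R' z\<close>; each factor
    \<open>e\<close> contributes at least 1.\<close>
  define m where "m = nat (\<Sum>R'\<in>S. \<bar>N R' - R' z\<bar>)"
  have "e ^ k \<in> vge R 0 \<and> 1 - e ^ k \<in> vge R 1" for k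
  proof (induction k)
    case 0
    then show ?case using R by (simp add: vge_def)
  next
    case (Suc k)
    have "1 - (1 - e) \<in> vge R 0"
      by (rule K.subspace_diff[OF subspace_vge[OF R]]) (use e(2) R in \<open>auto simp: vge_def\<close>)
    then have "e \<in> vge R 0" by simp
    then have "e * e ^ k \<in> vge R 0" "e * (1 - e ^ k) \<in> vge R 1"
      using Suc vge_mult[OF R, of e 0 "e ^ k" 0] vge_mult[OF R, of e 0 "1 - e ^ k" 1] by auto
    moreover have "1 - e ^ Suc k = (1 - e) + e * (1 - e ^ k)" by (simp add: algebra_simps)
    ultimately show ?case using vge_add[OF R e(2), of "e * (1 - e ^ k)"] by (metis power_Suc)
  qed
  then have "z * (1 - e ^ m) \<in> vge R 1" using vge_mult[OF R z, of "1 - e ^ m" 1] by auto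
  then have "z - z * e ^ m \<in> vge R 1" by (simp add: algebra_simps)
  moreover have "z * e ^ m \<in> vge R' (N R')" if R': "R' \<in> S" for R'
  proof -
    have pl: "R' \<in> places emb" using R' S by blast
    have "N R' - R' z \<le> \<bar>N R' - R' z\<bar>" by simp
    also have "\<dots> \<le> (\<Sum>R'\<in>S. \<bar>N R' - R' z\<bar>)" using S R' by (intro member_le_sum) auto
    also have "\<dots> = int m * 1" by (simp add: m_def sum_nonneg)
    also have "\<dots> \<le> int m * R' e" using e R' by (intro mult_left_mono) auto
    finally show ?thesis using False e pl by (simp add: vge_def place_mult place_power)
  qed
  ultimately show ?thesis by blast
qed

text \<open>Elements with independent residues are independent over \<open>K[t]\<close> for a
  uniformizer \<open>t\<close>, so \<open>poly_rank t\<close> bounds their number. Positivity holds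
  because 1 has nonzero residue.\<close>

lemma residue_finite:
  assumes R: "R \<in> places emb"
  shows "K.fin_mod (vge R 1) (vge R 0)" "place_degree emb R = K.rdim (vge R 1) (vge R 0)"
    "place_degree emb R > 0"
proof -
  obtain t where t: "t \<noteq> 0" "R t = 1" using place_uniformizer[OF R] by blast
  have sub: "vge R 1 \<subseteq> vge R 0" by (rule vge_mono) simp
  have b: "card T \<le> poly_rank t" if T: "finite T" "T \<subseteq> vge R 0"
    "\<And>c. (\<Sum>s\<in>T. emb (c s) * s) \<in> vge R 1 \<Longrightarrow> \<forall>s\<in>T. c s = 0" for T
  proof -
    have "poly_indep t T"
    proof (rule poly_indep_if_indep_mod[where M = "vge R 0" and N = "vge R 1"])
      show "t * z \<in> vge R 1" if "z \<in> vge R 0" for z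
        using vge_mult_iff[OF R t(1), of z 0] that t by simp
    qed (use subspace_vge R sub t T in auto)
    then show ?thesis by (rule poly_indep_card_le)
  qed
  show fin: "K.fin_mod (vge R 1) (vge R 0)"
    by (rule K.fin_mod_exists(1)[OF subspace_vge[OF R] b])
  then obtain S where S: "K.basis_mod (vge R 1) (vge R 0) S" "card S = K.rdim (vge R 1) (vge R 0)"
    using K.fin_modE subspace_vge R by blast
  have rb: "residue_basis emb R = K.basis_mod (vge R 1) (vge R 0)"
    by (auto simp: residue_basis_def K.basis_mod_def local_ring_eq max_ideal_eq fun_eq_iff)
  show deg: "place_degree emb R = K.rdim (vge R 1) (vge R 0)"
    unfolding place_degree_def rb
  proof (rule the_equality)
    show "\<exists>S. K.basis_mod (vge R 1) (vge R 0) S \<and> card S = K.rdim (vge R 1) (vge R 0)"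
      using S by blast
  qed (use K.rdim_eq[OF subspace_vge[OF R]] in metis)
  have "card {1::'f} \<le> card S"
  proof (rule K.basis_mod_card_ge[OF subspace_vge[OF R] S(1), where v = "\<lambda>x. x"])
    fix c assume "(\<Sum>i\<in>{1::'f}. emb (c i) * i) \<in> vge R 1"
    then show "\<forall>i\<in>{1}. c i = 0" using place_emb[OF R] by (auto simp: vge_def)
  qed (use R in \<open>auto simp: vge_def\<close>)
  then show "place_degree emb R > 0" using S deg by simp
qed

section \<open>Ideals of semilocal rings and the degree of the divisor of zeros\<close>

definition semilocal :: "('f \<Rightarrow> int) set \<Rightarrow> (('f \<Rightarrow> int) \<Rightarrow> int) \<Rightarrow> 'f set" where
  "semilocal S D = {z. \<forall>R\<in>S. z \<in> vge R (D R)}"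

lemma subspace_semilocal: "S \<subseteq> places emb \<Longrightarrow> K.subspace (semilocal S D)"
  using subspace_vge unfolding K.subspace_def semilocal_def by blast

text \<open>Multiplication by \<open>u\<close> moves the condition at \<open>R\<close> to order 0
  and identifies the quotient with the residue field; weak approximation gives surjectivity while
  the conditions at the other places of \<open>S\<close> are kept.\<close>

lemma semilocal_step:
  assumes S: "finite S" "S \<subseteq> places emb" and R: "R \<in> S"
  shows "K.fin_mod (semilocal S (D(R := D R + 1))) (semilocal S D)"
    "K.rdim (semilocal S (D(R := D R + 1))) (semilocal S D) = place_degree emb R"
proof -
  have pl: "R \<in> places emb" using S R by blast
  obtain u where u: "u \<noteq> 0" "R u = - D R" using place_element[OF pl] by blast
  have iff: "u * z \<in> vge R n \<longleftrightarrow> z \<in> vge R (D R + n)" for z n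
    using vge_mult_iff[OF pl u(1), of z "D R + n"] u by simp
  have W: "semilocal S (D(R := D R + 1)) = {z \<in> semilocal S D. u * z \<in> vge R 1}"
    using R vge_mono[of "D R" "D R + 1" R] by (auto simp: semilocal_def iff)
  have im: "(\<lambda>z. u * z) ` semilocal S D \<subseteq> vge R 0" using R by (auto simp: semilocal_def iff)
  have surj: "\<exists>y\<in>semilocal S D. z - u * y \<in> vge R 1" if z: "z \<in> vge R 0" for z
  proof -
    obtain f where f: "z - f \<in> vge R 1" "\<forall>R'\<in>S - {R}. f \<in> vge R' (R' u + D R')"
      using weak_approximation[OF pl _ _ _ z, of "S - {R}" "\<lambda>R'. R' u + D R'"] S by auto
    have uf: "u * (f / u) = f" using u by simp
    have "z - (z - f) \<in> vge R 0"
      by (rule K.subspace_diff[OF subspace_vge[OF pl] z]) (use f vge_mono[of 0 1 R] in auto)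
    then have "f / u \<in> vge R (D R)" using iff[of "f / u" 0] uf by simp
    moreover have "f / u \<in> vge R' (D R')" if "R' \<in> S - {R}" for R'
      using vge_mult_iff[of R' u "f / u" "D R'"] u uf f that S by auto
    ultimately have "f / u \<in> semilocal S D" by (auto simp: semilocal_def)
    then show ?thesis using f uf by (intro bexI[of _ "f / u"]) auto
  qed
  note args = module_hom_mult subspace_vge[OF pl] subspace_semilocal[OF S(2)] residue_finite(1)[OF pl]
    im W subspace_semilocal[OF S(2)]
  show "K.fin_mod (semilocal S (D(R := D R + 1))) (semilocal S D)"
    by (rule K.rdim_pullback_le(1)[OF args])
  show "K.rdim (semilocal S (D(R := D R + 1))) (semilocal S D) = place_degree emb R"
    using K.rdim_pullback_eq[OF args surj] residue_finite(2)[OF pl] by simp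
qed

text \<open>The orders are raised from 0 to \<open>n R\<close> one unit at a time, each unit costing
  the degree of its place.\<close>

lemma semilocal_rdim:
  assumes S: "finite S" "S \<subseteq> places emb"
  shows "K.fin_mod (semilocal S (\<lambda>R. int (n R))) (semilocal S (\<lambda>R. 0)) \<and>
    K.rdim (semilocal S (\<lambda>R. int (n R))) (semilocal S (\<lambda>R. 0)) = (\<Sum>R\<in>S. n R * place_degree emb R)"
proof (induction "\<Sum>R\<in>S. n R" arbitrary: n)
  case 0
  then have "\<forall>R\<in>S. n R = 0" using S by simp
  then have eq: "semilocal S (\<lambda>R. int (n R)) = semilocal S (\<lambda>R. 0)" "(\<Sum>R\<in>S. n R * place_degree emb R) = 0"
    by (auto simp: semilocal_def)
  have "K.basis_mod V V {}" if "K.subspace V" for V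
    using that by (auto simp: K.basis_mod_def K.subspace_0)
  then have "K.basis_mod (semilocal S (\<lambda>R. 0)) (semilocal S (\<lambda>R. 0)) {}"
    using subspace_semilocal S by blast
  then show ?case
    using K.rdim_eq[OF subspace_semilocal[OF S(2)]] eq by (auto simp: K.fin_mod_def)
next
  case (Suc k)
  then obtain R where R: "R \<in> S" "n R \<noteq> 0" using S by (metis Zero_not_Suc sum.neutral)
  define m where "m = n(R := n R - 1)"
  have sums: "(\<Sum>R\<in>S. f R (n R)) = (\<Sum>R\<in>S - {R}. f R (m R)) + f R (n R)"
    "(\<Sum>R\<in>S. f R (m R)) = (\<Sum>R\<in>S - {R}. f R (m R)) + f R (n R - 1)" for f :: "_ \<Rightarrow> nat \<Rightarrow> nat"
    using S R by (simp_all add: sum.remove[of S R] m_def)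
  have "(\<Sum>R\<in>S. m R) = k" using sums[of "\<lambda>R x. x"] Suc.hyps(2) R by simp
  note IH = Suc.hyps(1)[OF this[symmetric]]
  have eq: "(\<lambda>R. int (n R)) = (\<lambda>R. int (m R))(R := int (m R) + 1)"
    using R by (auto simp: m_def)
  note step = semilocal_step[OF S R(1), of "\<lambda>R. int (m R)", folded eq]
  have sub: "semilocal S (\<lambda>R. int (n R)) \<subseteq> semilocal S (\<lambda>R. int (m R))"
    "semilocal S (\<lambda>R. int (m R)) \<subseteq> semilocal S (\<lambda>R. 0)"
    by (auto simp: semilocal_def vge_def m_def split: if_splits)
  note tr = K.rdim_trans[OF subspace_semilocal[OF S(2)] subspace_semilocal[OF S(2)] sub step(1) conjunct1[OF IH]]
  have "(\<Sum>R\<in>S. n R * place_degree emb R) = (\<Sum>R\<in>S. m R * place_degree emb R) + place_degree emb R"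
  proof -
    have "n R * place_degree emb R = (n R - 1) * place_degree emb R + place_degree emb R"
      using R(2) by (cases "n R") simp_all
    then show ?thesis using sums[of "\<lambda>R x. x * place_degree emb R"] by linarith
  qed
  then show ?case using tr step(2) IH by simp
qed

text \<open>The sum is the dimension of the functions regular on \<open>S\<close> modulo those
  vanishing to the orders of \<open>x\<close>. Multiplication by \<open>x\<close> maps the former
  into the latter, so a basis of the quotient is independent over \<open>K[x]\<close>.\<close>

lemma zeros_degree_le:
  assumes S: "finite S" "S \<subseteq> places emb" and x: "x \<noteq> 0" "\<And>R. R \<in> S \<Longrightarrow> 0 < R x"
  shows "(\<Sum>R\<in>S. nat (R x) * place_degree emb R) \<le> poly_rank x"
proof -
  let ?M = "semilocal S (\<lambda>R. 0)" and ?N = "semilocal S (\<lambda>R. int (nat (R x)))"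
  note rd = semilocal_rdim[OF S, of "\<lambda>R. nat (R x)"]
  obtain Z where Z: "K.basis_mod ?N ?M Z" "card Z = K.rdim ?N ?M"
    using K.fin_modE subspace_semilocal S rd by blast
  have "poly_indep x Z"
  proof (rule poly_indep_if_indep_mod[where M = ?M and N = ?N])
    show "x * z \<in> ?N" if z: "z \<in> ?M" for z
      unfolding semilocal_def
    proof (intro CollectI ballI)
      fix R assume R: "R \<in> S"
      then have "z \<in> vge R 0" using z by (auto simp: semilocal_def)
      then show "x * z \<in> vge R (int (nat (R x)))"
        using vge_mult_iff[of R x z 0] x(1) x(2)[OF R] subsetD[OF S(2) R] by simp
    qed
    have "vge R (int (nat (R x))) \<subseteq> vge R 0" for R by (rule vge_mono) simp
    then show "?N \<subseteq> ?M" unfolding semilocal_def by blast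
    show "\<forall>s\<in>Z. c s = 0" if "(\<Sum>s\<in>Z. emb (c s) * s) \<in> ?N" for c
      using that by (rule K.basis_modD(3)[OF Z(1)])
  qed (rule subspace_semilocal[OF S(2)] x(1) K.basis_modD(1,2)[OF Z(1)])+
  then show ?thesis using Z(2) rd poly_indep_card_le[of x Z] by simp
qed

lemma zeros_finite:
  assumes x: "x \<noteq> 0"
  shows "finite {R \<in> places emb. 0 < R x}"
proof (rule ccontr)
  assume "infinite {R \<in> places emb. 0 < R x}"
  then obtain S where S: "S \<subseteq> {R \<in> places emb. 0 < R x}" "finite S" "card S = Suc (poly_rank x)"
    using infinite_arbitrarily_large by blast
  have "card S = (\<Sum>R\<in>S. 1)" by simp
  also have "\<dots> \<le> (\<Sum>R\<in>S. nat (R x) * place_degree emb R)"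
  proof (rule sum_mono)
    fix R assume "R \<in> S"
    then have "0 < nat (R x)" "0 < place_degree emb R" using S residue_finite(3) by auto
    then show "1 \<le> nat (R x) * place_degree emb R" by (simp add: Suc_leI)
  qed
  also have "\<dots> \<le> poly_rank x" using S by (intro zeros_degree_le x) auto
  finally show False using S by simp
qed

end

subsection \<open>Existence of places\<close>

context function_field
begin

definition const_subring :: "'f set \<Rightarrow> bool" where
  "const_subring V \<longleftrightarrow> range emb \<subseteq> V \<and> (\<forall>a\<in>V. \<forall>b\<in>V. a + b \<in> V \<and> a * b \<in> V)"

lemma const_subringD:
  assumes "const_subring V"
  shows "emb c \<in> V" "0 \<in> V" "1 \<in> V" "a \<in> V \<Longrightarrow> b \<in> V \<Longrightarrow> a + b \<in> V"
    "a \<in> V \<Longrightarrow> b \<in> V \<Longrightarrow> a * b \<in> V" "a \<in> V \<Longrightarrow> - a \<in> V" "a \<in> V \<Longrightarrow> b \<in> V \<Longrightarrow> a - b \<in> V"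
    "a \<in> V \<Longrightarrow> a ^ n \<in> V"
proof -
  show emb: "emb c \<in> V" for c using assms by (auto simp: const_subring_def)
  show "0 \<in> V" "1 \<in> V" using emb[of 0] emb[of 1] by simp_all
  show add: "a + b \<in> V" and mult: "a * b \<in> V" if "a \<in> V" "b \<in> V" for a b
    using that assms by (auto simp: const_subring_def)
  show neg: "- a \<in> V" if "a \<in> V" for a
    using mult[OF emb[of "- 1"] that] by (simp add: emb_uminus)
  show "a - b \<in> V" if "a \<in> V" "b \<in> V" for a b
    using add[OF that(1) neg[OF that(2)]] by simp
  show "a ^ n \<in> V" if "a \<in> V" for a
    by (induction n) (use that mult \<open>1 \<in> V\<close> in auto)
qed

lemma const_subring_sum:
  assumes "const_subring V" "\<And>i. i \<in> I \<Longrightarrow> f i \<in> V"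
  shows "sum f I \<in> V"
  using assms(2) by (induction I rule: infinite_finite_induct) (simp_all add: const_subringD(2,4)[OF assms(1)])

definition adjoin :: "'f set \<Rightarrow> 'f \<Rightarrow> 'f set" where
  "adjoin V a = {poly p a | p. \<forall>i. coeff p i \<in> V}"

lemma adjoin:
  assumes V: "const_subring V"
  shows "const_subring (adjoin V a)" "V \<subseteq> adjoin V a" "a \<in> adjoin V a"
proof -
  note V' = const_subringD[OF V]
  show sub: "V \<subseteq> adjoin V a"
  proof
    fix x assume "x \<in> V"
    then show "x \<in> adjoin V a" unfolding adjoin_def
      using V' by (intro CollectI exI[of _ "[:x:]"]) (auto simp: coeff_pCons split: nat.split)
  qed
  show "a \<in> adjoin V a" unfolding adjoin_def
    using V' by (intro CollectI exI[of _ "[:0, 1:]"]) (auto simp: coeff_pCons split: nat.split)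
  show "const_subring (adjoin V a)"
    unfolding const_subring_def
  proof (intro conjI ballI)
    show "range emb \<subseteq> adjoin V a" using V'(1) sub by blast
    fix x z assume "x \<in> adjoin V a" "z \<in> adjoin V a"
    then obtain p q where pq: "x = poly p a" "z = poly q a" "\<And>i. coeff p i \<in> V" "\<And>i. coeff q i \<in> V"
      by (auto simp: adjoin_def)
    show "x + z \<in> adjoin V a" unfolding adjoin_def
      using pq V'(4) by (intro CollectI exI[of _ "p + q"]) simp
    show "x * z \<in> adjoin V a" unfolding adjoin_def
      using pq V'(5) by (intro CollectI exI[of _ "p * q"]) (simp add: coeff_mult const_subring_sum[OF V])
  qed
qed

lemma adjoinD:
  assumes "x \<in> adjoin V a"
  shows "\<exists>c n. (\<forall>i. c i \<in> V) \<and> x = (\<Sum>i<Suc n. c i * a ^ i)"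
proof -
  obtain p where p: "x = poly p a" "\<forall>i. coeff p i \<in> V" using assms by (auto simp: adjoin_def)
  then show ?thesis
    by (intro exI[of _ "coeff p"] exI[of _ "degree p"]) (simp only: poly_altdef lessThan_Suc_atMost simp_thms)
qed

section \<open>Maximal subrings without \<open>inverse y\<close> are valuation rings\<close>

context
  fixes V :: "'f set" and y :: 'f
  assumes V: "const_subring V" and y: "y \<in> V" "inverse y \<notin> V"
    and maximal: "\<And>U. const_subring U \<Longrightarrow> V \<subseteq> U \<Longrightarrow> inverse y \<notin> U \<Longrightarrow> U = V"
begin

private lemma y0: "y \<noteq> 0"
  using y by auto

private lemma inverse_y_adjoin: "a \<notin> V \<Longrightarrow> inverse y \<in> adjoin V a"
  using maximal[OF adjoin(1)[OF V, of a] adjoin(2)[OF V]] adjoin(3)[OF V, of a] by blast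

text \<open>Let \<open>b = 1 - y * c\<close>. If \<open>inverse b\<close> were outside
  \<open>V\<close>, maximality would express \<open>inverse y\<close> by powers of
  \<open>inverse b\<close>, so \<open>b ^ n * inverse y\<close> would lie in \<open>V\<close> for
  some \<open>n\<close>. As \<open>b ^ n\<close> is 1 modulo \<open>y\<close>, already
  \<open>inverse y\<close> would lie in \<open>V\<close>.\<close>

private lemma unit: assumes c: "c \<in> V" shows "1 - y * c \<noteq> 0" "inverse (1 - y * c) \<in> V"
proof -
  note V' = const_subringD[OF V]
  define b where "b = 1 - y * c"
  have bV: "b \<in> V" using V' c y by (simp add: b_def)
  have "b \<noteq> 0"
  proof
    assume "b = 0"
    then have "y * c = 1" by (simp add: b_def)
    then have "inverse y = c" by (rule inverse_unique)
    then show False using y c by simp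
  qed
  then show "1 - y * c \<noteq> 0" by (simp add: b_def)
  show "inverse (1 - y * c) \<in> V"
  proof (rule ccontr)
    assume "inverse (1 - y * c) \<notin> V"
    then have "inverse y \<in> adjoin V (inverse b)" using inverse_y_adjoin by (simp add: b_def)
    then obtain d n where d: "\<forall>i. d i \<in> V" "inverse y = (\<Sum>i<Suc n. d i * inverse b ^ i)"
      using adjoinD by blast
    have "b ^ n * inverse y = (\<Sum>i<Suc n. d i * b ^ (n - i))"
      unfolding d(2) sum_distrib_left
    proof (rule sum.cong)
      fix i assume "i \<in> {..<Suc n}"
      then have "b ^ n = b ^ i * b ^ (n - i)" by (simp flip: power_add)
      then show "b ^ n * (d i * inverse b ^ i) = d i * b ^ (n - i)"
        using \<open>b \<noteq> 0\<close> by (simp add: power_inverse field_simps)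
    qed simp
    also have "\<dots> \<in> V" using d V' bV by (intro const_subring_sum[OF V]) auto
    finally have 1: "b ^ n * inverse y \<in> V" .
    have "\<exists>e\<in>V. b ^ n = 1 - y * e"
    proof (induction n)
      case 0
      then show ?case using V' by (intro bexI[of _ 0]) auto
    next
      case (Suc n)
      then obtain e where e: "e \<in> V" "b ^ n = 1 - y * e" by blast
      have "b ^ Suc n = b * (1 - y * e)" by (simp add: e(2))
      also have "\<dots> = 1 - y * (e + c * (1 - y * e))" by (simp add: b_def algebra_simps)
      finally show ?case using V'(4)[OF e(1) V'(5)[OF c V'(7)[OF V'(3) V'(5)[OF y(1) e(1)]]]] by blast
    qed
    then obtain e where e: "e \<in> V" "b ^ n = 1 - y * e" by blast
    have "inverse y = b ^ n * inverse y + e" unfolding e(2) using y0 by (simp add: algebra_simps)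
    then show False using V'(4)[OF 1 e(1)] y by simp
  qed
qed

text \<open>Membership of \<open>inverse y\<close> in \<open>V[z]\<close>, multiplied by
  \<open>y\<close>, with \<open>n\<close> counting the terms: the degree in \<open>z\<close> is
  below \<open>n\<close>.\<close>

private definition rel :: "'f \<Rightarrow> nat \<Rightarrow> bool" where
  "rel z n \<longleftrightarrow> (\<exists>a. (\<forall>i. a i \<in> V) \<and> y * (\<Sum>i<n. a i * z ^ i) = 1)"

text \<open>In the relation for \<open>w = 1 / z\<close> the constant part
  \<open>1 - y * b 0\<close> is a unit, so multiplication by \<open>z ^ m\<close> expresses
  \<open>z ^ m\<close>, hence also \<open>z ^ n\<close>, by lower powers of \<open>z\<close>.
  Substituting this removes the top term of the relation for \<open>z\<close>.\<close>

private lemma rel_lower: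
  assumes "rel z (Suc n)" "rel w (Suc m)" "w * z = 1" "m \<le> n"
  shows "rel z n"
proof -
  note V' = const_subringD[OF V]
  obtain a where a: "\<And>i. a i \<in> V" "y * (\<Sum>i<Suc n. a i * z ^ i) = 1"
    using assms by (auto simp: rel_def)
  obtain b where b: "\<And>i. b i \<in> V" "y * (\<Sum>i<Suc m. b i * w ^ i) = 1"
    using assms by (auto simp: rel_def)
  define u where "u = 1 - y * b 0"
  have u: "u \<noteq> 0" "inverse u \<in> V" using unit[OF b(1)] by (simp_all add: u_def)
  have wz: "w ^ Suc i * z ^ m = z ^ (m - Suc i)" if "i < m" for i
  proof -
    have "z ^ m = z ^ Suc i * z ^ (m - Suc i)" using that by (simp only: flip: power_add) simp
    moreover have "w ^ Suc i * z ^ Suc i = 1" using assms(3) by (simp only: flip: power_mult_distrib) simp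
    ultimately show ?thesis by (metis mult.assoc mult_1)
  qed
  have "u = y * (\<Sum>i<m. b (Suc i) * w ^ Suc i)"
    using b(2) unfolding sum.lessThan_Suc_shift u_def by (simp add: algebra_simps)
  then have "u * z ^ m = y * (\<Sum>i<m. b (Suc i) * (w ^ Suc i * z ^ m))"
    by (simp add: sum_distrib_right mult.assoc)
  also have "(\<Sum>i<m. b (Suc i) * (w ^ Suc i * z ^ m)) = (\<Sum>i<m. b (m - (m - Suc i)) * z ^ (m - Suc i))"
    by (rule sum.cong) (simp_all only: wz lessThan_iff, simp)
  also have "\<dots> = (\<Sum>j<m. b (m - j) * z ^ j)"
    by (rule sum.nat_diff_reindex[of "\<lambda>j. b (m - j) * z ^ j"])
  finally have "z ^ m = inverse u * y * (\<Sum>j<m. b (m - j) * z ^ j)" using u by (simp add: field_simps)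
  then have "z ^ (n - m) * z ^ m = inverse u * y * (\<Sum>j<m. b (m - j) * z ^ (j + (n - m)))"
    by (simp add: sum_distrib_left power_add mult_ac)
  moreover have "z ^ (n - m) * z ^ m = z ^ n" using assms(4) by (simp flip: power_add)
  moreover have "(\<Sum>j<m. b (m - j) * z ^ (j + (n - m))) = (\<Sum>i\<in>{n - m..<n}. b (n - i) * z ^ i)"
    by (rule sum.reindex_bij_witness[where i = "\<lambda>i. i - (n - m)" and j = "\<lambda>j. j + (n - m)"])
       (use assms(4) in auto)
  ultimately have zn: "z ^ n = inverse u * y * (\<Sum>i\<in>{n - m..<n}. b (n - i) * z ^ i)" by simp
  define c where "c = a n * inverse u * y"
  define a' where "a' = (\<lambda>i. a i + (if n - m \<le> i then c * b (n - i) else 0))"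
  have cV: "c \<in> V" using a u y V' by (simp add: c_def)
  have "(\<Sum>i<n. a' i * z ^ i)
      = (\<Sum>i<n. a i * z ^ i) + (\<Sum>i<n. if n - m \<le> i then c * b (n - i) * z ^ i else 0)"
    unfolding sum.distrib[symmetric] by (rule sum.cong) (auto simp: a'_def algebra_simps)
  also have "(\<Sum>i<n. if n - m \<le> i then c * b (n - i) * z ^ i else 0) = (\<Sum>i\<in>{n - m..<n}. c * b (n - i) * z ^ i)"
    by (rule sum.mono_neutral_cong_right) auto
  also have "\<dots> = a n * z ^ n" unfolding zn by (simp add: c_def sum_distrib_left mult_ac)
  finally have "y * (\<Sum>i<n. a' i * z ^ i) = 1" using a(2) by simp
  moreover have "a' i \<in> V" for i using a b cV V' by (simp add: a'_def)
  ultimately show ?thesis unfolding rel_def by blast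
qed

text \<open>If neither lay in \<open>V\<close>, both would satisfy relations \<open>rel\<close>;
  with each of minimal length, the one that is not shorter could still be shortened by means of the
  other.\<close>

lemma maximal_subring_valuation: "z \<in> V \<or> inverse z \<in> V"
proof (rule ccontr)
  assume "\<not> ?thesis"
  then have z: "z \<notin> V" "inverse z \<notin> V" by auto
  then have z0: "z \<noteq> 0" using const_subringD[OF V] by auto
  have ex: "\<exists>n. rel a n" if a: "a \<notin> V" for a
  proof -
    obtain c n where c: "\<forall>i. c i \<in> V" "inverse y = (\<Sum>i<Suc n. c i * a ^ i)"
      using adjoinD[OF inverse_y_adjoin[OF a]] by blast
    have "y * inverse y = 1" using y0 by simp
    then have "rel a (Suc n)" unfolding rel_def c(2) using c(1) by blast
    then show ?thesis by blast
  qed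
  define n where "n = (LEAST n. rel z n)"
  define m where "m = (LEAST n. rel (inverse z) n)"
  have n: "rel z n" and m: "rel (inverse z) m"
    unfolding n_def m_def using ex z by (auto intro: LeastI_ex)
  have min: "\<not> rel z k" if "k < n" for k using that not_less_Least unfolding n_def by blast
  have min': "\<not> rel (inverse z) k" if "k < m" for k using that not_less_Least unfolding m_def by blast
  have "\<not> rel a 0" for a by (simp add: rel_def)
  then obtain n' m' where nm: "n = Suc n'" "m = Suc m'" using n m by (metis not0_implies_Suc)
  show False
  proof (cases "m' \<le> n'")
    case True
    have "rel z n'" using n m z0 True by (intro rel_lower[of z n' "inverse z" m']) (auto simp: nm)
    then show False using min nm by simp
  next
    case False
    have "rel (inverse z) m'" using n m z0 False by (intro rel_lower[of "inverse z" m' z n']) (auto simp: nm)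
    then show False using min' nm by simp
  qed
qed

end

text \<open>As \<open>y\<close> is transcendental over \<open>K\<close>, the ring
  \<open>K[y]\<close> does not contain \<open>inverse y\<close>; Zorn's lemma enlarges it to a
  maximal ring with this property.\<close>

lemma exists_valuation_ring:
  assumes y: "y \<notin> range emb"
  shows "\<exists>V. const_subring V \<and> y \<in> V \<and> inverse y \<notin> V \<and> (\<forall>z. z \<in> V \<or> inverse z \<in> V)"
proof -
  define \<A> where "\<A> = {V. const_subring V \<and> y \<in> V \<and> inverse y \<notin> V}"
  have "const_subring (range emb)"
    by (auto simp: const_subring_def simp flip: emb_add emb_mult)
  note adj = adjoin[OF this, of y]
  have "inverse y \<notin> adjoin (range emb) y"
  proof
    assume "inverse y \<in> adjoin (range emb) y"
    then obtain c n where c: "\<forall>i. c i \<in> range emb" "inverse y = (\<Sum>i<Suc n. c i * y ^ i)"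
      using adjoinD by blast
    have "\<forall>i. \<exists>d. c i = emb d" using c(1) by blast
    then obtain d where d: "\<And>i. c i = emb (d i)" by metis
    define p where "p = (\<Sum>i<Suc n. monom (d i) i)"
    have "ev p y = inverse y" by (simp add: p_def ev_sum ev_monom c(2) d del: sum.lessThan_Suc)
    then have "ev (pCons (- 1) p) y = 0" using y by (cases "y = 0") (auto simp: emb_uminus intro: rev_image_eqI[of 0])
    then have "algebraic_over emb y" unfolding algebraic_over_def by (intro exI[of _ "pCons (- 1) p"]) simp
    then show False using y algebraic_iff by blast
  qed
  then have "\<A> \<noteq> {}" using adj unfolding \<A>_def by blast
  then obtain V where V: "V \<in> \<A>" "\<And>U. U \<in> \<A> \<Longrightarrow> V \<subseteq> U \<Longrightarrow> U = V"
  proof (rule subset_Zorn_nonempty[THEN bexE])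
    fix C assume C: "C \<noteq> {}" "subset.chain \<A> C"
    then have CA: "C \<subseteq> \<A>" by (simp add: subset.chain_def)
    have "const_subring (\<Union> C)"
      unfolding const_subring_def
    proof (intro conjI ballI)
      obtain U where "U \<in> C" using C(1) by blast
      moreover from this have "range emb \<subseteq> U" using CA unfolding \<A>_def const_subring_def by blast
      ultimately show "range emb \<subseteq> \<Union> C" by blast
      fix a b assume "a \<in> \<Union> C" "b \<in> \<Union> C"
      then obtain X Y where XY: "X \<in> C" "Y \<in> C" "a \<in> X" "b \<in> Y" by blast
      then have "X \<subseteq> Y \<or> Y \<subseteq> X" using C(2) by (auto simp: subset.chain_def)
      then obtain U where U: "U \<in> C" "a \<in> U" "b \<in> U" using XY by blast
      then have "const_subring U" using CA unfolding \<A>_def by blast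
      then show "a + b \<in> \<Union> C" "a * b \<in> \<Union> C" using U const_subringD(4,5)[of U a b] by blast+
    qed
    then show "\<Union> C \<in> \<A>" using C CA unfolding \<A>_def by blast
  qed blast
  have "z \<in> V \<or> inverse z \<in> V" for z
  proof (rule maximal_subring_valuation[of V y])
    fix U assume "const_subring U" "V \<subseteq> U" "inverse y \<notin> U"
    then show "U = V" using V by (auto simp: \<A>_def)
  qed (use V in \<open>auto simp: \<A>_def\<close>)
  then show ?thesis using V by (auto simp: \<A>_def)
qed

section \<open>Valuation rings of the function field are discrete\<close>

context
  fixes V :: "'f set"
  assumes V: "const_subring V" and val: "\<And>z. z \<in> V \<or> inverse z \<in> V"
begin

text \<open>The maximal ideal of \<open>V\<close>; 0 is listed separately because
  \<open>inverse 0 = 0\<close> lies in \<open>V\<close>.\<close>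

private definition nonunits :: "'f set" where
  "nonunits = {z. z = 0 \<or> inverse z \<notin> V}"

private lemma nonunits_V: "z \<in> nonunits \<Longrightarrow> z \<in> V"
  using val[of z] const_subringD(2)[OF V] by (auto simp: nonunits_def)

private lemma nonunits_mult:
  assumes "a \<in> nonunits" "b \<in> V" shows "a * b \<in> nonunits"
proof (rule ccontr)
  assume "a * b \<notin> nonunits"
  then have ab: "a \<noteq> 0" "b \<noteq> 0" "inverse (a * b) \<in> V" by (auto simp: nonunits_def)
  then have "b * inverse (a * b) \<in> V" using const_subringD(5)[OF V assms(2)] by blast
  moreover have "b * inverse (a * b) = inverse a" using ab by (simp add: field_simps)
  ultimately have "inverse a \<in> V" by metis
  then show False using assms ab by (simp add: nonunits_def)
qed

text \<open>One of \<open>a / b\<close> and \<open>b / a\<close> lies in \<open>V\<close>, so the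
  sum is a nonunit times an element of \<open>V\<close>.\<close>

private lemma nonunits_add:
  assumes "a \<in> nonunits" "b \<in> nonunits" shows "a + b \<in> nonunits"
proof -
  have *: "a + b \<in> nonunits" if "a \<in> nonunits" "a \<noteq> 0" "inverse (a / b) \<in> V" for a b
  proof -
    have "a * (1 + inverse (a / b)) \<in> nonunits"
      using that const_subringD[OF V] by (intro nonunits_mult) auto
    moreover have "a * (1 + inverse (a / b)) = a + b" using that by (simp add: field_simps)
    ultimately show ?thesis by simp
  qed
  show ?thesis
  proof (cases "a = 0 \<or> b = 0")
    case True
    then show ?thesis using assms by auto
  next
    case False
    then show ?thesis using val[of "a / b"] *[of a b] *[of b a] assms by (auto simp: add.commute)
  qed
qed

private lemma subspace_nonunits: "K.subspace ((\<lambda>z. a * z) ` nonunits)"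
  unfolding K.subspace_def
proof (intro conjI allI ballI)
  show "0 \<in> (\<lambda>z. a * z) ` nonunits" by (rule image_eqI[of _ _ 0]) (auto simp: nonunits_def)
next
  fix x w assume "x \<in> (\<lambda>z. a * z) ` nonunits" "w \<in> (\<lambda>z. a * z) ` nonunits"
  then obtain x' w' where "x = a * x'" "w = a * w'" "x' \<in> nonunits" "w' \<in> nonunits" by blast
  then show "x + w \<in> (\<lambda>z. a * z) ` nonunits"
    by (intro image_eqI[of _ _ "x' + w'"]) (auto simp: nonunits_add algebra_simps)
next
  fix c x assume "x \<in> (\<lambda>z. a * z) ` nonunits"
  then obtain x' where "x = a * x'" "x' \<in> nonunits" by blast
  then show "emb c * x \<in> (\<lambda>z. a * z) ` nonunits"
    using nonunits_mult[of x' "emb c"] const_subringD(1)[OF V]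
    by (intro image_eqI[of _ _ "x' * emb c"]) auto
qed

private lemma emb_nonunits: "emb c \<in> nonunits \<Longrightarrow> c = 0"
proof (rule ccontr)
  assume c: "emb c \<in> nonunits" "c \<noteq> 0"
  then have "emb c * emb (inverse c) = 1" by (simp flip: emb_mult)
  then have "inverse (emb c) = emb (inverse c)" by (rule inverse_unique)
  then show False using c const_subringD(1)[OF V] by (simp add: nonunits_def)
qed

text \<open>Elements \<open>a 0, \<dots>, a n\<close> of strictly decreasing valuation are independent over \<open>K[a 0]\<close>, so
  strictly ascending chains of principal ideals are finite.\<close>

private lemma chain_bounded:
  assumes mem: "\<And>i. a i \<in> nonunits" "\<And>i. a i \<noteq> 0" and step: "\<And>i. a i / a (Suc i) \<in> nonunits"
  shows False
proof -
  have desc: "a i / a (i + Suc k) \<in> nonunits" for i k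
  proof (induction k)
    case (Suc k)
    have "a i / a (i + Suc k) * (a (i + Suc k) / a (Suc (i + Suc k))) \<in> nonunits"
      using Suc step nonunits_V by (intro nonunits_mult) auto
    then show ?case using mem by simp
  qed (use step in simp)
  then have lt: "a i / a j \<in> nonunits" if "i < j" for i j
    using that by (metis add_Suc_right less_iff_Suc_add)
  have inj: "inj a"
  proof (rule injI, rule ccontr)
    fix i j assume "a i = a j" "i \<noteq> j"
    then have "a i / a j = emb 1" using mem by simp
    then show False using lt[of i j] lt[of j i] \<open>a i = a j\<close> \<open>i \<noteq> j\<close> emb_nonunits[of 1]
      by (cases "i < j") auto
  qed
  have "poly_indep (a 0) (a ` {..n})" for n
  proof (rule poly_indep_if_indep_mod[where M = nonunits and N = "(\<lambda>z. a 0 * z) ` nonunits"])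
    show "K.subspace nonunits" using subspace_nonunits[of 1] by simp
    show "(\<lambda>z. a 0 * z) ` nonunits \<subseteq> nonunits"
      using nonunits_mult[OF mem(1)] nonunits_V by blast
    fix c assume c: "(\<Sum>s\<in>a ` {..n}. emb (c s) * s) \<in> (\<lambda>z. a 0 * z) ` nonunits"
    have c': "(\<Sum>i\<le>n. emb (c (a i)) * a i) \<in> (\<lambda>z. a 0 * z) ` nonunits"
      using c inj by (simp add: sum.reindex inj_on_subset)
    have "\<forall>i\<le>n. c (a i) = 0"
    proof (rule ccontr)
      assume "\<not> ?thesis"
      then have ne: "{i. i \<le> n \<and> c (a i) \<noteq> 0} \<noteq> {}" by blast
      \<comment> \<open>The last index with a nonzero coefficient has the least valuation: all other
        terms, and the remainder \<open>a 0 * m\<close>, lie in \<open>a j\<close> times the maximal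
        ideal, which would make the constant \<open>c (a j)\<close> a nonunit. For
        \<open>j = 0\<close> this uses that \<open>m\<close> itself is a nonunit.\<close>
      define j where "j = Max {i. i \<le> n \<and> c (a i) \<noteq> 0}"
      have fin: "finite {i. i \<le> n \<and> c (a i) \<noteq> 0}" by simp
      have j: "j \<le> n" "c (a j) \<noteq> 0" using Max_in[OF fin ne] by (auto simp: j_def)
      have big: "c (a i) = 0" if "i \<le> n" "j < i" for i
        using Max_ge[OF fin, of i] that by (fastforce simp: j_def)
      let ?J = "(\<lambda>z. a j * z) ` nonunits"
      have in_J: "a i * m \<in> ?J" if "i < j" "m \<in> V" for i m
        using nonunits_mult[OF lt[OF that(1)] that(2)] mem
        by (intro image_eqI[of _ _ "a i / a j * m"]) auto
      obtain m where m: "m \<in> nonunits" "(\<Sum>i\<le>n. emb (c (a i)) * a i) = a 0 * m" using c' by blast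
      have aJ: "a 0 * m \<in> ?J"
        using in_J[of 0 m] nonunits_V[OF m(1)] m(1) by (cases "j = 0") auto
      have "(\<Sum>i\<le>n. emb (c (a i)) * a i) = (\<Sum>i\<le>j. emb (c (a i)) * a i)"
        by (rule sum.mono_neutral_right) (use j big in auto)
      also have "\<dots> = emb (c (a j)) * a j + (\<Sum>i<j. emb (c (a i)) * a i)"
        by (simp add: lessThan_Suc_atMost[symmetric])
      finally have "emb (c (a j)) * a j = a 0 * m - (\<Sum>i<j. emb (c (a i)) * a i)" using m by simp
      also have "\<dots> \<in> ?J"
      proof (rule K.subspace_diff[OF subspace_nonunits aJ])
        show "(\<Sum>i<j. emb (c (a i)) * a i) \<in> ?J"
        proof (rule K.subspace_sum[OF subspace_nonunits])
          fix i assume "i \<in> {..<j}"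
          then show "emb (c (a i)) * a i \<in> ?J"
            using in_J[of i "emb (c (a i))"] const_subringD(1)[OF V] by (simp add: mult.commute)
        qed
      qed
      finally obtain z where "z \<in> nonunits" "emb (c (a j)) * a j = a j * z" by blast
      then have "emb (c (a j)) \<in> nonunits" using mem by simp
      then show False using emb_nonunits j by blast
    qed
    then show "\<forall>s\<in>a ` {..n}. c s = 0" by auto
  qed (use mem subspace_nonunits in auto)
  from poly_indep_card_le[OF this[of "poly_rank (a 0)"]] inj show False
    by (simp add: card_image inj_on_subset)
qed

text \<open>If no element generated the maximal ideal, every nonzero nonunit \<open>t\<close> would
  have a nonunit divisor \<open>s t\<close> with \<open>t / s t\<close> again a nonunit; iterating
  \<open>s\<close> from \<open>y\<close> contradicts \<open>chain_bounded\<close>.\<close>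

private lemma uniformizer:
  assumes y: "y \<in> nonunits" "y \<noteq> 0"
  shows "\<exists>t. t \<in> nonunits \<and> t \<noteq> 0 \<and> (\<forall>z\<in>nonunits. z / t \<in> V)"
proof (rule ccontr)
  assume no: "\<not> ?thesis"
  have "\<forall>t. \<exists>z. t \<in> nonunits \<and> t \<noteq> 0 \<longrightarrow> z \<in> nonunits \<and> z \<noteq> 0 \<and> t / z \<in> nonunits"
  proof
    fix t
    show "\<exists>z. t \<in> nonunits \<and> t \<noteq> 0 \<longrightarrow> z \<in> nonunits \<and> z \<noteq> 0 \<and> t / z \<in> nonunits"
    proof (cases "t \<in> nonunits \<and> t \<noteq> 0")
      case True
      then obtain z where z: "z \<in> nonunits" "z / t \<notin> V" using no by blast
      then have "z \<noteq> 0" using const_subringD(2)[OF V] by auto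
      then show ?thesis using z by (intro exI[of _ z]) (simp add: nonunits_def)
    qed blast
  qed
  then obtain s where s: "\<And>t. t \<in> nonunits \<Longrightarrow> t \<noteq> 0 \<Longrightarrow> s t \<in> nonunits \<and> s t \<noteq> 0 \<and> t / s t \<in> nonunits"
    by metis
  define a where "a = (\<lambda>i. (s ^^ i) y)"
  have "a i \<in> nonunits \<and> a i \<noteq> 0" for i by (induction i) (use y s in \<open>auto simp: a_def\<close>)
  moreover from this have "a i / a (Suc i) \<in> nonunits" for i using s[of "a i"] by (simp add: a_def)
  ultimately show False using chain_bounded[of a] by blast
qed

private definition units :: "'f set" where
  "units = {z \<in> V. z \<noteq> 0 \<and> inverse z \<in> V}"

private lemma units_mult: "a \<in> units \<Longrightarrow> b \<in> units \<Longrightarrow> a * b \<in> units"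
  and units_inverse: "a \<in> units \<Longrightarrow> inverse a \<in> units"
  using const_subringD(5)[OF V] by (auto simp: units_def)

text \<open>Dividing a nonunit by \<open>t\<close> repeatedly must leave the maximal ideal, since
  otherwise the quotients form an infinite chain. On leaving, the quotient is still in
  \<open>V\<close> by the choice of \<open>t\<close>, so it is a unit. Elements outside
  \<open>V\<close> are treated through their inverses.\<close>

private lemma exists_order:
  assumes t: "t \<in> nonunits" "t \<noteq> 0" "\<forall>z\<in>nonunits. z / t \<in> V" and z: "z \<noteq> 0"
  shows "\<exists>n::int. z / t powi n \<in> units"
proof -
  have pos: "\<exists>n::nat. z / t ^ n \<in> units" if z: "z \<in> nonunits" "z \<noteq> 0" for z
  proof -
    have "\<exists>i. z / t ^ i \<notin> nonunits"
    proof (rule ccontr)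
      assume "\<not> ?thesis"
      then show False using chain_bounded[of "\<lambda>i. z / t ^ i"] z t by simp
    qed
    then have "\<exists>k. z / t ^ k \<notin> nonunits \<and> (\<forall>i<k. \<not> z / t ^ i \<notin> nonunits)"
      by (subst (asm) exists_least_iff)
    then obtain k where k: "z / t ^ k \<notin> nonunits" "\<And>i. i < k \<Longrightarrow> z / t ^ i \<in> nonunits" by blast
    obtain k' where k': "k = Suc k'" using z k(1) by (cases k) simp_all
    have "z / t ^ k' / t \<in> V" using t k(2)[of k'] k' by blast
    then have "z / t ^ k \<in> V" by (simp add: k' field_simps)
    then show ?thesis using k(1) z t by (intro exI[of _ k]) (auto simp: nonunits_def units_def)
  qed
  consider "z \<in> nonunits" | "inverse z \<in> nonunits" | "z \<in> units"
    using z by (auto simp: nonunits_def units_def)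
  then show ?thesis
  proof cases
    case 1
    then obtain n where "z / t ^ n \<in> units" using pos z by blast
    then show ?thesis by (intro exI[of _ "int n"]) simp
  next
    case 2
    then obtain n where "inverse z / t ^ n \<in> units" using pos z by force
    from units_inverse[OF this] show ?thesis
      by (intro exI[of _ "- int n"]) (simp add: power_int_minus field_simps)
  next
    case 3
    then show ?thesis by (intro exI[of _ 0]) simp
  qed
qed

text \<open>The value of \<open>z\<close> is the exponent \<open>n\<close> for which
  \<open>z / t powi n\<close> is a unit; no nonzero power of \<open>t\<close> is a unit, so
  \<open>n\<close> is unique and additivity follows.\<close>

lemma valuation_ring_place:
  assumes y: "y \<in> V" "inverse y \<notin> V"
  shows "\<exists>R\<in>places emb. 0 < R y"
proof -
  note V' = const_subringD[OF V]
  have y0: "y \<noteq> 0" using y by auto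
  have ynon: "y \<in> nonunits" using y by (simp add: nonunits_def)
  obtain t where t: "t \<in> nonunits" "t \<noteq> 0" "\<forall>z\<in>nonunits. z / t \<in> V"
    using uniformizer[OF ynon y0] by blast
  have disj: "a \<notin> units" if "a \<in> nonunits" for a
    using that by (auto simp: nonunits_def units_def)
  have tpos: "t powi n \<in> nonunits" if n: "n > 0" for n
  proof -
    obtain k where "n = int (Suc k)" using n by (metis gr0_conv_Suc zero_less_imp_eq_int)
    then have "t powi n = t * t ^ k" by (simp add: power_int_def nat_add_distrib)
    then show ?thesis using nonunits_mult[OF t(1)] V'(8)[OF nonunits_V[OF t(1)]] by simp
  qed
  have tunit: "n = 0" if n: "t powi n \<in> units" for n
  proof (rule ccontr)
    assume "n \<noteq> 0"
    then consider "n > 0" | "- n > 0" by linarith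
    then show False
    proof cases
      case 1
      then show False using tpos disj n by blast
    next
      case 2
      then show False using tpos[OF 2] disj units_inverse[OF n] by (simp add: power_int_minus)
    qed
  qed
  obtain v where v: "\<And>z. z \<noteq> 0 \<Longrightarrow> z / t powi (v z) \<in> units"
    using exists_order[OF t] by metis
  have uniq: "v z = n" if "z / t powi n \<in> units" "z \<noteq> 0" for z n
  proof -
    have "z / t powi (v z) * inverse (z / t powi n) \<in> units"
      using v that units_mult units_inverse by blast
    then have "t powi (n - v z) \<in> units" using that t by (simp add: power_int_diff)
    then show ?thesis using tunit by force
  qed
  have vmult: "v (x * z) = v x + v z" if "x \<noteq> 0" "z \<noteq> 0" for x z
  proof (rule uniq)
    have "x / t powi (v x) * (z / t powi (v z)) \<in> units" using v that units_mult by blast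
    then show "x * z / t powi (v x + v z) \<in> units" using t by (simp add: power_int_add)
  qed (use that in simp)
  have vinv: "v (inverse x) = - v x" if "x \<noteq> 0" for x
  proof -
    have "v 1 = 0" by (rule uniq) (use V' in \<open>auto simp: units_def\<close>)
    then show ?thesis using vmult[of x "inverse x"] that by simp
  qed
  have vnon: "0 < v x" if "x \<noteq> 0" "x \<in> nonunits" for x
  proof (rule ccontr)
    assume "\<not> 0 < v x"
    then consider "v x = 0" | "- v x > 0" by linarith
    then show False
    proof cases
      case 1
      then show False using v[OF that(1)] disj[OF that(2)] by simp
    next
      case 2
      have "x * t powi (- v x) \<in> nonunits"
        using nonunits_mult[OF that(2) nonunits_V[OF tpos[OF 2]]] .
      then show False using v[OF that(1)] disj t by (simp add: power_int_minus divide_inverse)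
    qed
  qed
  have vV: "0 \<le> v x \<longleftrightarrow> x \<in> V" if "x \<noteq> 0" for x
  proof
    assume "x \<in> V"
    show "0 \<le> v x"
    proof (cases "x \<in> nonunits")
      case True
      then show ?thesis using vnon that by force
    next
      case False
      then have "x / t powi 0 \<in> units" using \<open>x \<in> V\<close> that by (simp add: nonunits_def units_def)
      from uniq[OF this that] show ?thesis by simp
    qed
  next
    assume le: "0 \<le> v x"
    show "x \<in> V"
    proof (rule ccontr)
      assume "x \<notin> V"
      then have "inverse x \<in> nonunits" by (simp add: nonunits_def)
      then have "0 < v (inverse x)" using vnon that by simp
      then show False using vinv[OF that] le by simp
    qed
  qed
  have vadd: "v x \<le> v (x + z)" if nz: "x \<noteq> 0" "z \<noteq> 0" "x + z \<noteq> 0" and "v x \<le> v z" for x z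
  proof -
    have "0 \<le> v (z * inverse x)" using that by (simp add: vmult vinv)
    then have "1 + z * inverse x \<in> V" using vV[of "z * inverse x"] that V' by simp
    moreover have eq: "x + z = x * (1 + z * inverse x)" using that by (simp add: field_simps)
    moreover have nz1: "1 + z * inverse x \<noteq> 0" using eq that by auto
    ultimately have "0 \<le> v (1 + z * inverse x)" using vV by blast
    then show ?thesis using vmult[OF nz(1) nz1] eq by simp
  qed
  \<comment> \<open>The choice function \<open>v\<close> is arbitrary at 0; the dummy value required
    by \<open>places\<close> is imposed here.\<close>
  define R where "R = v(0 := 0)"
  have "R \<in> places emb"
    unfolding places_def
  proof (intro CollectI conjI allI impI)
    fix x z :: 'f assume nz: "x \<noteq> 0" "z \<noteq> 0"
    show "R (x * z) = R x + R z" using nz vmult by (simp add: R_def)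
    assume "x + z \<noteq> 0"
    then show "min (R x) (R z) \<le> R (x + z)"
      using nz vadd[of x z] vadd[of z x] by (cases "v x \<le> v z") (auto simp: R_def add.commute)
  next
    fix c :: 'k assume "c \<noteq> 0"
    then have "emb c / t powi 0 \<in> units"
      using emb_nonunits[of c] V'(1) by (auto simp: nonunits_def units_def)
    then show "R (emb c) = 0" using uniq \<open>c \<noteq> 0\<close> by (simp add: R_def)
  next
    have "t / t powi 1 \<in> units" using t V' by (simp add: units_def)
    then have "v t = 1" using uniq t by blast
    then show "\<exists>t. t \<noteq> 0 \<and> R t = 1" using t by (intro exI[of _ t]) (simp add: R_def)
  qed (simp add: R_def)
  moreover have "0 < R y" using vnon[OF y0 ynon] y0 by (simp add: R_def)
  ultimately show ?thesis by blast
qed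

end

lemma exists_zero: "y \<notin> range emb \<Longrightarrow> \<exists>R\<in>places emb. 0 < R y"
  using exists_valuation_ring[of y] valuation_ring_place by blast

end

subsection \<open>Divisors and Riemann's theorem\<close>

context function_field
begin

lemma inverse_notin_range_emb: "x \<notin> range emb \<Longrightarrow> inverse x \<notin> range emb"
proof
  assume x: "x \<notin> range emb" "inverse x \<in> range emb"
  then obtain c where c: "inverse x = emb c" by blast
  have x0: "x \<noteq> 0" using x emb_0 by (metis rangeI)
  then have "c \<noteq> 0" using c by auto
  then have "emb c * emb (inverse c) = 1" by (simp flip: emb_mult)
  then have "inverse (emb c) = emb (inverse c)" by (rule inverse_unique)
  then have "x = emb (inverse c)" using c by (metis inverse_inverse_eq)
  then show False using x by blast
qed

lemma RR_space_eq: "RR_space emb D = {f. \<forall>R\<in>places emb. f \<in> vge R (- Poly_Mapping.lookup D R)}"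
  by (auto simp: RR_space_def vge_def minus_le_iff[of "_ :: int"] add.commute algebra_simps)

lemma subspace_RR: "K.subspace (RR_space emb D)"
  unfolding RR_space_eq using subspace_vge unfolding K.subspace_def by blast

lemma subspace_zero: "K.subspace {0}"
  by (simp add: K.subspace_def)

text \<open>A nonconstant function has a pole, namely any zero of its inverse.\<close>

lemma RR_space_0: "RR_space emb 0 = range emb"
proof
  show "range emb \<subseteq> RR_space emb 0" by (auto simp: RR_space_eq vge_emb)
  show "RR_space emb 0 \<subseteq> range emb"
  proof
    fix f assume f: "f \<in> RR_space emb 0"
    show "f \<in> range emb"
    proof (rule ccontr)
      assume nf: "f \<notin> range emb"
      then have f0: "f \<noteq> 0" using emb_0 by (metis rangeI)
      obtain R where R: "R \<in> places emb" "0 < R (inverse f)"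
        using exists_zero[OF inverse_notin_range_emb[OF nf]] by blast
      then have "R f < 0" by (simp add: place_inverse)
      then show False using f R f0 by (auto simp: RR_space_eq vge_def)
    qed
  qed
qed

section \<open>Degrees of divisors and dimensions of Riemann-Roch spaces\<close>

abbreviation ell :: "'f divisor \<Rightarrow> nat" where
  "ell D \<equiv> K.rdim {0} (RR_space emb D)"

abbreviation dg :: "'f divisor \<Rightarrow> int" where
  "dg \<equiv> degree_divisor emb"

lemma RR_0: "K.fin_mod {0} (RR_space emb 0)" "ell 0 = 1"
proof -
  have "K.basis_mod {0} (RR_space emb 0) {1}"
    unfolding K.basis_mod_def RR_space_0 using emb_1 by (auto intro: rev_image_eqI[of 1])
  from this K.rdim_eq[OF subspace_zero this]
  show "K.fin_mod {0} (RR_space emb 0)" "ell 0 = 1" by (auto simp: K.fin_mod_def)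
qed

lemma degree_superset:
  assumes "finite A" "Poly_Mapping.keys D \<subseteq> A"
  shows "dg D = (\<Sum>R\<in>A. Poly_Mapping.lookup D R * int (place_degree emb R))"
  unfolding degree_divisor_def
  by (rule sum.mono_neutral_left) (use assms in \<open>auto simp: in_keys_iff\<close>)

lemma degree_add: "dg (D + E) = dg D + dg E"
proof -
  let ?A = "Poly_Mapping.keys D \<union> Poly_Mapping.keys E"
  have "dg (D + E) = (\<Sum>R\<in>?A. Poly_Mapping.lookup (D + E) R * int (place_degree emb R))"
    by (rule degree_superset) (simp, rule Poly_Mapping.keys_add)
  also have "\<dots> = dg D + dg E"
    by (subst (1 2) degree_superset[of ?A]) (auto simp: lookup_add algebra_simps sum.distrib)
  finally show ?thesis .
qed

lemma degree_0 [simp]: "dg 0 = 0"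
  by (simp add: degree_divisor_def)

lemma degree_uminus: "dg (- D) = - dg D"
  using degree_add[of D "- D"] by simp

lemma degree_diff: "dg (D - E) = dg D - dg E"
  using degree_add[of D "- E"] by (simp add: degree_uminus)

lemma degree_single: "dg (Poly_Mapping.single R n) = n * int (place_degree emb R)"
  by (simp add: degree_divisor_def)

lemma degree_sum: "dg (\<Sum>i\<in>I. D i) = (\<Sum>i\<in>I. dg (D i))"
  by (induction I rule: infinite_finite_induct) (auto simp: degree_add)

lemma divisors_0: "0 \<in> divisors emb"
  and divisors_add: "D \<in> divisors emb \<Longrightarrow> E \<in> divisors emb \<Longrightarrow> D + E \<in> divisors emb"
  and divisors_uminus: "D \<in> divisors emb \<Longrightarrow> - D \<in> divisors emb"
  and divisors_single: "R \<in> places emb \<Longrightarrow> Poly_Mapping.single R n \<in> divisors emb"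
  using Poly_Mapping.keys_add[of D E] by (auto simp: divisors_def)

lemma divisors_diff: "D \<in> divisors emb \<Longrightarrow> E \<in> divisors emb \<Longrightarrow> D - E \<in> divisors emb"
  using divisors_add[of D "- E"] divisors_uminus[of E] by simp

lemma divisors_sum: "(\<And>i. i \<in> I \<Longrightarrow> D i \<in> divisors emb) \<Longrightarrow> (\<Sum>i\<in>I. D i) \<in> divisors emb"
  by (induction I rule: infinite_finite_induct) (auto simp: divisors_0 divisors_add)

definition mkdiv :: "('f \<Rightarrow> int) set \<Rightarrow> (('f \<Rightarrow> int) \<Rightarrow> int) \<Rightarrow> 'f divisor" where
  "mkdiv A n = (\<Sum>R\<in>A. Poly_Mapping.single R (n R))"

lemma mkdiv_lookup: "finite A \<Longrightarrow> Poly_Mapping.lookup (mkdiv A n) R = (if R \<in> A then n R else 0)"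
  by (simp add: mkdiv_def lookup_sum lookup_single when_def)

lemma mkdiv_divisors: "A \<subseteq> places emb \<Longrightarrow> mkdiv A n \<in> divisors emb"
  unfolding mkdiv_def by (intro divisors_sum divisors_single) auto

lemma mkdiv_degree: "dg (mkdiv A n) = (\<Sum>R\<in>A. n R * int (place_degree emb R))"
  by (simp add: mkdiv_def degree_sum degree_single)

lemma mkdiv_keys: "mkdiv (Poly_Mapping.keys D) (Poly_Mapping.lookup D) = D"
  by (rule poly_mapping_eqI) (simp add: mkdiv_lookup in_keys_iff)

lemma RR_space_mono:
  "(\<And>R. R \<in> places emb \<Longrightarrow> Poly_Mapping.lookup D R \<le> Poly_Mapping.lookup E R) \<Longrightarrow> RR_space emb D \<subseteq> RR_space emb E"
  unfolding RR_space_def by force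

text \<open>Multiplication by \<open>u\<close>, taken modulo the maximal ideal, sends a function to
  its leading coefficient at \<open>R\<close> in the residue field, with kernel \<open>L(D)\<close>.
  Which residues occur is left open, hence an inequality.\<close>

lemma RR_step:
  assumes R: "R \<in> places emb"
  shows "K.fin_mod (RR_space emb D) (RR_space emb (D + Poly_Mapping.single R 1))"
    "K.rdim (RR_space emb D) (RR_space emb (D + Poly_Mapping.single R 1)) \<le> place_degree emb R"
proof -
  obtain u where u: "u \<noteq> 0" "R u = Poly_Mapping.lookup D R + 1" using place_element[OF R] by blast
  let ?V = "RR_space emb (D + Poly_Mapping.single R 1)"
  have iff: "u * z \<in> vge R n \<longleftrightarrow> z \<in> vge R (n - Poly_Mapping.lookup D R - 1)" for z n
    using vge_mult_iff[OF R u(1), of z "n - Poly_Mapping.lookup D R - 1"] u by simp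
  have lk: "Poly_Mapping.lookup (D + Poly_Mapping.single R 1) S
      = Poly_Mapping.lookup D S + (if S = R then 1 else 0)" for S
    by (simp add: lookup_add lookup_single when_def)
  have im: "(\<lambda>z. u * z) ` ?V \<subseteq> vge R 0"
    using R by (auto simp: RR_space_eq iff lk)
  have sub: "RR_space emb D \<subseteq> ?V" by (rule RR_space_mono) (simp add: lk)
  have W: "RR_space emb D = {z \<in> ?V. u * z \<in> vge R 1}"
  proof (intro equalityI subsetI)
    fix z assume "z \<in> RR_space emb D"
    then show "z \<in> {z \<in> ?V. u * z \<in> vge R 1}" using sub R by (auto simp: iff RR_space_eq)
  next
    fix z assume z: "z \<in> {z \<in> ?V. u * z \<in> vge R 1}"
    have "z \<in> vge S (- Poly_Mapping.lookup D S)" if "S \<in> places emb" for S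
      using z that by (cases "S = R") (auto simp: iff RR_space_eq lk dest: bspec[of _ _ S])
    then show "z \<in> RR_space emb D" by (simp add: RR_space_eq)
  qed
  note args = module_hom_mult subspace_vge[OF R] subspace_RR residue_finite(1)[OF R] im W subspace_RR
  show "K.fin_mod (RR_space emb D) ?V" by (rule K.rdim_pullback_le(1)[OF args])
  show "K.rdim (RR_space emb D) ?V \<le> place_degree emb R"
    using K.rdim_pullback_le(2)[OF args] residue_finite(2)[OF R] by simp
qed

lemma RR_space_0_mem: "{0} \<subseteq> RR_space emb D"
  by (simp add: RR_space_def)

lemma ell_add_single:
  assumes R: "R \<in> places emb" and fin: "K.fin_mod {0} (RR_space emb D)"
  shows "K.fin_mod {0} (RR_space emb (D + Poly_Mapping.single R (int k))) \<and>
    ell (D + Poly_Mapping.single R (int k)) \<le> ell D + k * place_degree emb R"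
proof (induction k)
  case 0
  then show ?case using fin by simp
next
  case (Suc k)
  let ?D = "D + Poly_Mapping.single R (int k)"
  have eq: "D + Poly_Mapping.single R (int (Suc k)) = ?D + Poly_Mapping.single R 1"
    by (simp add: single_add[symmetric] add.assoc add.commute)
  have sub: "RR_space emb ?D \<subseteq> RR_space emb (?D + Poly_Mapping.single R 1)"
    by (rule RR_space_mono) (simp add: lookup_add lookup_single when_def)
  note tr = K.rdim_trans[OF subspace_zero subspace_RR RR_space_0_mem sub conjunct1[OF Suc] RR_step(1)[OF R]]
  show ?case unfolding eq using tr Suc RR_step(2)[OF R, of ?D] by simp
qed

lemma ell_add_mkdiv:
  assumes A: "finite A" "A \<subseteq> places emb" and fin: "K.fin_mod {0} (RR_space emb D)"
  shows "K.fin_mod {0} (RR_space emb (D + mkdiv A (\<lambda>R. int (n R)))) \<and>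
    ell (D + mkdiv A (\<lambda>R. int (n R))) \<le> ell D + (\<Sum>R\<in>A. n R * place_degree emb R)"
  using A
proof induction
  case empty
  then show ?case using fin by (simp add: mkdiv_def)
next
  case (insert R A)
  have eq: "D + mkdiv (insert R A) (\<lambda>R. int (n R))
      = (D + mkdiv A (\<lambda>R. int (n R))) + Poly_Mapping.single R (int (n R))"
    using insert by (simp add: mkdiv_def add_ac)
  have R: "R \<in> places emb" and IH: "K.fin_mod {0} (RR_space emb (D + mkdiv A (\<lambda>R. int (n R))))"
    "ell (D + mkdiv A (\<lambda>R. int (n R))) \<le> ell D + (\<Sum>R\<in>A. n R * place_degree emb R)"
    using insert by auto
  show ?case unfolding eq using ell_add_single[OF R IH(1), of "n R"] IH(2) insert.hyps by simp
qed

text \<open>The positive part \<open>E\<close> of \<open>D\<close> is reached from the zero divisor,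
  whose space is \<open>K\<close>, by adding finitely many points.\<close>

lemma RR_fin:
  assumes D: "D \<in> divisors emb"
  shows "K.fin_mod {0} (RR_space emb D)"
proof -
  define E where "E = mkdiv (Poly_Mapping.keys D) (\<lambda>R. int (nat (Poly_Mapping.lookup D R)))"
  have "K.fin_mod {0} (RR_space emb (0 + E))"
    unfolding E_def
    by (rule ell_add_mkdiv[OF finite_keys _ RR_0(1), THEN conjunct1]) (use D in \<open>simp add: divisors_def\<close>)
  moreover have "RR_space emb D \<subseteq> RR_space emb (0 + E)"
    by (rule RR_space_mono) (simp add: E_def mkdiv_lookup in_keys_iff)
  ultimately show ?thesis using K.rdim_mono(1)[OF subspace_zero] by blast
qed

lemma RR_dim_eq: "D \<in> divisors emb \<Longrightarrow> RR_dim emb D = ell D"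
  unfolding RR_dim_def using K.dim_eq_rdim[OF subspace_RR RR_fin] .

text \<open>Raising a coefficient by one adds the degree of the place to \<open>deg\<close> and at
  most that much to \<open>l\<close>. The second part says that \<open>deg - l\<close> is monotone
  in the divisor.\<close>

lemma ell_mono_bound:
  assumes D: "D \<in> divisors emb" and E: "E \<in> divisors emb"
    and le: "\<And>R. R \<in> places emb \<Longrightarrow> Poly_Mapping.lookup D R \<le> Poly_Mapping.lookup E R"
  shows "ell D \<le> ell E" "int (ell E) \<le> int (ell D) + dg E - dg D"
proof -
  show "ell D \<le> ell E" using K.rdim_mono(2)[OF subspace_zero RR_fin[OF E] RR_space_mono[OF le]] .
  define A where "A = Poly_Mapping.keys (E - D)"
  define n where "n = (\<lambda>R. nat (Poly_Mapping.lookup (E - D) R))"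
  have A: "finite A" "A \<subseteq> places emb"
    using divisors_diff[OF E D] by (auto simp: A_def divisors_def)
  have pos: "0 \<le> Poly_Mapping.lookup (E - D) R" if "R \<in> A" for R
    using le[of R] A that by (auto simp: lookup_minus)
  have mk: "mkdiv A (\<lambda>R. int (n R)) = E - D"
  proof -
    have "mkdiv A (\<lambda>R. int (n R)) = mkdiv A (Poly_Mapping.lookup (E - D))"
      unfolding mkdiv_def by (rule sum.cong) (simp_all add: n_def pos)
    then show ?thesis by (simp add: A_def mkdiv_keys)
  qed
  have "dg (E - D) = int (\<Sum>R\<in>A. n R * place_degree emb R)"
    unfolding mk[symmetric] mkdiv_degree by simp
  moreover have "ell E \<le> ell D + (\<Sum>R\<in>A. n R * place_degree emb R)"
    using ell_add_mkdiv[OF A RR_fin[OF D], of n] mk by simp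
  ultimately show "int (ell E) \<le> int (ell D) + dg E - dg D" unfolding degree_diff by linarith
qed

lemma ell_principal:
  assumes D: "D \<in> divisors emb" and E: "E \<in> divisors emb" and z: "z \<noteq> 0"
    and eq: "\<And>R. R \<in> places emb \<Longrightarrow> Poly_Mapping.lookup E R = Poly_Mapping.lookup D R - R z"
  shows "ell D = ell E" "f \<in> RR_space emb D \<longleftrightarrow> z * f \<in> RR_space emb E"
proof -
  have iff: "f \<in> RR_space emb D \<longleftrightarrow> z * f \<in> RR_space emb E" for f
  proof -
    have "f \<in> vge R (- Poly_Mapping.lookup D R) \<longleftrightarrow> z * f \<in> vge R (- Poly_Mapping.lookup E R)"
      if R: "R \<in> places emb" for R
      using vge_mult_iff[OF R z, of f "- Poly_Mapping.lookup D R"] eq[OF R] by simp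
    then show ?thesis by (simp add: RR_space_eq)
  qed
  then show "f \<in> RR_space emb D \<longleftrightarrow> z * f \<in> RR_space emb E" .
  show "ell D = ell E"
  proof (rule K.rdim_pullback_eq[OF module_hom_mult subspace_zero subspace_zero RR_fin[OF E] _ _ subspace_RR])
    show "(\<lambda>w. z * w) ` RR_space emb D \<subseteq> RR_space emb E" using iff by blast
    show "{0} = {w \<in> RR_space emb D. z * w \<in> {0}}" using z RR_space_0_mem by auto
    fix w assume "w \<in> RR_space emb E"
    then show "\<exists>y\<in>RR_space emb D. w - z * y \<in> {0}"
      using iff[of "w / z"] z by (intro bexI[of _ "w / z"]) auto
  qed
qed

section \<open>Degree of the divisor of poles\<close>

definition poles :: "'f \<Rightarrow> ('f \<Rightarrow> int) set" where
  "poles x = {R \<in> places emb. R x < 0}"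

lemma poles_finite: "x \<noteq> 0 \<Longrightarrow> finite (poles x)"
  using zeros_finite[of "inverse x"] by (simp add: poles_def place_inverse cong: conj_cong)

lemma poles_places: "poles x \<subseteq> places emb"
  by (auto simp: poles_def)

definition pole_div :: "int \<Rightarrow> 'f \<Rightarrow> 'f divisor" where
  "pole_div k x = mkdiv (poles x) (\<lambda>R. k * - R x)"

lemma pole_div_lookup:
  "x \<noteq> 0 \<Longrightarrow> R \<in> places emb \<Longrightarrow> Poly_Mapping.lookup (pole_div k x) R = k * max 0 (- R x)"
  by (auto simp: pole_div_def mkdiv_lookup poles_finite) (auto simp: poles_def)

lemma pole_div_divisors: "pole_div k x \<in> divisors emb"
  unfolding pole_div_def by (rule mkdiv_divisors[OF poles_places])

lemma pole_div_degree: "dg (pole_div k x) = k * dg (pole_div 1 x)"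
  by (simp add: pole_div_def mkdiv_degree sum_distrib_left mult.assoc)

lemma pole_div_degree_le:
  assumes x: "x \<noteq> 0"
  shows "dg (pole_div 1 x) \<le> int (poly_rank (inverse x))"
proof -
  have "dg (pole_div 1 x) = int (\<Sum>R\<in>poles x. nat (R (inverse x)) * place_degree emb R)"
    unfolding pole_div_def mkdiv_degree of_nat_sum
    by (rule sum.cong) (auto simp: poles_def place_inverse)
  also have "\<dots> \<le> int (poly_rank (inverse x))"
    using x poles_finite by (intro of_nat_mono zeros_degree_le poles_places) (auto simp: poles_def place_inverse)
  finally show ?thesis .
qed

text \<open>The divisor \<open>C\<close> absorbs the poles of a largest independent family
  \<open>Z\<close>, so all \<open>x ^ j * z\<close> with \<open>j\<close> at most \<open>k\<close>
  lie in the space of \<open>k\<close> times the pole divisor plus \<open>C\<close>, and they are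
  independent over \<open>K\<close>.\<close>

lemma pole_div_growth:
  assumes x: "x \<notin> range emb"
  shows "\<exists>C\<in>divisors emb. 0 \<le> dg C \<and>
    (\<forall>R\<in>places emb. 0 \<le> Poly_Mapping.lookup C R) \<and>
    (\<forall>k. Suc k * poly_rank x \<le> ell (pole_div (int k) x + C))"
proof -
  have x0: "x \<noteq> 0" using x emb_0 by (metis rangeI)
  obtain Z where Z: "poly_indep x Z" "card Z = poly_rank x" using poly_rank_attained by blast
  have finZ: "finite Z" using Z by (simp add: poly_indep_def)
  have Z0: "z \<noteq> 0" if z: "z \<in> Z" for z
  proof
    assume "z = 0"
    define p :: "'f \<Rightarrow> 'k poly" where "p = (\<lambda>w. if w = z then 1 else 0)"
    have "(\<Sum>w\<in>Z. ev (p w) x * w) = 0" by (rule sum.neutral) (simp add: p_def \<open>z = 0\<close>)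
    then have "p z = 0" using Z(1) z unfolding poly_indep_def by blast
    then show False by (simp add: p_def)
  qed
  define C where "C = (\<Sum>z\<in>Z. pole_div 1 z)"
  have C: "C \<in> divisors emb" unfolding C_def by (intro divisors_sum pole_div_divisors)
  have lkC: "Poly_Mapping.lookup C R = (\<Sum>z\<in>Z. max 0 (- R z))" if "R \<in> places emb" for R
    unfolding C_def lookup_sum by (rule sum.cong) (simp_all add: pole_div_lookup Z0 that)
  have C0: "\<forall>R\<in>places emb. 0 \<le> Poly_Mapping.lookup C R" by (simp add: lkC sum_nonneg)
  have "0 \<le> dg C" unfolding degree_divisor_def
    using C C0 by (intro sum_nonneg mult_nonneg_nonneg) (auto simp: divisors_def)
  moreover have "Suc k * poly_rank x \<le> ell (pole_div (int k) x + C)" for k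
  proof -
    let ?E = "pole_div (int k) x + C"
    have E: "?E \<in> divisors emb" by (intro divisors_add pole_div_divisors C)
    obtain S where S: "K.basis_mod {0} (RR_space emb ?E) S" "card S = ell ?E"
      using K.fin_modE[OF subspace_zero RR_fin[OF E]] by blast
    have "card ({..k} \<times> Z) \<le> card S"
    proof (rule K.basis_mod_card_ge[OF subspace_zero S(1), where v = "\<lambda>i. x ^ fst i * snd i"])
      show "finite ({..k} \<times> Z)" using finZ by simp
      show "(\<lambda>i. x ^ fst i * snd i) ` ({..k} \<times> Z) \<subseteq> RR_space emb ?E"
      proof (rule image_subsetI)
        fix i assume "i \<in> {..k} \<times> Z"
        then obtain j z where i: "i = (j, z)" "j \<le> k" "z \<in> Z" by blast
        have "x ^ j * z \<in> vge R (- Poly_Mapping.lookup ?E R)" if R: "R \<in> places emb" for R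
        proof -
          have "int k * max 0 (- R x) \<ge> int j * max 0 (- R x)"
            using i by (intro mult_right_mono) auto
          moreover have "int j * max 0 (- R x) \<ge> int j * - R x"
            by (intro mult_left_mono) auto
          moreover have "(\<Sum>z\<in>Z. max 0 (- R z)) \<ge> max 0 (- R z)"
            using finZ i by (intro member_le_sum) auto
          ultimately show ?thesis
            using Z0[OF i(3)] x0 R by (auto simp: vge_def lookup_add pole_div_lookup lkC place_mult place_power)
        qed
        then show "x ^ fst i * snd i \<in> RR_space emb ?E" by (simp add: RR_space_eq i)
      qed
      fix c assume "(\<Sum>i\<in>{..k} \<times> Z. emb (c i) * (x ^ fst i * snd i)) \<in> {0}"
      then show "\<forall>i\<in>{..k} \<times> Z. c i = 0" using poly_indep_powers[OF Z(1)] by blast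
    qed
    then show ?thesis using S Z by (simp add: card_cartesian_product)
  qed
  ultimately show ?thesis using C C0 by blast
qed

lemma ell_effective_le:
  assumes C: "C \<in> divisors emb" "\<forall>R\<in>places emb. 0 \<le> Poly_Mapping.lookup C R"
    and D: "D \<in> divisors emb"
  shows "int (ell (D + C)) \<le> int (ell D) + dg C"
  using ell_mono_bound(2)[OF D divisors_add[OF D C(1)]] C(2) by (simp add: lookup_add degree_add)

text \<open>Let \<open>n = poly_rank x\<close> and let \<open>d\<close> be the degree of the pole
  divisor. The dimension for \<open>k\<close> times the pole divisor plus \<open>C\<close> is at
  least \<open>(k + 1) n\<close> and at most \<open>1 + k d + deg C\<close>; comparing growth in
  \<open>k\<close> gives the claim.\<close>

lemma poly_rank_le_pole_div:
  assumes x: "x \<notin> range emb"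
  shows "int (poly_rank x) \<le> dg (pole_div 1 x)"
proof (rule ccontr)
  assume neg: "\<not> ?thesis"
  have x0: "x \<noteq> 0" using x emb_0 by (metis rangeI)
  obtain C where C: "C \<in> divisors emb" "0 \<le> dg C" "\<forall>R\<in>places emb. 0 \<le> Poly_Mapping.lookup C R"
    "\<forall>k. Suc k * poly_rank x \<le> ell (pole_div (int k) x + C)" using pole_div_growth[OF x] by blast
  \<comment> \<open>If \<open>d + 1 <= n\<close>, the two bounds give \<open>k + d <= deg C\<close>,
    which this \<open>k\<close> excludes.\<close>
  define k where "k = nat (dg C) + 1"
  let ?E = "pole_div (int k) x + C"
  have "int (ell (0 + ?E)) \<le> int (ell 0) + dg ?E"
    using C(3) x0 by (intro ell_effective_le divisors_add pole_div_divisors C(1) divisors_0)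
      (simp add: lookup_add pole_div_lookup)
  then have "int (ell ?E) \<le> 1 + (int k * dg (pole_div 1 x) + dg C)"
    using pole_div_degree[of "int k" x] by (simp add: degree_add RR_0(2))
  moreover have "int (Suc k * poly_rank x) \<le> int (ell ?E)" using C(4) by (simp only: of_nat_le_iff)
  moreover have "int (Suc k) * (dg (pole_div 1 x) + 1) \<le> int (Suc k) * int (poly_rank x)"
    using neg by (intro mult_left_mono) auto
  ultimately have "int (Suc k) * (dg (pole_div 1 x) + 1) \<le> 1 + (int k * dg (pole_div 1 x) + dg C)"
    unfolding of_nat_mult by linarith
  moreover have "0 \<le> dg (pole_div 1 x)"
    unfolding pole_div_def mkdiv_degree
    by (intro sum_nonneg mult_nonneg_nonneg) (auto simp: poles_def)
  ultimately show False using C(2) by (simp add: k_def algebra_simps)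
qed

text \<open>The four bounds for \<open>x\<close> and \<open>1/x\<close> close up to a cycle of inequalities, so all are equalities.\<close>

lemma pole_div_degree_eq:
  assumes x: "x \<notin> range emb"
  shows "dg (pole_div 1 x) = int (poly_rank x)" "dg (pole_div 1 (inverse x)) = dg (pole_div 1 x)"
proof -
  have x0: "x \<noteq> 0" using x emb_0 by (metis rangeI)
  note bounds = pole_div_degree_le[OF x0] poly_rank_le_pole_div[OF inverse_notin_range_emb[OF x]]
    pole_div_degree_le[of "inverse x"] poly_rank_le_pole_div[OF x]
  then show "dg (pole_div 1 x) = int (poly_rank x)" "dg (pole_div 1 (inverse x)) = dg (pole_div 1 x)"
    using x0 by auto
qed

lemma principal_divisor:
  assumes z: "z \<noteq> 0"
  shows "\<exists>E\<in>divisors emb. dg E = 0 \<and> (\<forall>R\<in>places emb. Poly_Mapping.lookup E R = R z)"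
proof (cases "z \<in> range emb")
  case True
  then show ?thesis by (intro bexI[of _ 0]) (auto simp: place_emb divisors_0)
next
  case False
  let ?E = "pole_div 1 (inverse z) - pole_div 1 z"
  have "Poly_Mapping.lookup ?E R = R z" if R: "R \<in> places emb" for R
    using z R by (simp add: lookup_minus pole_div_lookup place_inverse)
  then show ?thesis using pole_div_degree_eq(2)[OF False]
    by (intro bexI[of _ ?E]) (auto simp: degree_diff intro: divisors_diff pole_div_divisors)
qed

lemma effective_degree:
  assumes "D \<in> divisors emb" "\<And>R. R \<in> places emb \<Longrightarrow> 0 \<le> Poly_Mapping.lookup D R"
  shows "0 \<le> dg D"
  unfolding degree_divisor_def
  using assms by (intro sum_nonneg mult_nonneg_nonneg) (auto simp: divisors_def)

lemma degree_neg_RR: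
  assumes D: "D \<in> divisors emb" and neg: "dg D < 0"
  shows "RR_space emb D = {0}"
proof (rule ccontr)
  assume "RR_space emb D \<noteq> {0}"
  then obtain f where f: "f \<in> RR_space emb D" "f \<noteq> 0" using RR_space_0_mem by blast
  obtain E where E: "E \<in> divisors emb" "dg E = 0" "\<forall>R\<in>places emb. Poly_Mapping.lookup E R = R f"
    using principal_divisor[OF f(2)] by blast
  have "0 \<le> dg (D + E)"
    using f E by (intro effective_degree divisors_add D) (auto simp: lookup_add RR_space_def)
  then show False using E neg by (simp add: degree_add)
qed

text \<open>A nonzero \<open>z\<close> in \<open>L(D - A)\<close> makes \<open>D\<close> plus the
  divisor of \<open>z\<close> at least \<open>A\<close>; the quantity \<open>deg - l\<close> is
  monotone and does not change under linear equivalence.\<close>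

lemma ell_pos_dominates:
  assumes A: "A \<in> divisors emb" and D: "D \<in> divisors emb" and pos: "0 < ell (D - A)"
  shows "dg A - int (ell A) \<le> dg D - int (ell D)"
proof -
  have "RR_space emb (D - A) \<noteq> {0}"
  proof
    assume "RR_space emb (D - A) = {0}"
    moreover have "K.basis_mod {0} {0} {}" by (simp add: K.basis_mod_def)
    ultimately show False using pos K.rdim_eq[OF subspace_zero] by fastforce
  qed
  then obtain z where z: "z \<in> RR_space emb (D - A)" "z \<noteq> 0" using RR_space_0_mem by blast
  obtain E where E: "E \<in> divisors emb" "dg E = 0" "\<forall>R\<in>places emb. Poly_Mapping.lookup E R = R z"
    using principal_divisor[OF z(2)] by blast
  have DE: "D + E \<in> divisors emb" by (intro divisors_add D E)
  have "ell (D + E) = ell D"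
    by (rule ell_principal(1)[OF DE D z(2)]) (simp add: lookup_add E)
  moreover have "int (ell (D + E)) \<le> int (ell A) + dg (D + E) - dg A"
    using z E by (intro ell_mono_bound(2) A DE) (auto simp: lookup_add lookup_minus RR_space_def)
  ultimately show ?thesis using E by (simp add: degree_add)
qed

text \<open>On multiples of the pole divisor of \<open>x\<close> the quantity \<open>deg - l\<close>
  is bounded by \<open>pole_div_growth\<close>. Every \<open>A\<close> is dominated, up to
  equivalence, by such a multiple and inherits the bound.\<close>

lemma riemann_bound: "\<exists>\<gamma>. \<forall>A\<in>divisors emb. dg A - int (ell A) \<le> \<gamma>"
proof -
  obtain x where "\<not> algebraic_over emb x" using finite_over_rational by blast
  then have x: "x \<notin> range emb" using algebraic_iff by blast
  then have x0: "x \<noteq> 0" using emb_0 by (metis rangeI)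
  obtain C where C: "C \<in> divisors emb" "0 \<le> dg C" "\<forall>R\<in>places emb. 0 \<le> Poly_Mapping.lookup C R"
    "\<forall>k. Suc k * poly_rank x \<le> ell (pole_div (int k) x + C)" using pole_div_growth[OF x] by blast
  let ?n = "int (poly_rank x)"
  have deg: "dg (pole_div (int k) x) = int k * ?n" for k
    using pole_div_degree[of "int k" x] pole_div_degree_eq(1)[OF x] by simp
  have npos: "0 < ?n"
  proof -
    obtain R where R: "R \<in> places emb" "0 < R (inverse x)"
      using exists_zero[OF inverse_notin_range_emb[OF x]] by blast
    have "0 < dg (pole_div 1 x)" unfolding pole_div_def mkdiv_degree
    proof (rule sum_pos2[OF poles_finite[OF x0], of R])
      show "R \<in> poles x" using R by (simp add: poles_def place_inverse)
      show "0 < 1 * - R x * int (place_degree emb R)"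
        using R residue_finite(3)[OF R(1)] by (intro mult_pos_pos) (simp_all add: place_inverse)
      show "0 \<le> 1 * - S x * int (place_degree emb S)" if "S \<in> poles x" for S
        using that by (intro mult_nonneg_nonneg) (simp_all add: poles_def)
    qed
    then show ?thesis using pole_div_degree_eq(1)[OF x] by simp
  qed
  have growth: "int k * ?n - int (ell (pole_div (int k) x)) \<le> dg C - ?n" for k
  proof -
    have "int (Suc k * poly_rank x) \<le> int (ell (pole_div (int k) x + C))" using C(4) by (simp only: of_nat_le_iff)
    also have "\<dots> \<le> int (ell (pole_div (int k) x)) + dg C"
      by (rule ell_effective_le[OF C(1,3) pole_div_divisors])
    finally show ?thesis by (simp add: algebra_simps)
  qed
  have "dg A - int (ell A) \<le> dg C - ?n" if A: "A \<in> divisors emb" for A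
  proof -
    define E where "E = mkdiv (Poly_Mapping.keys A) (\<lambda>R. max 0 (Poly_Mapping.lookup A R))"
    have E: "E \<in> divisors emb" unfolding E_def using A by (intro mkdiv_divisors) (auto simp: divisors_def)
    have E0: "0 \<le> Poly_Mapping.lookup E R" "Poly_Mapping.lookup A R \<le> Poly_Mapping.lookup E R" for R
      by (auto simp: E_def mkdiv_lookup in_keys_iff)
    \<comment> \<open>With \<open>n = poly_rank x\<close>, the space for \<open>?B - A\<close> has
      dimension at least \<open>k n + n - deg C - deg E\<close>, which is positive for this
      \<open>k\<close>.\<close>
    define k where "k = nat (dg C + dg E) + 1"
    let ?B = "pole_div (int k) x"
    have BA: "?B - A \<in> divisors emb" by (intro divisors_diff pole_div_divisors A)
    have "int (ell ?B) \<le> int (ell (?B - A + E))"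
      using ell_mono_bound(1)[OF pole_div_divisors divisors_add[OF BA E], of "int k" x] E0
      by (simp add: lookup_add lookup_minus)
    also have "\<dots> \<le> int (ell (?B - A)) + dg E"
      using E0 by (intro ell_effective_le E BA) auto
    finally have "int (ell ?B) - dg E \<le> int (ell (?B - A))" by simp
    moreover have "int k * ?n - int (ell ?B) \<le> dg C - ?n" by (rule growth)
    moreover have "int k * 1 \<le> int k * ?n" using npos by (intro mult_left_mono) auto
    moreover have "dg C + dg E < int k" by (simp add: k_def)
    ultimately have "0 < ell (?B - A)" using npos by linarith
    from ell_pos_dominates[OF A pole_div_divisors this] deg growth[of k] show ?thesis by simp
  qed
  then show ?thesis by blast
qed

lemma genus_bound: "A \<in> divisors emb \<Longrightarrow> dg A + 1 - int (genus emb) \<le> int (ell A)"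
  and genus_attained: "\<exists>A\<in>divisors emb. dg A + 1 - int (genus emb) = int (ell A)"
proof -
  let ?f = "\<lambda>A. dg A - int (RR_dim emb A) + 1"
  let ?X = "?f ` divisors emb"
  obtain \<gamma> where g: "\<And>A. A \<in> divisors emb \<Longrightarrow> dg A - int (ell A) \<le> \<gamma>" using riemann_bound by blast
  have 0: "0 \<in> ?X" using RR_0(2) RR_dim_eq[OF divisors_0] by (intro image_eqI[of _ _ 0]) (auto simp: divisors_0)
  \<comment> \<open>Discarding negative values leaves a finite set, since the values are bounded
    above. It contains the value 0 of the zero divisor, so the supremum is its maximum and
    \<open>nat\<close> in \<open>genus\<close> loses nothing.\<close>
  have "finite (?X \<inter> {0..})"
    by (rule finite_subset[of _ "{0..\<gamma> + 1}"]) (use g RR_dim_eq in force, simp)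
  moreover have ne: "?X \<inter> {0..} \<noteq> {}" using 0 by blast
  ultimately have mem: "Max (?X \<inter> {0..}) \<in> ?X \<inter> {0..}"
    and ge: "\<And>b. b \<in> ?X \<inter> {0..} \<Longrightarrow> b \<le> Max (?X \<inter> {0..})"
    by (rule Max_in, intro Max_ge)
  define m where "m = Max (?X \<inter> {0..})"
  have m: "m \<in> ?X" "0 \<le> m" "\<And>b. b \<in> ?X \<Longrightarrow> 0 \<le> b \<Longrightarrow> b \<le> m"
    using mem ge by (auto simp: m_def)
  have max: "b \<le> m" if "b \<in> ?X" for b using m(3)[OF that] m(2) by linarith
  have "Sup ?X = m" using m(1) max by (rule cSup_eq_maximum)
  then have gm: "int (genus emb) = m" using m(2) by (simp add: genus_def)
  show "dg A + 1 - int (genus emb) \<le> int (ell A)" if "A \<in> divisors emb"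
    using max[of "?f A"] that RR_dim_eq[OF that] gm by force
  obtain A where "A \<in> divisors emb" "m = ?f A" using m(1) by blast
  then show "\<exists>A\<in>divisors emb. dg A + 1 - int (genus emb) = int (ell A)"
    using RR_dim_eq gm by (intro bexI[of _ A]) auto
qed

text \<open>Let \<open>A\<close> attain the supremum. If \<open>deg D\<close> is at least
  \<open>deg A + g\<close>, then \<open>L(D - A)\<close> is nonzero by \<open>genus_bound\<close>,
  so \<open>deg - l\<close> is at least as large for \<open>D\<close> as for \<open>A\<close>, and
  \<open>D\<close> attains the supremum too.\<close>

lemma riemann: "\<exists>c. \<forall>D\<in>divisors emb. c \<le> dg D \<longrightarrow> int (ell D) = dg D + 1 - int (genus emb)"
proof -
  obtain A where A: "A \<in> divisors emb" "dg A + 1 - int (genus emb) = int (ell A)"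
    using genus_attained by blast
  have "int (ell D) = dg D + 1 - int (genus emb)"
    if D: "D \<in> divisors emb" "dg A + int (genus emb) \<le> dg D" for D
  proof -
    have "0 < ell (D - A)"
      using genus_bound[OF divisors_diff[OF D(1) A(1)]] D(2) by (simp add: degree_diff)
    from ell_pos_dominates[OF A(1) D(1) this] genus_bound[OF D(1)] A(2) show ?thesis by linarith
  qed
  then show ?thesis by blast
qed

end

subsection \<open>Riemann-Roch in large degree\<close>

text \<open>The functional is the coordinate at \<open>t\<close> with respect to \<open>T\<close>;
  coordinates modulo \<open>W\<close> are unique, hence linear.\<close>

lemma (in scalar_space) exists_functional:
  assumes W: "subspace W" and T: "basis_mod W UNIV T" and t: "t \<in> T"
  shows "\<exists>\<omega>. (\<forall>x y. \<omega> (x + y) = \<omega> x + \<omega> y) \<and> (\<forall>c x. \<omega> (c *s x) = c * \<omega> x) \<and>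
    (\<forall>w\<in>W. \<omega> w = 0) \<and> \<omega> t = 1"
proof -
  have "\<forall>z. \<exists>c. z - (\<Sum>s\<in>T. c s *s s) \<in> W" using basis_modD(4)[OF T] by blast
  then obtain c where c: "\<And>z. z - (\<Sum>s\<in>T. c z s *s s) \<in> W" by metis
  have uniq: "c z t = d t" if d: "z - (\<Sum>s\<in>T. d s *s s) \<in> W" for z d
  proof -
    have "(z - (\<Sum>s\<in>T. d s *s s)) - (z - (\<Sum>s\<in>T. c z s *s s)) \<in> W"
      by (rule subspace_diff[OF W d c])
    then have "(\<Sum>s\<in>T. (c z s - d s) *s s) \<in> W"
      by (simp add: scale_left_diff_distrib sum_subtractf)
    from basis_modD(3)[OF T this] show ?thesis using t by simp
  qed
  show ?thesis
  proof (intro exI[of _ "\<lambda>z. c z t"] conjI allI ballI)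
    fix x y
    have "(x - (\<Sum>s\<in>T. c x s *s s)) + (y - (\<Sum>s\<in>T. c y s *s s)) \<in> W"
      by (rule subspace_add[OF W c c])
    then show "c (x + y) t = c x t + c y t"
      by (intro uniq) (simp add: scale_left_distrib sum.distrib algebra_simps)
  next
    fix a x
    have "a *s (x - (\<Sum>s\<in>T. c x s *s s)) \<in> W" by (rule subspace_scale[OF W c])
    then show "c (a *s x) t = a * c x t"
      by (intro uniq) (simp add: scale_right_diff_distrib scale_sum_right)
  next
    fix w assume "w \<in> W"
    then show "c w t = 0" using uniq[of w "\<lambda>_. 0"] by simp
  next
    have "(\<Sum>s\<in>T. (if s = t then 1 else 0) *s s) = t"
      using basis_modD(1)[OF T] t by (simp add: if_distrib[of "\<lambda>c. c *s _"] cong: if_cong)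
    then show "c t t = 1" using uniq[of t "\<lambda>s. if s = t then 1 else 0"] subspace_0[OF W] by simp
  qed
qed

context function_field
begin

context
  fixes P :: "'f \<Rightarrow> int"
  assumes rational: "P \<in> rational_points emb"
begin

lemma rational_place: "P \<in> places emb" and rational_degree: "place_degree emb P = 1"
  using rational by (auto simp: rational_points_def)

abbreviation nP :: "int \<Rightarrow> 'f divisor" where
  "nP \<equiv> Poly_Mapping.single P"

text \<open>The basis element \<open>s\<close> of the one-dimensional residue field need not be 1.
  The coordinate \<open>a\<close> of 1 is nonzero, so dividing by it expresses every residue by a
  constant.\<close>

lemma rational_residue: assumes z: "z \<in> vge P 0" shows "\<exists>c. z - emb c \<in> vge P 1"
proof -
  note sub = subspace_vge[OF rational_place]
  obtain S where S: "K.basis_mod (vge P 1) (vge P 0) S" "card S = 1"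
    using K.fin_modE[OF sub residue_finite(1)[OF rational_place]] residue_finite(2)[OF rational_place] rational_degree by metis
  obtain s where s: "S = {s}" using S(2) by (auto simp: card_1_singleton_iff)
  have ex: "\<exists>a. w - emb a * s \<in> vge P 1" if "w \<in> vge P 0" for w
    using K.basis_modD(4)[OF S(1) that] by (auto simp: s)
  have 1: "1 \<in> vge P 0" "1 \<notin> vge P 1" using rational_place by (auto simp: vge_def)
  obtain a where a: "1 - emb a * s \<in> vge P 1" using ex[OF 1(1)] by blast
  obtain b where b: "z - emb b * s \<in> vge P 1" using ex[OF z] by blast
  have a0: "a \<noteq> 0" using a 1 by auto
  have "(z - emb b * s) - emb (b / a) * (1 - emb a * s) \<in> vge P 1"
    by (rule K.subspace_diff[OF sub b K.subspace_scale[OF sub a]])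
  moreover have "emb (b / a) * (1 - emb a * s) = emb (b / a) - emb b * s"
    using a0 by (simp add: right_diff_distrib mult.assoc[symmetric] emb_mult[symmetric])
  ultimately show ?thesis by (intro exI[of _ "b / a"]) simp
qed

lemma rational_split:
  assumes u: "u \<noteq> 0" and z: "z \<in> vge P (P u)"
  shows "\<exists>c. z - emb c * u \<in> vge P (P u + 1)"
proof -
  have "z / u \<in> vge P 0" using vge_mult_iff[OF rational_place u, of "z / u" 0] u z by simp
  then obtain c where "z / u - emb c \<in> vge P 1" using rational_residue by blast
  then have "u * (z / u - emb c) \<in> vge P (P u + 1)" using vge_mult_iff[OF rational_place u] by blast
  moreover have "u * (z / u - emb c) = z - emb c * u" using u by (simp add: field_simps)
  ultimately show ?thesis by auto
qed

lemma dg_nP: "dg (nP k) = k"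
  by (simp add: degree_single rational_degree)

lemma nP_divisors: "nP k \<in> divisors emb"
  by (rule divisors_single[OF rational_place])

lemma lookup_nP: "Poly_Mapping.lookup (D + nP k) R = Poly_Mapping.lookup D R + (if R = P then k else 0)"
  by (simp add: lookup_add lookup_single when_def)

lemma nP_Suc: "D + nP (int (Suc k)) = (D + nP (int k)) + nP 1"
  by (simp add: single_add[symmetric] add.assoc add.commute)

lemma ell_step:
  assumes D: "D \<in> divisors emb"
  shows "ell (D + nP 1) = ell D + (if RR_space emb (D + nP 1) \<noteq> RR_space emb D then 1 else 0)"
proof (cases "RR_space emb (D + nP 1) = RR_space emb D")
  case False
  have sub: "RR_space emb D \<subseteq> RR_space emb (D + nP 1)"
    by (rule RR_space_mono) (simp add: lookup_nP)
  note step = RR_step[OF rational_place, of D]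
  have "K.rdim (RR_space emb D) (RR_space emb (D + nP 1)) \<noteq> 0"
  proof
    assume 0: "K.rdim (RR_space emb D) (RR_space emb (D + nP 1)) = 0"
    obtain S where S: "K.basis_mod (RR_space emb D) (RR_space emb (D + nP 1)) S" "card S = 0"
      using K.fin_modE[OF subspace_RR step(1)] 0 by metis
    then have "S = {}" using K.basis_modD(1)[OF S(1)] by simp
    then have "RR_space emb (D + nP 1) \<subseteq> RR_space emb D" using K.basis_modD(4)[OF S(1)] by auto
    then show False using sub False by blast
  qed
  then have "K.rdim (RR_space emb D) (RR_space emb (D + nP 1)) = 1"
    using step(2) rational_degree by simp
  moreover note K.rdim_trans(2)[OF subspace_zero subspace_RR RR_space_0_mem sub RR_fin[OF D] step(1)]
  ultimately show ?thesis using False by simp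
qed simp

section \<open>The quotient by \<open>polar D\<close> and weak duality\<close>

definition away :: "'f divisor \<Rightarrow> 'f set" where
  "away D = {f. \<forall>R\<in>places emb - {P}. f \<in> vge R (- Poly_Mapping.lookup D R)}"

text \<open>The quotient of the function field by \<open>polar D\<close> plays the role of the first cohomology group of
  \<open>D\<close>: it is computed by the two-piece cover consisting of a neighbourhood of \<open>P\<close> and the
  complement of \<open>P\<close>.\<close>

definition polar :: "'f divisor \<Rightarrow> 'f set" where
  "polar D = {a + b | a b. a \<in> vge P (- Poly_Mapping.lookup D P) \<and> b \<in> away D}"

lemma subspace_away: "K.subspace (away D)"
  unfolding away_def using subspace_vge unfolding K.subspace_def by blast

lemma subspace_polar: "K.subspace (polar D)"
  unfolding polar_def by (rule K.subspace_sums[OF subspace_vge[OF rational_place] subspace_away])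

lemma RR_space_away: "RR_space emb D = vge P (- Poly_Mapping.lookup D P) \<inter> away D"
  using rational_place by (auto simp: RR_space_eq away_def)

lemma away_nP: "away (D + nP k) = away D"
  by (auto simp: away_def lookup_nP)

lemma away_polar: "away D \<subseteq> polar D"
proof
  fix b assume "b \<in> away D"
  moreover have "0 \<in> vge P (- Poly_Mapping.lookup D P)" by (simp add: vge_def)
  ultimately show "b \<in> polar D" unfolding polar_def by force
qed

lemma vge_polar: "vge P (- Poly_Mapping.lookup D P) \<subseteq> polar D"
proof
  fix a assume "a \<in> vge P (- Poly_Mapping.lookup D P)"
  moreover have "0 \<in> away D" using subspace_away K.subspace_0 by blast
  ultimately show "a \<in> polar D" unfolding polar_def by force
qed

text \<open>Through this product a functional vanishing on \<open>polar D\<close> is pulled back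
  along multiplication by \<open>f\<close> to one vanishing on \<open>polar 0\<close>.\<close>

lemma polar_mult:
  assumes f: "f \<in> RR_space emb D" and z: "z \<in> polar 0"
  shows "f * z \<in> polar D"
proof -
  obtain a b where ab: "z = a + b" "a \<in> vge P 0" "b \<in> away 0" using z by (auto simp: polar_def)
  have *: "f * w \<in> vge R (- Poly_Mapping.lookup D R)" if "R \<in> places emb" "w \<in> vge R 0" for R w
    using vge_mult[of R f "- Poly_Mapping.lookup D R" w 0] that f by (simp add: RR_space_eq)
  have "f * a \<in> vge P (- Poly_Mapping.lookup D P)" using * rational_place ab by blast
  moreover have "f * b \<in> away D" using * ab by (auto simp: away_def)
  ultimately show ?thesis unfolding polar_def ab(1) distrib_left by blast
qed

text \<open>Because the residue field at \<open>P\<close> is \<open>K\<close>, a multiple of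
  \<open>u\<close> removes the leading term of the summand \<open>a\<close>. So one vector accounts
  for the whole step.\<close>

lemma polar_step_le:
  assumes u: "u \<noteq> 0" "P u = - Poly_Mapping.lookup D P - 1" and z: "z \<in> polar (D + nP 1)"
  shows "\<exists>c. z - emb c * u \<in> polar D"
proof -
  obtain a b where ab: "z = a + b" "a \<in> vge P (P u)" "b \<in> away D"
    using z u by (auto simp: polar_def lookup_nP away_nP)
  obtain c where "a - emb c * u \<in> vge P (P u + 1)" using rational_split[OF u(1) ab(2)] by blast
  then have "a - emb c * u \<in> vge P (- Poly_Mapping.lookup D P)" using u by simp
  then have "(a - emb c * u) + b \<in> polar D" unfolding polar_def using ab by blast
  then show ?thesis by (intro exI[of _ c]) (simp add: ab algebra_simps)
qed

text \<open>A new function in \<open>L(D + P)\<close> has the exact new pole order at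
  \<open>P\<close> but satisfies all conditions away from \<open>P\<close>. It therefore lies in
  \<open>polar D\<close> and can serve as the spanning vector \<open>u\<close>.\<close>

lemma polar_step_eq:
  assumes "RR_space emb (D + nP 1) \<noteq> RR_space emb D"
  shows "polar (D + nP 1) \<subseteq> polar D"
proof
  fix z assume z: "z \<in> polar (D + nP 1)"
  have "RR_space emb D \<subseteq> RR_space emb (D + nP 1)" by (rule RR_space_mono) (simp add: lookup_nP)
  then obtain u where u: "u \<in> RR_space emb (D + nP 1)" "u \<notin> RR_space emb D" using assms by blast
  then have aw: "u \<in> away D" and "u \<in> vge P (- Poly_Mapping.lookup D P - 1)"
    "u \<notin> vge P (- Poly_Mapping.lookup D P)"
    by (auto simp: RR_space_away away_nP lookup_nP)
  then have u': "u \<noteq> 0" "P u = - Poly_Mapping.lookup D P - 1" by (auto simp: vge_def)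
  obtain c where c: "z - emb c * u \<in> polar D" using polar_step_le[OF u' z] by blast
  have "emb c * u \<in> polar D"
    using aw away_polar by (intro K.subspace_scale[OF subspace_polar]) blast
  from K.subspace_add[OF subspace_polar c this] show "z \<in> polar D" by simp
qed

text \<open>If a function \<open>u\<close> of the exact new pole order were \<open>a + b\<close> as
  in \<open>polar D\<close>, then \<open>b\<close> would have that same order and be a new element
  of \<open>L(D + P)\<close>.\<close>

lemma polar_step_neq:
  assumes "RR_space emb (D + nP 1) = RR_space emb D"
  shows "polar D \<noteq> UNIV"
proof
  assume U: "polar D = UNIV"
  obtain u where u: "u \<noteq> 0" "P u = - Poly_Mapping.lookup D P - 1" using place_element[OF rational_place] by blast
  have "u \<in> polar D" using U by simp
  then obtain a b where ab: "u = a + b" "a \<in> vge P (- Poly_Mapping.lookup D P)" "b \<in> away D"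
    by (auto simp: polar_def)
  have a': "a \<in> vge P (P u + 1)" using ab u by simp
  have "u - a \<in> vge P (P u)"
    by (rule K.subspace_diff[OF subspace_vge[OF rational_place]])
       (use a' vge_mono[of "P u" "P u + 1" P] in \<open>auto simp: vge_def\<close>)
  then have "b \<in> vge P (- Poly_Mapping.lookup (D + nP 1) P)" using ab u by (simp add: lookup_nP)
  then have "b \<in> RR_space emb (D + nP 1)" using ab by (simp add: RR_space_away away_nP)
  then have "b \<in> RR_space emb D" using assms by blast
  then have "b \<in> vge P (P u + 1)" using u by (simp add: RR_space_away)
  with a' have "a + b \<in> vge P (P u + 1)" by (rule vge_add[OF rational_place])
  then show False using u ab(1) by (simp add: vge_def)
qed

text \<open>In each step either \<open>l\<close> grows by one and no vector is added, or
  \<open>l\<close> stays and one more vector suffices. Hence \<open>card S + l\<close> rises by at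
  most one per step.\<close>

lemma polar_chain:
  assumes D: "D \<in> divisors emb"
  shows "\<exists>S. finite S \<and> card S + ell (D + nP (int k)) \<le> ell D + k \<and>
    (\<forall>z\<in>polar (D + nP (int k)). \<exists>c. z - (\<Sum>s\<in>S. emb (c s) * s) \<in> polar D)"
proof (induction k)
  case 0
  then show ?case by (intro exI[of _ "{}"]) simp
next
  case (Suc k)
  let ?E = "D + nP (int k)"
  obtain S where S: "finite S" "card S + ell ?E \<le> ell D + k"
    "\<forall>z\<in>polar ?E. \<exists>c. z - (\<Sum>s\<in>S. emb (c s) * s) \<in> polar D" using Suc by blast
  have E: "?E \<in> divisors emb" by (intro divisors_add D nP_divisors)
  show ?case
  proof (cases "RR_space emb (?E + nP 1) = RR_space emb ?E")
    case False
    then have "ell (?E + nP 1) = ell ?E + 1" using ell_step[OF E] by simp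
    then show ?thesis unfolding nP_Suc using S polar_step_eq[OF False] by (intro exI[of _ S]) auto
  next
    case True
    obtain u where u: "u \<noteq> 0" "P u = - Poly_Mapping.lookup ?E P - 1" using place_element[OF rational_place] by blast
    have "card (insert u S) \<le> Suc (card S)" using S by (simp add: card_insert_if)
    then have "card (insert u S) + ell (?E + nP 1) \<le> ell D + Suc k" using True S by simp
    moreover have "\<exists>c. z - (\<Sum>s\<in>insert u S. emb (c s) * s) \<in> polar D" if z: "z \<in> polar (?E + nP 1)" for z
    proof -
      obtain a where "z - emb a * u \<in> polar ?E" using polar_step_le[OF u z] by blast
      then obtain c where c: "z - emb a * u - (\<Sum>s\<in>S. emb (c s) * s) \<in> polar D" using S(3) by blast
      \<comment> \<open>The two coefficients are added because \<open>u\<close> may already belong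
        to \<open>S\<close>.\<close>
      define d where "d = (\<lambda>s. (if s = u then a else 0) + (if s \<in> S then c s else 0))"
      have "(\<Sum>s\<in>insert u S. emb (d s) * s)
          = (\<Sum>s\<in>insert u S. (if s = u then emb a * s else 0)) + (\<Sum>s\<in>insert u S. (if s \<in> S then emb (c s) * s else 0))"
        unfolding sum.distrib[symmetric] by (rule sum.cong) (auto simp: d_def emb_add distrib_right)
      also have "(\<Sum>s\<in>insert u S. (if s = u then emb a * s else 0)) = emb a * u" using S by simp
      also have "(\<Sum>s\<in>insert u S. (if s \<in> S then emb (c s) * s else 0)) = (\<Sum>s\<in>S. emb (c s) * s)"
        by (rule sum.mono_neutral_cong_right) (use S in auto)
      finally have "z - (\<Sum>s\<in>insert u S. emb (d s) * s) = z - emb a * u - (\<Sum>s\<in>S. emb (c s) * s)" by simp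
      then show ?thesis using c by metis
    qed
    ultimately show ?thesis unfolding nP_Suc using S(1) by (intro exI[of _ "insert u S"]) simp
  qed
qed

text \<open>Beyond Riemann's bound every step enlarges \<open>L\<close>, so \<open>polar\<close>
  stops growing; yet any given function lies in \<open>polar (D + kP)\<close> once \<open>k\<close>
  admits its pole at \<open>P\<close>.\<close>

lemma polar_UNIV_large:
  "\<exists>c. \<forall>D\<in>divisors emb. c \<le> dg D \<longrightarrow> int (ell D) = dg D + 1 - int (genus emb) \<and> polar D = UNIV"
proof -
  obtain c where c: "\<And>D. D \<in> divisors emb \<Longrightarrow> c \<le> dg D \<Longrightarrow> int (ell D) = dg D + 1 - int (genus emb)"
    using riemann by blast
  have "polar D = UNIV" if D: "D \<in> divisors emb" "c \<le> dg D" for D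
  proof -
    have sub: "polar (D + nP (int k)) \<subseteq> polar D" for k
    proof (induction k)
      case (Suc k)
      let ?E = "D + nP (int k)"
      have E: "?E \<in> divisors emb" "?E + nP 1 \<in> divisors emb" by (intro divisors_add D nP_divisors)+
      have "c \<le> dg ?E" "c \<le> dg (?E + nP 1)" using D by (simp_all add: degree_add dg_nP)
      from c[OF E(1) this(1)] c[OF E(2) this(2)] have "ell (?E + nP 1) \<noteq> ell ?E"
        by (simp add: degree_add dg_nP)
      then have "RR_space emb (?E + nP 1) \<noteq> RR_space emb ?E" by auto
      then show ?case unfolding nP_Suc using polar_step_eq Suc by blast
    qed simp
    have "z \<in> polar D" for z
    proof -
      define k where "k = nat (- P z - Poly_Mapping.lookup D P)"
      have "z \<in> vge P (- Poly_Mapping.lookup (D + nP (int k)) P)"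
        by (simp add: vge_def lookup_nP k_def)
      then show ?thesis using sub vge_polar by blast
    qed
    then show ?thesis by blast
  qed
  then show ?thesis using c by blast
qed

text \<open>The steps are counted from \<open>D\<close> up to a divisor of degree at least
  \<open>c\<close>, where \<open>polar\<close> is everything and \<open>l\<close> is known.\<close>

lemma polar_fin:
  assumes D: "D \<in> divisors emb"
  shows "K.fin_mod (polar D) UNIV"
    "int (K.rdim (polar D) UNIV) \<le> int (ell D) - dg D - 1 + int (genus emb)"
proof -
  obtain c where c: "\<And>D. D \<in> divisors emb \<Longrightarrow> c \<le> dg D \<Longrightarrow>
      int (ell D) = dg D + 1 - int (genus emb) \<and> polar D = UNIV" using polar_UNIV_large by blast
  define k where "k = nat (c - dg D)"
  let ?E = "D + nP (int k)"
  have E: "?E \<in> divisors emb" by (intro divisors_add D nP_divisors)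
  have dE: "dg ?E = dg D + int k" by (simp add: degree_add dg_nP)
  then have "c \<le> dg ?E" by (simp add: k_def)
  note cE = c[OF E this]
  obtain S where S: "finite S" "card S + ell ?E \<le> ell D + k"
    "\<forall>z\<in>polar ?E. \<exists>c. z - (\<Sum>s\<in>S. emb (c s) * s) \<in> polar D" using polar_chain[OF D] by blast
  have b: "card T \<le> card S" if "finite T" "T \<subseteq> UNIV"
    "\<And>c. (\<Sum>s\<in>T. emb (c s) * s) \<in> polar D \<Longrightarrow> \<forall>s\<in>T. c s = 0" for T
    by (rule K.card_le_mod[OF that(1) S(1) subspace_polar, where v = "\<lambda>x. x" and w = "\<lambda>x. x"])
       (use that S(3) cE in auto)
  show "K.fin_mod (polar D) UNIV" by (rule K.fin_mod_exists(1)[OF subspace_polar b])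
  have "K.rdim (polar D) UNIV \<le> card S" by (rule K.fin_mod_exists(2)[OF subspace_polar b])
  then show "int (K.rdim (polar D) UNIV) \<le> int (ell D) - dg D - 1 + int (genus emb)"
    using S(2) cE dE by linarith
qed

text \<open>Once \<open>polar\<close> is everything, each further point enlarges \<open>L\<close> by
  \<open>polar_step_neq\<close>; the formula valid in large degree can therefore be followed back
  down to \<open>D\<close>.\<close>

lemma polar_UNIV_ell:
  assumes D: "D \<in> divisors emb" and U: "polar D = UNIV"
  shows "int (ell D) = dg D + 1 - int (genus emb)"
proof -
  have mono: "polar D \<subseteq> polar (D + nP (int k))" for k
  proof -
    have "vge P (- Poly_Mapping.lookup D P) \<subseteq> vge P (- Poly_Mapping.lookup (D + nP (int k)) P)"
      by (rule vge_mono) (simp add: lookup_nP)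
    then show ?thesis unfolding polar_def away_nP by blast
  qed
  have grow: "ell (D + nP (int k)) = ell D + k" for k
  proof (induction k)
    case (Suc k)
    have "polar (D + nP (int k)) = UNIV" using mono U by blast
    then have "RR_space emb (D + nP (int k) + nP 1) \<noteq> RR_space emb (D + nP (int k))"
      using polar_step_neq by blast
    moreover have "D + nP (int k) \<in> divisors emb" by (intro divisors_add D nP_divisors)
    ultimately show ?case unfolding nP_Suc using ell_step Suc by simp
  qed simp
  obtain c where c: "\<And>D. D \<in> divisors emb \<Longrightarrow> c \<le> dg D \<Longrightarrow> int (ell D) = dg D + 1 - int (genus emb)"
    using riemann by blast
  define k where "k = nat (c - dg D)"
  have "int (ell (D + nP (int k))) = dg (D + nP (int k)) + 1 - int (genus emb)"
    by (rule c) (auto simp: k_def degree_add dg_nP intro: divisors_add D nP_divisors)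
  then show ?thesis using grow[of k] by (simp add: degree_add dg_nP)
qed

lemma ell_le_genus:
  assumes D: "D \<in> divisors emb" and nU: "polar D \<noteq> UNIV"
  shows "ell D \<le> genus emb"
proof -
  obtain T where T: "K.basis_mod (polar D) UNIV T" using polar_fin(1)[OF D] by (auto simp: K.fin_mod_def)
  have "T \<noteq> {}"
  proof
    assume "T = {}"
    then have "z \<in> polar D" for z using K.basis_modD(4)[OF T, of z] by simp
    then show False using nU by blast
  qed
  then obtain t where t: "t \<in> T" by blast
  obtain \<omega> where \<omega>: "\<And>x y. \<omega> (x + y) = \<omega> x + \<omega> y" "\<And>c x. \<omega> (emb c * x) = c * \<omega> x"
    "\<And>w. w \<in> polar D \<Longrightarrow> \<omega> w = 0" "\<omega> t = 1"
    using K.exists_functional[OF subspace_polar T t] by blast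
  have \<omega>0: "\<omega> 0 = 0" using \<omega>(2)[of 0 0] by simp
  have \<omega>sum: "\<omega> (\<Sum>i\<in>I. f i) = (\<Sum>i\<in>I. \<omega> (f i))" for I :: "'f set" and f
    by (induction I rule: infinite_finite_induct) (auto simp: \<omega>(1) \<omega>0)
  obtain S where S: "K.basis_mod (polar 0) UNIV S" "card S = K.rdim (polar 0) UNIV"
    using K.fin_modE[OF subspace_polar polar_fin(1)[OF divisors_0]] by blast
  \<comment> \<open>For the zero divisor the bound in \<open>polar_fin\<close> reads
    \<open>1 - 0 - 1 + g\<close>.\<close>
  have cardS: "card S \<le> genus emb" using polar_fin(2)[OF divisors_0] S(2) RR_0(2) by simp
  obtain J where J: "K.basis_mod {0} (RR_space emb D) J" "card J = ell D"
    using K.fin_modE[OF subspace_zero RR_fin[OF D]] by blast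
  \<comment> \<open>Encodes the functional sending \<open>z\<close> to
    \<open>\<omega> (j * z)\<close> on the quotient by \<open>polar 0\<close> through its values on
    the basis \<open>S\<close>, so the dual space is replaced by the span of
    \<open>S\<close>.\<close>
  define v where "v = (\<lambda>j. \<Sum>s\<in>S. emb (\<omega> (j * s)) * s)"
  have "card J \<le> card S"
  proof (rule K.card_le_span[where u = v])
    show "finite J" "finite S" using J S K.basis_modD(1) by blast+
    show "v ` J \<subseteq> K.span S" unfolding v_def
      by (intro image_subsetI K.span_sum K.span_scale K.span_base)
    fix c assume 0: "(\<Sum>j\<in>J. emb (c j) * v j) = 0"
    define f where "f = (\<Sum>j\<in>J. emb (c j) * j)"
    have f: "f \<in> RR_space emb D" unfolding f_def
      using K.basis_modD(2)[OF J(1)] by (intro K.subspace_sum K.subspace_scale subspace_RR) blast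
    have wf: "\<omega> (f * s) = (\<Sum>j\<in>J. c j * \<omega> (j * s))" for s
      by (simp add: f_def sum_distrib_right \<omega>sum mult.assoc \<omega>(2))
    have emb_sum: "emb (\<Sum>j\<in>I. h j) = (\<Sum>j\<in>I. emb (h j))" for h and I :: "'f set"
      by (induction I rule: infinite_finite_induct) (auto simp: emb_add)
    have "(\<Sum>j\<in>J. emb (c j) * v j) = (\<Sum>j\<in>J. \<Sum>s\<in>S. emb (c j * \<omega> (j * s)) * s)"
      by (simp only: v_def sum_distrib_left emb_mult mult.assoc)
    also have "\<dots> = (\<Sum>s\<in>S. \<Sum>j\<in>J. emb (c j * \<omega> (j * s)) * s)" by (rule sum.swap)
    also have "\<dots> = (\<Sum>s\<in>S. emb (\<omega> (f * s)) * s)" by (simp only: wf emb_sum sum_distrib_right)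
    finally have "(\<Sum>s\<in>S. emb (\<omega> (f * s)) * s) \<in> polar 0" using 0 K.subspace_0[OF subspace_polar, of 0] by metis
    from K.basis_modD(3)[OF S(1) this] have fS: "\<forall>s\<in>S. \<omega> (f * s) = 0" .
    have all0: "\<omega> (f * z) = 0" for z
    proof -
      obtain d where d: "z - (\<Sum>s\<in>S. emb (d s) * s) \<in> polar 0" using K.basis_modD(4)[OF S(1)] by blast
      define w where "w = z - (\<Sum>s\<in>S. emb (d s) * s)"
      have "f * z = f * w + (\<Sum>s\<in>S. emb (d s) * (f * s))"
        by (simp add: w_def right_diff_distrib sum_distrib_left mult_ac)
      then have "\<omega> (f * z) = \<omega> (f * w) + (\<Sum>s\<in>S. d s * \<omega> (f * s))" by (simp add: \<omega>(1,2) \<omega>sum)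
      also have "\<dots> = 0" using \<omega>(3)[OF polar_mult[OF f d]] fS by (simp add: w_def)
      finally show ?thesis .
    qed
    \<comment> \<open>If \<open>f\<close> were nonzero, every function, in particular
      \<open>t\<close>, would be a multiple of \<open>f\<close> and hence killed by
      \<open>\<omega>\<close>.\<close>
    have "f = 0" using all0[of "t / f"] \<omega>(4) by (cases "f = 0") auto
    then show "\<forall>j\<in>J. c j = 0" unfolding f_def by (intro K.basis_modD(3)[OF J(1)]) simp
  qed
  then show ?thesis using J cardS by simp
qed

lemma riemann_roch_large:
  assumes D: "D \<in> divisors emb" and deg: "2 * int (genus emb) - 1 \<le> dg D"
  shows "int (ell D) = dg D + 1 - int (genus emb)"
proof (cases "polar D = UNIV")
  case True
  then show ?thesis by (rule polar_UNIV_ell[OF D])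
next
  case False
  obtain S where S: "K.basis_mod (polar D) UNIV S" "card S = K.rdim (polar D) UNIV"
    using K.fin_modE[OF subspace_polar polar_fin(1)[OF D]] by blast
  have "K.rdim (polar D) UNIV \<noteq> 0"
  proof
    assume "K.rdim (polar D) UNIV = 0"
    then have "S = {}" using S K.basis_modD(1)[OF S(1)] by simp
    then have "z \<in> polar D" for z using K.basis_modD(4)[OF S(1), of z] by simp
    then show False using False by blast
  qed
  then show ?thesis using ell_le_genus[OF D False] polar_fin(2)[OF D] deg by linarith
qed

end

end

subsection \<open>Divisor classes\<close>

context function_field
begin

lemma linearly_equivalent_refl: "linearly_equivalent emb D D"
  unfolding linearly_equivalent_def by (intro exI[of _ 1]) simp

lemma linearly_equivalent_sym:
  assumes "linearly_equivalent emb D E" shows "linearly_equivalent emb E D"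
proof -
  obtain f where "f \<noteq> 0" "\<forall>R\<in>places emb. Poly_Mapping.lookup (D - E) R = R f"
    using assms by (auto simp: linearly_equivalent_def)
  then show ?thesis unfolding linearly_equivalent_def
    by (intro exI[of _ "inverse f"]) (auto simp: place_inverse lookup_minus)
qed

lemma linearly_equivalent_add:
  assumes "linearly_equivalent emb D E" "linearly_equivalent emb D' E'"
  shows "linearly_equivalent emb (D + D') (E + E')"
proof -
  obtain f where f: "f \<noteq> 0" "\<And>R. R \<in> places emb \<Longrightarrow> Poly_Mapping.lookup (D - E) R = R f"
    using assms by (auto simp: linearly_equivalent_def)
  obtain f' where f': "f' \<noteq> 0" "\<And>R. R \<in> places emb \<Longrightarrow> Poly_Mapping.lookup (D' - E') R = R f'"
    using assms by (auto simp: linearly_equivalent_def)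
  have "Poly_Mapping.lookup (D + D' - (E + E')) R = R (f * f')" if R: "R \<in> places emb" for R
    using f(2)[OF R] f'(2)[OF R] place_mult[OF R f(1) f'(1)] by (simp add: lookup_minus lookup_add)
  then show ?thesis unfolding linearly_equivalent_def using f f' by (intro exI[of _ "f * f'"]) simp
qed

lemma linearly_equivalent_uminus:
  assumes "linearly_equivalent emb D E" shows "linearly_equivalent emb (- D) (- E)"
proof -
  have "linearly_equivalent emb E D" using assms by (rule linearly_equivalent_sym)
  moreover have "- D - - E = E - D" by simp
  ultimately show ?thesis unfolding linearly_equivalent_def by metis
qed

lemma class_plus_divisor_class:
  assumes D: "D \<in> divisors emb" and E: "E \<in> divisors emb"
  shows "divisor_class emb D +\<^sub>c divisor_class emb E = divisor_class emb (D + E)"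
proof (intro equalityI subsetI)
  fix X assume "X \<in> divisor_class emb D +\<^sub>c divisor_class emb E"
  then show "X \<in> divisor_class emb (D + E)"
    using linearly_equivalent_add divisors_add by (auto simp: class_plus_def divisor_class_def)
next
  fix X assume "X \<in> divisor_class emb (D + E)"
  then have X: "X \<in> divisors emb" "linearly_equivalent emb X (D + E)" by (auto simp: divisor_class_def)
  have "linearly_equivalent emb (X - E) D"
    using X(2) by (simp add: linearly_equivalent_def diff_diff_eq add.commute)
  then have "X - E \<in> divisor_class emb D" using X(1) E by (simp add: divisor_class_def divisors_diff)
  moreover have "E \<in> divisor_class emb E" using E by (simp add: divisor_class_def linearly_equivalent_refl)
  ultimately show "X \<in> divisor_class emb D +\<^sub>c divisor_class emb E"
    unfolding class_plus_def by (intro CollectI exI[of _ "X - E"] exI[of _ E]) simp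
qed

lemma class_uminus_divisor_class:
  assumes D: "D \<in> divisors emb"
  shows "class_uminus (divisor_class emb D) = divisor_class emb (- D)"
proof (intro equalityI subsetI)
  fix X assume "X \<in> class_uminus (divisor_class emb D)"
  then show "X \<in> divisor_class emb (- D)"
    using linearly_equivalent_uminus divisors_uminus by (auto simp: class_uminus_def divisor_class_def)
next
  fix X assume "X \<in> divisor_class emb (- D)"
  then have X: "X \<in> divisors emb" "linearly_equivalent emb X (- D)" by (auto simp: divisor_class_def)
  then have "- X \<in> divisor_class emb D"
    using linearly_equivalent_uminus[OF X(2)] by (simp add: divisor_class_def divisors_uminus)
  then have "- (- X) \<in> class_uminus (divisor_class emb D)" unfolding class_uminus_def by (rule imageI)
  then show "X \<in> class_uminus (divisor_class emb D)" by simp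
qed

lemma class_minus_divisor_class:
  assumes D: "D \<in> divisors emb" and E: "E \<in> divisors emb"
  shows "divisor_class emb D -\<^sub>c divisor_class emb E = divisor_class emb (D - E)"
proof -
  have "A -\<^sub>c B = A +\<^sub>c class_uminus B" for A B :: "'f divisor set"
    unfolding class_minus_def class_plus_def class_uminus_def by force
  then show ?thesis
    using class_plus_divisor_class[OF D divisors_uminus[OF E]] by (simp add: class_uminus_divisor_class[OF E])
qed

text \<open>Multiplication by \<open>z\<close> carries the spaces of \<open>D\<close> and
  \<open>D - P\<close> to those of \<open>E\<close> and \<open>E - P\<close> simultaneously. This
  makes membership in \<open>Gamma\<close> testable on any representative.\<close>

lemma RR_space_eq_linearly_equivalent:
  assumes D: "D \<in> divisors emb" and E: "E \<in> divisors emb" and P: "P \<in> places emb"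
    and le: "linearly_equivalent emb D E"
    and eq: "RR_space emb D = RR_space emb (D - Poly_Mapping.single P 1)"
  shows "RR_space emb E = RR_space emb (E - Poly_Mapping.single P 1)"
proof -
  let ?P = "Poly_Mapping.single P (1::int)"
  obtain z where z: "z \<noteq> 0" "\<forall>R\<in>places emb. Poly_Mapping.lookup (D - E) R = R z"
    using le by (auto simp: linearly_equivalent_def)
  have DP: "D - ?P \<in> divisors emb" "E - ?P \<in> divisors emb"
    using D E divisors_single[OF P] by (auto intro: divisors_diff)
  have 1: "f \<in> RR_space emb D \<longleftrightarrow> z * f \<in> RR_space emb E" for f
    by (rule ell_principal(2)[OF D E z(1)]) (use z(2) in \<open>force simp: lookup_minus\<close>)
  have 2: "f \<in> RR_space emb (D - ?P) \<longleftrightarrow> z * f \<in> RR_space emb (E - ?P)" for f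
    by (rule ell_principal(2)[OF DP z(1)]) (use z(2) in \<open>force simp: lookup_minus\<close>)
  have "f \<in> RR_space emb E \<longleftrightarrow> f \<in> RR_space emb (E - ?P)" for f
    using 1[of "f / z"] 2[of "f / z"] z(1) eq by simp
  then show ?thesis by blast
qed

section \<open>Membership in \<open>Gamma\<close> by degree, and counting\<close>

lemma Gamma_iff:
  assumes D: "D \<in> divisors emb" and P: "P \<in> places emb"
  shows "divisor_class emb D \<in> Gamma emb P \<longleftrightarrow>
    RR_space emb D \<noteq> RR_space emb (D - Poly_Mapping.single P 1)"
proof
  assume "divisor_class emb D \<in> Gamma emb P"
  then obtain E where E: "E \<in> divisors emb" "divisor_class emb D = divisor_class emb E"
    "RR_space emb E \<noteq> RR_space emb (E - Poly_Mapping.single P 1)" by (auto simp: Gamma_def)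
  have "D \<in> divisor_class emb E"
    using D E(2)[symmetric] by (simp add: divisor_class_def linearly_equivalent_refl)
  then have "linearly_equivalent emb D E" by (simp add: divisor_class_def)
  then show "RR_space emb D \<noteq> RR_space emb (D - Poly_Mapping.single P 1)"
    using RR_space_eq_linearly_equivalent[OF D E(1) P] E(3) by blast
qed (use D in \<open>auto simp: Gamma_def\<close>)

text \<open>Both \<open>D\<close> and \<open>D - P\<close> have degree at least
  \<open>2g - 1\<close>, so the exact formula gives dimensions that differ by one.\<close>

lemma Gamma_degree_ge:
  assumes D: "D \<in> divisors emb" and P: "P \<in> rational_points emb" and deg: "2 * int (genus emb) \<le> dg D"
  shows "divisor_class emb D \<in> Gamma emb P"
proof -
  let ?E = "D - Poly_Mapping.single P 1"
  have P': "P \<in> places emb" using P by (rule rational_place)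
  have E: "?E \<in> divisors emb" using D divisors_single[OF P'] by (rule divisors_diff)
  have dE: "dg ?E = dg D - 1" using rational_degree[OF P] by (simp add: degree_diff degree_single)
  have "int (ell D) = dg D + 1 - int (genus emb)" "int (ell ?E) = dg ?E + 1 - int (genus emb)"
    using deg dE by (intro riemann_roch_large[OF P] D E; simp)+
  then have "ell D \<noteq> ell ?E" using dE by auto
  then show ?thesis using Gamma_iff[OF D P'] by auto
qed

lemma Gamma_degree_neg:
  assumes D: "D \<in> divisors emb" and P: "P \<in> rational_points emb" and deg: "dg D < 0"
  shows "divisor_class emb D \<notin> Gamma emb P"
proof -
  let ?E = "D - Poly_Mapping.single P 1"
  have P': "P \<in> places emb" using P by (rule rational_place)
  have E: "?E \<in> divisors emb" using D divisors_single[OF P'] by (rule divisors_diff)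
  have "dg ?E < 0" using rational_degree[OF P] deg by (simp add: degree_diff degree_single)
  then show ?thesis using Gamma_iff[OF D P'] degree_neg_RR[OF D deg] degree_neg_RR[OF E] by simp
qed

text \<open>Membership at \<open>k\<close> compares \<open>D + kP\<close> with
  \<open>D + (k - 1)P\<close>, so the telescoping sum runs from \<open>a - 1\<close> to
  \<open>a + n - 1\<close>. The additive form avoids subtraction of natural numbers.\<close>

lemma card_Gamma_interval:
  assumes D: "D \<in> divisors emb" and P: "P \<in> rational_points emb"
  shows "card {k \<in> {a..<a + int n}. divisor_class emb (D + Poly_Mapping.single P k) \<in> Gamma emb P}
      + ell (D + Poly_Mapping.single P (a - 1)) = ell (D + Poly_Mapping.single P (a + int n - 1))"
proof (induction n)
  case 0
  then show ?case by simp
next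
  case (Suc n)
  let ?D = "\<lambda>k. D + Poly_Mapping.single P k"
  let ?G = "\<lambda>k. divisor_class emb (?D k) \<in> Gamma emb P"
  have P': "P \<in> places emb" using P by (rule rational_place)
  have Dk: "?D k \<in> divisors emb" for k using D divisors_single[OF P'] by (rule divisors_add)
  have shift: "?D (k - 1) + Poly_Mapping.single P 1 = ?D k" "?D k - Poly_Mapping.single P 1 = ?D (k - 1)" for k
    by (simp_all add: add.assoc single_add[symmetric] single_diff add_diff_eq[symmetric])
  define A where "A = {k \<in> {a..<a + int n}. ?G k}"
  have A: "finite A" "a + int n \<notin> A" unfolding A_def by (auto intro: finite_subset[of _ "{a..<a + int n}"])
  have "{k \<in> {a..<a + int (Suc n)}. ?G k} = (if ?G (a + int n) then insert (a + int n) A else A)"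
  proof -
    have "{a..<a + int (Suc n)} = insert (a + int n) {a..<a + int n}" by auto
    then show ?thesis unfolding A_def by auto
  qed
  then have c: "card {k \<in> {a..<a + int (Suc n)}. ?G k} = card A + (if ?G (a + int n) then 1 else 0)"
    using A by (simp del: of_nat_Suc)
  have "?G (a + int n) \<longleftrightarrow> RR_space emb (?D (a + int n)) \<noteq> RR_space emb (?D (a + int n - 1))"
    using Gamma_iff[OF Dk P', of "a + int n"] unfolding shift .
  then have step: "ell (?D (a + int n)) = ell (?D (a + int n - 1)) + (if ?G (a + int n) then 1 else 0)"
    using ell_step[OF P Dk, of "a + int n - 1"] unfolding shift by simp
  have last: "a + int (Suc n) - 1 = a + int n" by simp
  show ?case unfolding c last step using Suc[folded A_def] by simp
qed

text \<open>The start \<open>a\<close> is the \<open>k\<close> at which \<open>D + kP\<close> has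
  degree 0. The telescoping sum compares degree -1, where \<open>l\<close> is 0, with degree
  \<open>2g - 1\<close>, where \<open>l\<close> is \<open>(2g - 1) + 1 - g = g\<close>.\<close>

lemma card_Gamma_gaps:
  assumes D: "D \<in> divisors emb" and P: "P \<in> rational_points emb" and a: "dg D = - a"
  defines "I \<equiv> {a..a + 2 * int (genus emb) - 1}"
  shows "card {k \<in> I. divisor_class emb (D + Poly_Mapping.single P k) \<in> Gamma emb P} = genus emb"
    and "card (I - {k \<in> I. divisor_class emb (D + Poly_Mapping.single P k) \<in> Gamma emb P}) = genus emb"
proof -
  let ?N = "{k \<in> I. divisor_class emb (D + Poly_Mapping.single P k) \<in> Gamma emb P}"
  have P': "P \<in> places emb" using P by (rule rational_place)
  have Dk: "D + Poly_Mapping.single P k \<in> divisors emb" for k using D divisors_single[OF P'] by (rule divisors_add)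
  have dk: "dg (D + Poly_Mapping.single P k) = k - a" for k
    using rational_degree[OF P] a by (simp add: degree_add degree_single)
  have I: "I = {a..<a + int (2 * genus emb)}" by (auto simp: I_def)
  have "RR_space emb (D + Poly_Mapping.single P (a - 1)) = {0}"
    by (rule degree_neg_RR[OF Dk]) (simp add: dk)
  moreover have "K.basis_mod {0} {0} {}" by (simp add: K.basis_mod_def)
  ultimately have "ell (D + Poly_Mapping.single P (a - 1)) = 0"
    using K.rdim_eq[OF subspace_zero] by fastforce
  moreover have "int (ell (D + Poly_Mapping.single P (a + int (2 * genus emb) - 1))) = int (genus emb)"
    using riemann_roch_large[OF P Dk, of "a + int (2 * genus emb) - 1"] dk by simp
  ultimately show N: "card ?N = genus emb"
    using card_Gamma_interval[OF D P, of a "2 * genus emb"] unfolding I by simp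
  have "card (I - ?N) = card I - card ?N" by (rule card_Diff_subset) (auto simp: I intro: finite_subset[of _ I])
  then show "card (I - ?N) = genus emb" using N by (simp add: I)
qed

end

theorem proposition7p7:
  fixes emb :: "'k::{field,finite} \<Rightarrow> 'f::field"
    and P Q :: "'f \<Rightarrow> int"
    and B0 C0 :: "'f divisor set"
    and g :: nat
    and N1 N2 N3 G1 G2 G3 :: "int set"
  assumes "function_field emb"
    and "genus emb = g"
    and "P \<in> rational_points emb" and "Q \<in> rational_points emb"
    and "B0 \<in> divisor_classes0 emb" and "C0 \<in> divisor_classes0 emb"
    and "N1 = {k \<in> {- 2 * int g .. -1}.
           B0 -\<^sub>c C0 +\<^sub>c point_class emb (2 * int g) Q +\<^sub>c point_class emb k P \<in> Gamma emb P}"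
    and "N2 = {k \<in> {0 .. 2 * int g - 1}.
           B0 +\<^sub>c point_class emb k P \<in> Gamma emb P}"
    and "N3 = {k \<in> {2 * int g .. 4 * int g - 1}.
           B0 -\<^sub>c C0 -\<^sub>c point_class emb (2 * int g) Q +\<^sub>c point_class emb k P \<in> Gamma emb P}"
    and "G1 = {- 2 * int g .. -1} - N1"
    and "G2 = {0 .. 2 * int g - 1} - N2"
    and "G3 = {2 * int g .. 4 * int g - 1} - N3"
  shows "card N1 = g \<and> card G1 = g \<and> card N2 = g \<and> card G2 = g \<and> card N3 = g \<and> card G3 = g
    \<and> I_set emb P B0 (C0 +\<^sub>c point_class emb (2 * int g) Q) = N2 \<union> G3
    \<and> I_set emb P (B0 -\<^sub>c C0 +\<^sub>c point_class emb (2 * int g) Q)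
        (class_uminus C0 +\<^sub>c point_class emb (2 * int g) Q) = N1 \<union> G2"
proof -
  interpret function_field emb by (rule assms(1))
  note g = assms(2) and P = assms(3) and Q = assms(4)
  have P': "P \<in> places emb" and Q': "Q \<in> places emb" using rational_place P Q by auto
  let ?cl = "divisor_class emb" and ?P = "Poly_Mapping.single P :: int \<Rightarrow> 'f divisor"
  obtain B where B: "B \<in> divisors emb" "dg B = 0" "B0 = ?cl B"
    using assms(5) by (auto simp: divisor_classes0_def)
  obtain C where C: "C \<in> divisors emb" "dg C = 0" "C0 = ?cl C"
    using assms(6) by (auto simp: divisor_classes0_def)
  define X where "X = Poly_Mapping.single Q (2 * int g)"
  have X: "X \<in> divisors emb" "dg X = 2 * int g"
    using divisors_single[OF Q'] rational_degree[OF Q] by (auto simp: X_def degree_single)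
  have Pk: "?P k \<in> divisors emb" for k by (rule divisors_single[OF P'])
  \<comment> \<open>Their degrees are \<open>2g\<close> and \<open>-2g\<close>, so adding
    \<open>kP\<close> gives degree 0 at \<open>k = -2g\<close> and \<open>k = 2g\<close>, the left
    ends of the intervals for \<open>N1\<close> and \<open>N3\<close>.\<close>
  define D1 D3 where "D1 = B - C + X" and "D3 = B - C - X"
  have D: "D1 \<in> divisors emb" "D3 \<in> divisors emb" "dg D1 = 2 * int g" "dg D3 = - 2 * int g"
    using B C X by (auto simp: D1_def D3_def degree_add degree_diff intro: divisors_add divisors_diff)
  note classes = B(3) C(3) point_class_def X_def[symmetric] class_plus_divisor_class
    class_minus_divisor_class class_uminus_divisor_class divisors_add divisors_diff divisors_uminus
    B(1) C(1) X(1) Pk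
  have e1: "B0 -\<^sub>c C0 +\<^sub>c point_class emb (2 * int g) Q = ?cl D1"
    and e3: "B0 -\<^sub>c C0 -\<^sub>c point_class emb (2 * int g) Q = ?cl D3"
    and eC: "C0 +\<^sub>c point_class emb (2 * int g) Q = ?cl (C + X)"
    and eC': "class_uminus C0 +\<^sub>c point_class emb (2 * int g) Q = ?cl (- C + X)"
    by (simp_all only: classes D1_def D3_def)
  have add_kP: "?cl E +\<^sub>c point_class emb k P = ?cl (E + ?P k)" if "E \<in> divisors emb" for E k
    using class_plus_divisor_class[OF that Pk] by (simp add: point_class_def)
  define \<Gamma> where "\<Gamma> = (\<lambda>E k. ?cl (E + ?P k) \<in> Gamma emb P)"
  have dk: "dg (E + ?P k) = dg E + k" for E k using rational_degree[OF P] by (simp add: degree_add degree_single)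
  have in\<Gamma>: "\<Gamma> E k" if "E \<in> divisors emb" "2 * int g \<le> dg E + k" for E k
    unfolding \<Gamma>_def using that g by (intro Gamma_degree_ge[OF _ P] divisors_add Pk) (simp_all add: dk)
  have notin\<Gamma>: "\<not> \<Gamma> E k" if "E \<in> divisors emb" "dg E + k < 0" for E k
    unfolding \<Gamma>_def using that by (intro Gamma_degree_neg[OF _ P] divisors_add Pk) (simp_all add: dk)
  have N1: "N1 = {k \<in> {- 2 * int g .. -1}. \<Gamma> D1 k}"
    unfolding assms(7) e1 \<Gamma>_def by (simp add: add_kP D)
  have N2: "N2 = {k \<in> {0 .. 2 * int g - 1}. \<Gamma> B k}"
    unfolding assms(8) \<Gamma>_def B(3) by (simp add: add_kP B)
  have N3: "N3 = {k \<in> {2 * int g .. 4 * int g - 1}. \<Gamma> D3 k}"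
    unfolding assms(9) e3 \<Gamma>_def by (simp add: add_kP D)
  have "card N1 = g" "card G1 = g"
    using card_Gamma_gaps[OF D(1) P, of "- 2 * int g"] D(3) g unfolding assms(10) N1 \<Gamma>_def by simp_all
  moreover have "card N2 = g" "card G2 = g"
    using card_Gamma_gaps[OF B(1) P, of 0] B(2) g unfolding assms(11) N2 \<Gamma>_def by simp_all
  moreover have "card N3 = g" "card G3 = g"
    using card_Gamma_gaps[OF D(2) P, of "2 * int g"] D(4) g unfolding assms(12) N3 \<Gamma>_def by simp_all
  moreover have "I_set emb P B0 (C0 +\<^sub>c point_class emb (2 * int g) Q) = N2 \<union> G3"
  proof -
    have "B0 -\<^sub>c ?cl (C + X) = ?cl D3"
      using class_minus_divisor_class[OF B(1) divisors_add[OF C(1) X(1)]]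
      by (simp add: B(3) D3_def diff_diff_eq)
    then have I: "I_set emb P B0 (C0 +\<^sub>c point_class emb (2 * int g) Q) = {i. \<Gamma> B i \<and> \<not> \<Gamma> D3 i}"
      unfolding I_set_def eC by (simp add: B(3) add_kP B(1) D(2) \<Gamma>_def)
    \<comment> \<open>For \<open>i < 0\<close> the degree of \<open>B + iP\<close> is negative, and
      for \<open>i >= 4g\<close> that of \<open>D3 + iP\<close> is at least \<open>2g\<close>, so
      neither range contributes. On the first interval \<open>D3 + iP\<close> has negative degree,
      on the second \<open>B + iP\<close> has degree at least \<open>2g\<close>; hence a single
      condition is left on each.\<close>
    show ?thesis unfolding I assms(12) N2 N3
    proof (intro equalityI subsetI)
      fix i assume i: "i \<in> {i. \<Gamma> B i \<and> \<not> \<Gamma> D3 i}"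
      then have "0 \<le> i" "i < 4 * int g"
        using notin\<Gamma>[OF B(1), of i] in\<Gamma>[OF D(2), of i] B(2) D(4) by force+
      then show "i \<in> {k \<in> {0..2 * int g - 1}. \<Gamma> B k} \<union>
          ({2 * int g..4 * int g - 1} - {k \<in> {2 * int g..4 * int g - 1}. \<Gamma> D3 k})"
        using i by auto
    next
      fix i assume "i \<in> {k \<in> {0..2 * int g - 1}. \<Gamma> B k} \<union>
          ({2 * int g..4 * int g - 1} - {k \<in> {2 * int g..4 * int g - 1}. \<Gamma> D3 k})"
      then show "i \<in> {i. \<Gamma> B i \<and> \<not> \<Gamma> D3 i}"
        using in\<Gamma>[OF B(1), of i] notin\<Gamma>[OF D(2), of i] B(2) D(4) by auto
    qed
  qed
  moreover have "I_set emb P (B0 -\<^sub>c C0 +\<^sub>c point_class emb (2 * int g) Q)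
        (class_uminus C0 +\<^sub>c point_class emb (2 * int g) Q) = N1 \<union> G2"
  proof -
    \<comment> \<open>In \<open>D1 - (- C + X)\<close> both \<open>C\<close> and \<open>X\<close>
      cancel, so the second condition concerns \<open>B\<close>. The case distinction is then the
      previous one with cut points \<open>-2g\<close>, 0 and \<open>2g\<close>.\<close>
    have "?cl D1 -\<^sub>c ?cl (- C + X) = ?cl B"
      using class_minus_divisor_class[OF D(1) divisors_add[OF divisors_uminus[OF C(1)] X(1)]]
      by (simp add: D1_def)
    then have I: "I_set emb P (?cl D1) (?cl (- C + X)) = {i. \<Gamma> D1 i \<and> \<not> \<Gamma> B i}"
      unfolding I_set_def by (simp add: add_kP B(1) D(1) \<Gamma>_def)
    show ?thesis unfolding e1 eC' I assms(11) N1 N2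
    proof (intro equalityI subsetI)
      fix i assume i: "i \<in> {i. \<Gamma> D1 i \<and> \<not> \<Gamma> B i}"
      then have "- 2 * int g \<le> i" "i < 2 * int g"
        using notin\<Gamma>[OF D(1), of i] in\<Gamma>[OF B(1), of i] B(2) D(3) by force+
      then show "i \<in> {k \<in> {- 2 * int g..-1}. \<Gamma> D1 k} \<union>
          ({0..2 * int g - 1} - {k \<in> {0..2 * int g - 1}. \<Gamma> B k})"
        using i by auto
    next
      fix i assume "i \<in> {k \<in> {- 2 * int g..-1}. \<Gamma> D1 k} \<union>
          ({0..2 * int g - 1} - {k \<in> {0..2 * int g - 1}. \<Gamma> B k})"
      then show "i \<in> {i. \<Gamma> D1 i \<and> \<not> \<Gamma> B i}"
        using in\<Gamma>[OF D(1), of i] notin\<Gamma>[OF B(1), of i] B(2) D(3) by auto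
    qed
  qed
  ultimately show ?thesis by blast
qed

end
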